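(* Let $d\geq 3$ and, for $i=1,2$, let $x_i\in\mathbb{R}^d$ and $y_i,\tau_i,b_i>0$ be given, with $x_1\neq x_2$. For each natural number $N$, let $(V^N_i,X^N_i)$, $i=1,2$, be Ornstein--Uhlenbeck velocity-position processes in $\mathbb{R}^d$ satisfying $$dV^N_i(t)=Nb_i\,dB^i_t-N\tau_iV^N_i(t)\,dt,\quad dX^N_i(t)=V^N_i(t)\,dt,\quad V^N_i(0)=0,\quad X^N_i(0)=x_i,$$ with $B^1,B^2$ independent standard Brownian motions in $\mathbb{R}^d$. Let $r_N>0$ (the sum of the radii of the two particles) and set $$T=\inf\{t\geq 0:|X^N_1(t)-X^N_2(t)|\leq r_N\},\qquad X(T)=\frac{y_1X^N_1(T)+y_2X^N_2(T)}{y_1+y_2}.$$ Suppose that $r_N>N^{-\alpha}$ for some $\alpha<\frac12$ and that $r_N\to0$ as $N\to\infty$. Let $g$ be a uniformly continuous and bounded function on $[0,\infty)\times\mathbb{R}^d$, supported on $[t_0,t_1]\times\mathbb{R}^d$ with $0<t_0<t_1$. Then, as $N\to\infty$, $$\left|(r_N)^{2-d}\,\mathbb{E}[g(T,X(T))]-c_d\Big[\Big(\frac{b_1}{\tau_1}\Big)^2+\Big(\frac{b_2}{\tau_2}\Big)^2\Big]\int_{t_0}^{t_1}\int_{\mathbb{R}^d}q_1(0,x_1;t,z)q_2(0,x_2;t,z)g(t,z)\,dz\,dt\right|\to0,$$ where $q_i$ is the transition density of the $d$-dimensional Brownian motion with diffusivity $a_i=(b_i/\tau_i)^2$ and $$\frac{1}{c_d}=\int_0^\infty\frac{1}{(2\pi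 t)^{d/2}}e^{-\frac{1}{2t}}\,dt.$$
   Context: A Brownian motion with diffusivity $a$ is $\sqrt a$ times a standard Brownian motion; thus $q_i(0,x;t,z)=(2\pi a_it)^{-d/2}e^{-|x-z|^2/(2a_it)}$. On the event $T=\infty$, $g(T,X(T))$ is taken to be $0$. *)

theory Defs
  imports "HOL-Probability.Probability"
begin

(* q(s,x;t,z) for d-dimensional Brownian motion with diffusivity a, i.e. sqrt a times a
   standard one; meaningful for a > 0 and s < t. *)
definition bm_density ::
  "real \<Rightarrow> real \<Rightarrow> real ^ 'd \<Rightarrow> real \<Rightarrow> real ^ 'd \<Rightarrow> real" where
  "bm_density a s x t z =
     (2 * pi * a * (t - s)) powr (- real CARD('d) / 2) *
     exp (- (norm (z - x))\<^sup>2 / (2 * a * (t - s)))"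

definition std_brownian_motion :: "'w measure \<Rightarrow> (real \<Rightarrow> 'w \<Rightarrow> real ^ 'd) \<Rightarrow> bool" where
  "std_brownian_motion M B \<longleftrightarrow>
     prob_space M \<and>
     (\<forall>t\<ge>0. B t \<in> borel_measurable M) \<and>
     (AE \<omega> in M. B 0 \<omega> = 0) \<and>
     (AE \<omega> in M. continuous_on {0..} (\<lambda>t. B t \<omega>)) \<and>
     (\<forall>s t. 0 \<le> s \<and> s < t \<longrightarrow>
        distributed M lborel (\<lambda>\<omega>. B t \<omega> - B s \<omega>) (\<lambda>z. ennreal (bm_density 1 s 0 t z))) \<and>
     (\<forall>(n::nat) (t::nat \<Rightarrow> real). 0 \<le> t 0 \<and> (\<forall>k<n. t k \<le> t (Suc k)) \<longrightarrow>
        prob_space.indep_vars M (\<lambda>_. borel) (\<lambda>k \<omega>. B (t (Suc k)) \<omega> - B (t k) \<omega>) {..<n})"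

(* dV = \<sigma> dB - \<theta> V dt, dX = V dt, V(0) = 0, X(0) = x.  The noise is additive, so the
   stochastic integral of the constant \<sigma> is \<sigma> (B(t) - B(0)) and the equations, in integrated
   form, hold pathwise.  Measurability of V(t) and X(t) with respect to the completion of M
   is a consequence. *)
definition ou_process ::
  "'w measure \<Rightarrow> (real \<Rightarrow> 'w \<Rightarrow> real ^ 'd) \<Rightarrow> real \<Rightarrow> real \<Rightarrow> real ^ 'd \<Rightarrow>
   (real \<Rightarrow> 'w \<Rightarrow> real ^ 'd) \<Rightarrow> (real \<Rightarrow> 'w \<Rightarrow> real ^ 'd) \<Rightarrow> bool" where
  "ou_process M B \<sigma> \<theta> x V X \<longleftrightarrow>
     (AE \<omega> in M.
        continuous_on {0..} (\<lambda>t. V t \<omega>) \<and>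
        V 0 \<omega> = 0 \<and> X 0 \<omega> = x \<and>
        (\<forall>t\<ge>0. V t \<omega> = \<sigma> *\<^sub>R (B t \<omega> - B 0 \<omega>) - \<theta> *\<^sub>R integral {0..t} (\<lambda>s. V s \<omega>)) \<and>
        (\<forall>t\<ge>0. X t \<omega> = x + integral {0..t} (\<lambda>s. V s \<omega>)))"

(* Equal to \<infinity> if the two paths never come within distance r. *)
definition collision_time ::
  "real \<Rightarrow> (real \<Rightarrow> real ^ 'd) \<Rightarrow> (real \<Rightarrow> real ^ 'd) \<Rightarrow> ereal" where
  "collision_time r \<xi> \<eta> = (INF t\<in>{t. 0 \<le> t \<and> norm (\<xi> t - \<eta> t) \<le> r}. ereal t)"

(* g(T, X(T)) along a pair of paths, where X is their (u,v)-weighted mean. *)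
definition collision_value ::
  "(real \<times> (real ^ 'd) \<Rightarrow> real) \<Rightarrow> real \<Rightarrow> real \<Rightarrow> real \<Rightarrow>
   (real \<Rightarrow> real ^ 'd) \<Rightarrow> (real \<Rightarrow> real ^ 'd) \<Rightarrow> real" where
  "collision_value g u v r \<xi> \<eta> =
     (let T = collision_time r \<xi> \<eta>; t = real_of_ereal T
      in if T = \<infinity> then 0 else g (t, (u *\<^sub>R \<xi> t + v *\<^sub>R \<eta> t) /\<^sub>R (u + v)))"

definition collision_const :: "nat \<Rightarrow> real" where
  "collision_const d =
     1 / (LINT t:{0<..}|lborel. 1 / (2 * pi * t) powr (real d / 2) * exp (- 1 / (2 * t)))"

end

theory Submission
  imports Defs "HOL-Real_Asymp.Real_Asymp"
begin

text \<open>
  Solving the Ornstein--Uhlenbeck equations gives \<open>X(t) = x + (b/\<tau>) B(t) + O(N\<^sup>-\<^sup>1\<^sup>/\<^sup>2)\<close>, up to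
  logarithms and off an event whose probability beats every power of \<open>N\<close>; since \<open>r \<ge> N\<^sup>-\<^sup>\<alpha>\<close> with
  \<open>\<alpha> < 1/2\<close>, the error is at most \<open>\<epsilon> r\<close>.  So at the collision time \<open>T\<close>, a stopping time of the driving
  Brownian motions, the Brownian separation \<open>R\<close> has norm within \<open>\<epsilon> r\<close> of \<open>r\<close>, and before \<open>T\<close> its norm
  exceeds \<open>(1 - \<epsilon>) r\<close>.

  Let \<open>Z\<close> be the weighted centre, \<open>a\<close> the diffusivity of \<open>R\<close>, and \<open>p_s\<close> the heat kernel, and compute the
  expectation of \<open>J = \<integral> g(t, Z(t)) p_\<delta>(R(t)) dt\<close> with \<open>\<delta> = (\<epsilon> r)\<^sup>2\<close> in two ways.  As \<open>\<delta> \<longlongrightarrow> 0\<close> it tends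
  to \<open>\<integral>\<integral> q\<^sub>1 q\<^sub>2 g\<close>.  On the other hand the contribution of times before \<open>T\<close> is negligible, because \<open>p_\<delta>\<close> is
  tiny at distance \<open>(1 - \<epsilon>) r\<close>, and by the strong Markov property at \<open>T\<close> the rest is close to
  \<open>g(T, Z(T)) \<integral>\<^sub>0 p\<^bsub>\<delta> + a u\<^esub>(R(T)) du\<close>, whose second factor is close to \<open>r\<^sup>2\<^sup>-\<^sup>d / (a c\<^sub>d)\<close> by scaling.  With
  \<open>g = 1\<close> the same identity bounds the probability of a collision by a multiple of \<open>r\<^sup>d\<^sup>-\<^sup>2\<close>, which turns
  all errors into \<open>o(1)\<close>.
\<close>

section \<open>Gaussian kernels\<close>

text \<open>The stopping time is the collision time of the Ornstein-Uhlenbeck pair itself, so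
  hitting times of two different processes are never compared, only positions at one time. The
  kernel p_\<delta> stands in for the singular harmonic function |y|^(2-d): it is bounded and
  continuous, so Fubini and the strong Markov property for bounded continuous functions suffice,
  without stochastic calculus. The scale \<delta> = (\<epsilon> r)^2 is forced from both sides:
  \<delta> / r^2 must be small for the kernel to be negligible before the collision, yet sup
  p_\<delta> must stay of order r^(-d), a power that the probability of the bad event absorbs.
  Freezing \<open>g\<close> at the collision costs \<eta> times the kernel plus a constant that does
  not shrink with \<delta>; the constant is harmless because it is paid only on collisions. Hence
  the order of choice: \<eta> and the modulus of continuity of \<open>g\<close>, then \<epsilon>,
  then \<open>N\<close>. A finite horizon \<open>K\<close> beyond \<open>t1\<close> keeps the time
  integrals finite and loses nothing, since \<open>g\<close> vanishes after \<open>t1\<close> and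
  r^2 is small against \<open>K - t1\<close>.\<close>

definition gauss :: "real \<Rightarrow> 'a::euclidean_space \<Rightarrow> real" where
  "gauss s y = (2 * pi * s) powr (- real DIM('a) / 2) * exp (- (norm y)\<^sup>2 / (2 * s))"

definition std_gauss :: "'a::euclidean_space measure" where
  "std_gauss = density lborel (\<lambda>z. ennreal (gauss 1 z))"

lemma bm_density_eq_gauss: "bm_density a s x t z = gauss (a * (t - s)) (z - x)"
  by (simp add: bm_density_def gauss_def mult.assoc)

lemma gauss_nonneg [simp]: "gauss s y \<ge> 0"
  by (simp add: gauss_def)

lemma gauss_measurable [measurable]: "gauss s \<in> borel_measurable borel"
  unfolding gauss_def by measurable

lemma gauss_uminus [simp]: "gauss s (- y) = gauss s y"
  by (simp add: gauss_def)

lemma gauss_le: "s > 0 \<Longrightarrow> gauss s (y::'a::euclidean_space) \<le> (2 * pi * s) powr (- real DIM('a) / 2)"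
  unfolding gauss_def by (intro mult_right_le_one_le) auto

lemma gauss_le_mono: 
  assumes "0 < s0" "s0 \<le> s"
  shows "gauss s (y::'a::euclidean_space) \<le> (2 * pi * s0) powr (- real DIM('a) / 2)"
proof -
  have "gauss s y \<le> (2 * pi * s) powr (- real DIM('a) / 2)"
    using assms by (intro gauss_le) auto
  also have "\<dots> \<le> (2 * pi * s0) powr (- real DIM('a) / 2)"
    using assms by (intro powr_mono2') auto
  finally show ?thesis .
qed

lemma continuous_gauss [continuous_intros]:
  fixes f :: "'b::topological_space \<Rightarrow> 'a::euclidean_space"
  assumes "continuous_on S f" "s > 0"
  shows "continuous_on S (\<lambda>w. gauss s (f w))"
  unfolding gauss_def using assms by (auto intro!: continuous_intros)

text \<open>The kernel factorises into one-dimensional normal densities over the basis, so the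
  integral is a product of ones.\<close>

lemma nn_integral_gauss:
  assumes "s > 0"
  shows "(\<integral>\<^sup>+ y. ennreal (gauss s (y::'a::euclidean_space)) \<partial>lborel) = 1"
proof -
  have "gauss s y = (\<Prod>b\<in>Basis. normal_density 0 (sqrt s) (y \<bullet> b))" for y :: 'a
  proof -
    have n2: "(norm y)\<^sup>2 = (\<Sum>b\<in>Basis. (y \<bullet> b)\<^sup>2)"
      unfolding power2_norm_eq_inner by (subst euclidean_inner) (simp add: power2_eq_square)
    have "(\<Prod>b\<in>Basis. normal_density 0 (sqrt s) (y \<bullet> b))
        = (1 / sqrt (2 * pi * s)) ^ DIM('a) * exp (- (norm y)\<^sup>2 / (2 * s))"
      using assms by (simp add: normal_density_def n2 prod.distrib exp_sum[symmetric]
          prod_dividef sum_negf sum_divide_distrib power_one_over)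
    also have "(1 / sqrt (2 * pi * s)) ^ DIM('a) = (2 * pi * s) powr (- real DIM('a) / 2)"
      using assms by (simp add: powr_half_sqrt[symmetric] powr_realpow[symmetric] powr_powr 
          powr_minus_divide power_one_over mult.commute powr_minus)
    finally show ?thesis by (simp add: gauss_def)
  qed
  then have "(\<integral>\<^sup>+ y. ennreal (gauss s (y::'a)) \<partial>lborel)
     = (\<integral>\<^sup>+ y. (\<Prod>b\<in>Basis. ennreal (normal_density 0 (sqrt s) ((y::'a) \<bullet> b))) \<partial>lborel)"
    by (simp add: prod_ennreal)
  also have "\<dots> = (\<Prod>b\<in>(Basis::'a set). \<integral>\<^sup>+ y. ennreal (normal_density 0 (sqrt s) y) \<partial>lborel)"
    by (rule nn_integral_lborel_prod) auto
  also have "\<dots> = 1"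
  proof -
    have "(\<integral>\<^sup>+ y. ennreal (normal_density 0 (sqrt s) y) \<partial>lborel) = 1"
      using assms by (subst nn_integral_eq_integral) (auto simp: integrable_normal_density)
    then show ?thesis by simp
  qed
  finally show ?thesis .
qed

lemma integrable_gauss: "s > 0 \<Longrightarrow> integrable lborel (gauss s :: 'a::euclidean_space \<Rightarrow> real)"
  using nn_integral_gauss[of s, where 'a='a] by (intro integrableI_nonneg) auto

lemma integral_gauss: "s > 0 \<Longrightarrow> (LINT y|lborel. gauss s (y::'a::euclidean_space)) = 1"
  using nn_integral_gauss[of s, where 'a='a] by (simp add: integral_eq_nn_integral)

lemma prob_space_std_gauss: "prob_space (std_gauss :: 'a::euclidean_space measure)"
  unfolding std_gauss_def
  using nn_integral_gauss[of 1, where 'a='a] by (intro prob_spaceI) (simp add: emeasure_density)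

lemma sets_std_gauss [simp, measurable_cong]: "sets std_gauss = sets borel"
  and space_std_gauss [simp]: "space std_gauss = UNIV"
  by (simp_all add: std_gauss_def)

lemma integral_std_gauss:
  fixes f :: "'a::euclidean_space \<Rightarrow> real"
  assumes [measurable]: "f \<in> borel_measurable borel"
  shows "(LINT z|std_gauss. f z) = (LINT z|lborel. gauss 1 z * f z)"
  unfolding std_gauss_def by (subst integral_density) auto

text \<open>Brownian scaling: the exponent is invariant, and the Jacobian cancels the factor that
  the normalisation picks up.\<close>

lemma gauss_scale:
  assumes "c \<noteq> 0" "s > 0"
  shows "\<bar>c\<bar> ^ DIM('a) * gauss (c\<^sup>2 * s) (c *\<^sub>R (y::'a::euclidean_space)) = gauss s y"
proof -
  have *: "(2 * pi * (c\<^sup>2 * s)) powr (- real DIM('a) / 2) 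
     = (2 * pi * s) powr (- real DIM('a) / 2) * (c\<^sup>2) powr (- real DIM('a) / 2)"
    using assms by (subst powr_mult[symmetric]) (auto simp: ac_simps)
  have "(c\<^sup>2) powr (- real DIM('a) / 2) = \<bar>c\<bar> powr (- real DIM('a))"
    using assms powr_powr[of "\<bar>c\<bar>" 2 "- real DIM('a) / 2"] by simp
  then have "\<bar>c\<bar> ^ DIM('a) * (c\<^sup>2) powr (- real DIM('a) / 2) = 1"
    using assms by (simp add: powr_minus powr_realpow)
  then have "\<bar>c\<bar> ^ DIM('a) * (2 * pi * (c\<^sup>2 * s)) powr (- real DIM('a) / 2) = (2 * pi * s) powr (- real DIM('a) / 2)"
    unfolding * by (simp add: ac_simps)
  then show ?thesis
    using assms unfolding gauss_def 
    by (simp add: power_mult_distrib mult.assoc[symmetric]) 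
qed

lemma integral_std_gauss_affine:
  fixes f :: "'a::euclidean_space \<Rightarrow> real"
  assumes [measurable]: "f \<in> borel_measurable borel" and "c \<noteq> 0"
  shows "(LINT z|std_gauss. f (x + c *\<^sub>R z)) = (LINT v|lborel. gauss (c\<^sup>2) (v - x) * f v)"
proof -
  have "(LINT v|lborel. gauss (c\<^sup>2) (v - x) * f v) 
     = (LINT v|density (distr lborel borel (\<lambda>z. x + c *\<^sub>R z)) (\<lambda>_. \<bar>c\<bar> ^ DIM('a)). gauss (c\<^sup>2) (v - x) * f v)"
    by (simp add: lborel_affine[OF \<open>c \<noteq> 0\<close>, of x, symmetric])
  also have "\<dots> = (LINT z|lborel. \<bar>c\<bar> ^ DIM('a) * (gauss (c\<^sup>2) (c *\<^sub>R z) * f (x + c *\<^sub>R z)))"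
    by (subst integral_density) (auto simp: integral_distr)
  also have "\<dots> = (LINT z|lborel. gauss 1 z * f (x + c *\<^sub>R z))"
    using gauss_scale[OF \<open>c \<noteq> 0\<close>, of 1, where 'a='a] by (simp add: mult.assoc[symmetric])
  finally show ?thesis by (simp add: integral_std_gauss)
qed

text \<open>Completing the square.\<close>

lemma gauss_convolution:
  fixes v :: "'a::euclidean_space"
  assumes "\<alpha> > 0"
  shows "(LINT z|std_gauss. gauss \<alpha> (v + c *\<^sub>R z)) = gauss (\<alpha> + c\<^sup>2) v"
proof -
  define \<beta> where "\<beta> = \<alpha> + c\<^sup>2"
  \<comment> \<open>\<open>- m\<close> and \<open>\<alpha> / \<beta>\<close> are the mean and the
    variance of the standard normal \<open>z\<close> after tilting by the factor
    \<open>gauss \<alpha> (v + c *\<^sub>R z)\<close>.\<close>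
  define m where "m = (c / \<beta>) *\<^sub>R v"
  have b: "\<beta> > 0" "\<beta> \<ge> \<alpha>" using assms by (auto simp: \<beta>_def intro: add_pos_nonneg)
  have sq: "(norm z)\<^sup>2 / 2 + (norm (v + c *\<^sub>R z))\<^sup>2 / (2 * \<alpha>) 
      = (norm v)\<^sup>2 / (2 * \<beta>) + (norm (z - (- m)))\<^sup>2 / (2 * (\<alpha> / \<beta>))" for z :: 'a
  proof -
    have "(norm (v + c *\<^sub>R z))\<^sup>2 = v \<bullet> v + 2 * c * (v \<bullet> z) + c\<^sup>2 * (z \<bullet> z)"
      by (simp only: power2_norm_eq_inner) (simp add: algebra_simps inner_commute power2_eq_square)
    moreover have "(norm (z - (- m)))\<^sup>2 = z \<bullet> z + 2 * (c / \<beta>) * (v \<bullet> z) + (c / \<beta>)\<^sup>2 * (v \<bullet> v)"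
      by (simp only: power2_norm_eq_inner m_def) (simp add: algebra_simps inner_commute power2_eq_square)
    moreover have "z \<bullet> z / 2 + (v \<bullet> v + 2 * c * (v \<bullet> z) + c\<^sup>2 * (z \<bullet> z)) / (2 * \<alpha>)
       = v \<bullet> v / (2 * \<beta>) + (z \<bullet> z + 2 * (c / \<beta>) * (v \<bullet> z) + (c / \<beta>)\<^sup>2 * (v \<bullet> v)) / (2 * (\<alpha> / \<beta>))"
    proof -
      have c2: "c\<^sup>2 = \<beta> - \<alpha>" by (simp add: \<beta>_def)
      have "(c / \<beta>)\<^sup>2 = (\<beta> - \<alpha>) / \<beta>\<^sup>2" using c2 by (simp add: power_divide)
      then show ?thesis using b assms unfolding \<open>(c / \<beta>)\<^sup>2 = _\<close> c2
        by (simp add: divide_simps power2_eq_square) (simp add: algebra_simps)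
    qed
    ultimately show ?thesis by (simp add: power2_norm_eq_inner)
  qed
  have pref: "(2 * pi) powr (- real DIM('a) / 2) * (2 * pi * \<alpha>) powr (- real DIM('a) / 2)
      = (2 * pi * \<beta>) powr (- real DIM('a) / 2) * (2 * pi * (\<alpha> / \<beta>)) powr (- real DIM('a) / 2)"
    using b assms by (subst (1 2) powr_mult[symmetric]) (auto simp: field_simps)
  have "gauss 1 z * gauss \<alpha> (v + c *\<^sub>R z) = gauss \<beta> v * gauss (\<alpha> / \<beta>) (z - (- m))" for z :: 'a
  proof -
    have "gauss 1 z * gauss \<alpha> (v + c *\<^sub>R z) 
      = ((2 * pi) powr (- real DIM('a) / 2) * (2 * pi * \<alpha>) powr (- real DIM('a) / 2)) 
         * exp (- ((norm z)\<^sup>2 / 2 + (norm (v + c *\<^sub>R z))\<^sup>2 / (2 * \<alpha>)))"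
      by (simp add: gauss_def exp_add[symmetric] algebra_simps)
    also have "\<dots> = gauss \<beta> v * gauss (\<alpha> / \<beta>) (z - (- m))"
      unfolding sq pref by (simp add: gauss_def exp_add[symmetric] mult.assoc mult.left_commute exp_diff exp_minus field_simps)
    finally show ?thesis .
  qed
  then have "(LINT z|std_gauss. gauss \<alpha> (v + c *\<^sub>R z)) 
       = (LINT z|lborel. gauss \<beta> v * gauss (\<alpha> / \<beta>) (z - (- m)))"
    by (subst integral_std_gauss) auto
  also have "\<dots> = gauss \<beta> v * (LINT z|lborel. gauss (\<alpha> / \<beta>) (z::'a))"
  proof -
    have "(LINT z|lborel. gauss (\<alpha> / \<beta>) (m + z)) = (LINT z|distr lborel borel ((+) m). gauss (\<alpha> / \<beta>) z)"
      by (subst integral_distr) auto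
    then show ?thesis by (simp add: lborel_distr_plus add.commute)
  qed
  finally show ?thesis using integral_gauss[of "\<alpha> / \<beta>", where 'a='a] b assms by (simp add: \<beta>_def)
qed

lemma gauss_convolution2:
  fixes v :: "'a::euclidean_space"
  assumes "\<alpha> > 0"
  shows "(LINT z|std_gauss. LINT z'|std_gauss. gauss \<alpha> (v + c *\<^sub>R z + c' *\<^sub>R z')) = gauss (\<alpha> + c'\<^sup>2 + c\<^sup>2) v"
  using gauss_convolution[of "\<alpha> + c'\<^sup>2"] assms by (simp only: gauss_convolution add_pos_nonneg zero_le_power2)

section \<open>Bounds on the kernel that are uniform in time, and Gaussian tails\<close>

lemma powr_exp_bounded:
  fixes c m :: real
  assumes "c > 0" "m > 0"
  shows "\<exists>C>0. \<forall>s>0. s powr (- m) * exp (- c / s) \<le> C"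
proof -
  \<comment> \<open>With u = 1 / s the claim is that u^m exp(-c u) is bounded for u > 0: it is below
    1 beyond some \<open>U\<close>, and at most |U|^m before it.\<close>
  have "((\<lambda>u. u powr m * exp (- c * u)) \<longlongrightarrow> 0) at_top"
    using assms by real_asymp
  then have "eventually (\<lambda>u. u powr m * exp (- c * u) < 1) at_top"
    by (rule order_tendstoD) simp
  then obtain U where U: "\<And>u. u \<ge> U \<Longrightarrow> u powr m * exp (- c * u) < 1"
    by (auto simp: eventually_at_top_linorder)
  have "s powr (- m) * exp (- c / s) \<le> 1 + \<bar>U\<bar> powr m" if "s > 0" for s
  proof (cases "1 / s \<ge> U")
    case True
    have "s powr (- m) = (1 / s) powr m" using that by (simp add: powr_minus_divide powr_divide)
    then show ?thesis using U[OF True] by (simp add: add_increasing2)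
  next
    case False
    have "s powr (- m) = (1 / s) powr m" using that by (simp add: powr_minus_divide powr_divide)
    also have "\<dots> \<le> \<bar>U\<bar> powr m" using False that assms by (intro powr_mono2) auto
    finally have "s powr (- m) * exp (- c / s) \<le> \<bar>U\<bar> powr m * 1"
      using that assms by (intro mult_mono) auto
    then show ?thesis by simp
  qed
  then show ?thesis by (intro exI[of _ "1 + \<bar>U\<bar> powr m"]) (auto intro: add_pos_nonneg)
qed

text \<open>At \<open>y\<close> = x1 - x2 this bounds the density of the separation at the origin
  uniformly in time: distinct starting points prevent a blow-up at time 0.\<close>

lemma gauss_bounded_off_origin:
  fixes y :: "'a::euclidean_space"
  assumes "y \<noteq> 0"
  shows "\<exists>C>0. \<forall>s>0. gauss s y \<le> C"
proof -
  obtain C where C: "C > 0" "\<And>s. s > 0 \<Longrightarrow> s powr (- (real DIM('a) / 2)) * exp (- ((norm y)\<^sup>2 / 2) / s) \<le> C"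
    using powr_exp_bounded[of "(norm y)\<^sup>2 / 2" "real DIM('a) / 2"] assms by auto
  have "gauss s y \<le> (2 * pi) powr (- real DIM('a) / 2) * C" if "s > 0" for s
    using C(2)[OF that] that by (simp add: gauss_def powr_mult mult.assoc)
  then show ?thesis using C(1) by (intro exI[of _ "(2 * pi) powr (- real DIM('a) / 2) * C"]) auto
qed

text \<open>Half of the exponent is spent on the tail factor; the other half is again a Gaussian, of
  variance 2 and mass 1. The constant is the ratio of the two normalisations.\<close>

lemma std_gauss_tail:
  assumes "l \<ge> 0"
  shows "measure (std_gauss :: 'a::euclidean_space measure) {z. norm z \<ge> l} \<le> 2 powr (real DIM('a) / 2) * exp (- l\<^sup>2 / 4)"
proof -
  interpret prob_space "std_gauss :: 'a measure" by (rule prob_space_std_gauss)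
  have le: "indicator {z. norm z \<ge> l} z * gauss 1 z \<le> 2 powr (real DIM('a) / 2) * exp (- l\<^sup>2 / 4) * gauss 2 z" for z :: 'a
  proof (cases "norm z \<ge> l")
    case True
    then have "l\<^sup>2 \<le> (norm z)\<^sup>2" using assms by (intro power_mono) auto
    then have "exp (- (norm z)\<^sup>2 / 2) \<le> exp (- l\<^sup>2 / 4) * exp (- (norm z)\<^sup>2 / 4)"
      by (simp add: exp_add[symmetric])
    moreover have "(2 * pi) powr (- real DIM('a) / 2) = 2 powr (real DIM('a) / 2) * (2 * pi * 2) powr (- real DIM('a) / 2)"
    proof -
      have "(2 * pi * 2) powr (- real DIM('a) / 2) = (2 * pi) powr (- real DIM('a) / 2) * 2 powr (- real DIM('a) / 2)"
        by (subst powr_mult) auto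
      then show ?thesis by (simp add: powr_minus field_simps)
    qed
    ultimately show ?thesis using True unfolding gauss_def
      by (simp add: mult.assoc mult.left_commute)
  qed auto
  have "measure (std_gauss :: 'a measure) {z. norm z \<ge> l} = (LINT z|(std_gauss::'a measure). indicator {z. norm z \<ge> l} z)"
    by simp
  also have "\<dots> = (LINT z|lborel. gauss 1 z * indicator {z. norm (z::'a) \<ge> l} z)"
    by (subst integral_std_gauss) auto
  also have "\<dots> \<le> (LINT z|lborel. 2 powr (real DIM('a) / 2) * exp (- l\<^sup>2 / 4) * gauss 2 (z::'a))"
  proof (rule integral_mono)
    show "integrable lborel (\<lambda>z. gauss 1 z * indicator {z. norm (z::'a) \<ge> l} z)"
      by (rule Bochner_Integration.integrable_bound[OF integrable_gauss[of 1]]) (auto split: split_indicator)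
    show "integrable lborel (\<lambda>z. 2 powr (real DIM('a) / 2) * exp (- l\<^sup>2 / 4) * gauss 2 (z::'a))"
      by (intro integrable_mult_right integrable_gauss) auto
  qed (use le in \<open>simp add: mult.commute\<close>)
  also have "\<dots> = 2 powr (real DIM('a) / 2) * exp (- l\<^sup>2 / 4)"
    by (simp add: integral_gauss)
  finally show ?thesis .
qed

text \<open>The same halving of the exponent as in \<open>std_gauss_tail\<close>, kept pointwise.
  What remains is again a heat kernel, at doubled time, so its expectation along the Brownian pair
  stays bounded however small \<open>s\<close> is.\<close>

lemma gauss_off_ball:
  fixes y :: "'a::euclidean_space"
  assumes "s > 0" "0 \<le> \<rho>" "\<rho> \<le> norm y"
  shows "gauss s y \<le> 2 powr (real DIM('a) / 2) * exp (- \<rho>\<^sup>2 / (4 * s)) * gauss (2 * s) y"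
proof -
  have "\<rho>\<^sup>2 \<le> (norm y)\<^sup>2" using assms by (intro power_mono) auto
  then have e: "exp (- (norm y)\<^sup>2 / (2 * s)) \<le> exp (- \<rho>\<^sup>2 / (4 * s)) * exp (- (norm y)\<^sup>2 / (2 * (2 * s)))"
    using assms by (simp add: exp_add[symmetric] field_simps)
  have p: "(2 * pi * s) powr (- real DIM('a) / 2) = 2 powr (real DIM('a) / 2) * (2 * pi * (2 * s)) powr (- real DIM('a) / 2)"
  proof -
    have "(2 * pi * (2 * s)) powr (- real DIM('a) / 2) = (2 * pi * s) powr (- real DIM('a) / 2) * 2 powr (- real DIM('a) / 2)"
      using assms by (subst powr_mult[symmetric]) (auto simp: ac_simps)
    then show ?thesis by (simp add: powr_minus field_simps)
  qed
  have "gauss s y \<le> (2 * pi * s) powr (- real DIM('a) / 2) * (exp (- \<rho>\<^sup>2 / (4 * s)) * exp (- (norm y)\<^sup>2 / (2 * (2 * s))))"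
    unfolding gauss_def by (intro mult_left_mono e) auto
  then show ?thesis unfolding p by (simp add: gauss_def mult_ac)
qed

section \<open>The constant of the collision rate\<close>

text \<open>The heat kernel of dimension \<open>d\<close> at time \<open>v\<close> and at a point of
  norm 1, set to 0 for \<open>v\<close> \<le> 0. Its total mass is 1 / c_d.\<close>

definition theta :: "nat \<Rightarrow> real \<Rightarrow> real" where
  "theta d v = indicator {0<..} v * (1 / (2 * pi * v) powr (real d / 2) * exp (- 1 / (2 * v)))"

lemma theta_nonneg [simp]: "theta d v \<ge> 0"
  by (simp add: theta_def)

lemma theta_measurable [measurable]: "theta d \<in> borel_measurable borel"
  unfolding theta_def by measurable

lemma theta_bounded:
  assumes "d > 0"
  shows "\<exists>C>0. \<forall>v. theta d v \<le> C"
proof -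
  obtain C where C: "C > 0" "\<And>s. s > 0 \<Longrightarrow> s powr (- (real d / 2)) * exp (- (1/2) / s) \<le> C"
    using powr_exp_bounded[of "1/2" "real d / 2"] assms by auto
  have "theta d v \<le> (2 * pi) powr (- (real d / 2)) * C" for v
  proof (cases "v > 0")
    case True
    have "theta d v = (2 * pi) powr (- (real d / 2)) * (v powr (- (real d / 2)) * exp (- (1/2) / v))"
      using True by (simp add: theta_def powr_mult powr_minus divide_simps)
    then show ?thesis using C(2)[OF True] by simp
  qed (use C in \<open>auto simp: theta_def\<close>)
  then show ?thesis using C(1) by (intro exI[of _ "(2 * pi) powr (- (real d / 2)) * C"]) auto
qed

text \<open>Near 0 the exponential keeps the function bounded; beyond 1 it is at most v^(-3/2). The
  latter expresses transience of Brownian motion, and is where dimension at least 3 enters.\<close>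

lemma theta_integrable:
  assumes "d \<ge> 3"
  shows "integrable lborel (theta d)"
proof -
  obtain C where C: "C > 0" "\<And>v. theta d v \<le> C" using theta_bounded[of d] assms by auto
  have "integrable lborel (\<lambda>v::real. indicator {1..} v * v powr (- (3/2)) :: real)"
  proof -
    have "(\<integral>\<^sup>+ v. ennreal (v powr (- (3/2))) * indicator {1::real..} v \<partial>lborel) = ennreal (0 - (- 2 * 1 powr (- (1/2))))"
    proof (rule nn_integral_FTC_atLeast[where F = "\<lambda>v. - 2 * v powr (- (1/2))"])
      show "((\<lambda>v. - 2 * v powr (- (1/2))) \<longlongrightarrow> 0) (at_top :: real filter)"
        by real_asymp
      show "((\<lambda>v. - 2 * v powr (- (1/2))) has_real_derivative v powr (- (3/2))) (at v)" if "1 \<le> v" for v :: real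
        using that by (auto intro!: derivative_eq_intros)
    qed auto
    then have "(\<integral>\<^sup>+ v. ennreal (indicator {1..} v * v powr (- (3/2))) \<partial>lborel) < \<infinity>"
      by (simp add: ennreal_mult' ennreal_indicator mult.commute)
    then show ?thesis by (intro integrableI_nonneg) auto
  qed
  moreover have "integrable lborel (\<lambda>v::real. C * indicator {0..1} v :: real)"
    by (intro integrable_mult_right integrable_real_indicator) auto
  ultimately have "integrable lborel (\<lambda>v::real. C * indicator {0..1} v + indicator {1..} v * v powr (- (3/2)) :: real)"
    by (rule Bochner_Integration.integrable_add[rotated])
  then show ?thesis
  proof (rule Bochner_Integration.integrable_bound)
    show "AE v in lborel. norm (theta d v) \<le> norm (C * indicator {0..1} v + indicator {1..} v * v powr (- (3/2)) :: real)"
    proof (rule AE_I2)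
      fix v :: real
      consider "v \<le> 0" | "0 < v" "v \<le> 1" | "v > 1" by linarith
      then show "norm (theta d v) \<le> norm (C * indicator {0..1} v + indicator {1..} v * v powr (- (3/2)) :: real)"
      proof cases
        case 2
        then show ?thesis using C(2)[of v] C(1) by (simp add: abs_of_nonneg add_increasing2)
      next
        case 3
        have "v powr (3/2) \<le> (2 * pi * v) powr (3/2)"
        proof (rule powr_mono2)
          show "v \<le> 2 * pi * v" using 3 pi_gt3 by (intro mult_right_mono[of 1 "2 * pi" v, simplified]) linarith+
        qed (use 3 in auto)
        also have "\<dots> \<le> (2 * pi * v) powr (real d / 2)"
        proof (rule powr_mono)
          show "1 \<le> 2 * pi * v" using 3 pi_gt3 by (intro mult_mono[of 1 "2 * pi" 1 v, simplified]) linarith+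
        qed (use assms in auto)
        finally have "1 / (2 * pi * v) powr (real d / 2) * exp (- 1 / (2 * v)) \<le> 1 / v powr (3/2) * 1"
          using 3 by (intro mult_mono divide_left_mono) auto
        moreover have "norm (theta d v) = 1 / (2 * pi * v) powr (real d / 2) * exp (- 1 / (2 * v))"
          using 3 by (simp add: theta_def)
        moreover have "norm (C * indicator {0..1} v + indicator {1..} v * v powr (- (3/2)) :: real) = 1 / v powr (3/2) * 1"
          using 3 by (simp add: powr_minus_divide)
        ultimately show ?thesis by simp
      qed (use C in \<open>auto simp: theta_def indicator_def\<close>)
    qed
  qed auto
qed

text \<open>Guarantees that \<open>collision_const\<close> is a genuine reciprocal; a division by 0
  would silently give 0.\<close>

lemma theta_integral_pos:
  assumes "d \<ge> 3"
  shows "(LINT v|lborel. theta d v) > 0"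
proof -
  have "(LINT v|lborel. theta d v) \<noteq> 0"
  proof
    assume "(LINT v|lborel. theta d v) = 0"
    then have "AE v in lborel. theta d v = 0"
      using integral_nonneg_eq_0_iff_AE[OF theta_integrable[OF assms]] by simp
    then have "AE v in lborel. v \<notin> {0<..<1::real}"
      by eventually_elim (auto simp: theta_def)
    then have "{0<..<1::real} \<in> null_sets lborel"
      by (subst AE_iff_null_sets) auto
    then have "emeasure lborel {0<..<1::real} = 0" by (rule null_setsD1)
    then show False by simp
  qed
  moreover have "(LINT v|lborel. theta d v) \<ge> 0" by (rule integral_nonneg_AE) simp
  ultimately show ?thesis by linarith
qed

lemma collision_const_eq: "collision_const d = 1 / (LINT v|lborel. theta d v)"
  unfolding collision_const_def set_lebesgue_integral_def theta_def by simp

lemma collision_const_pos: "d \<ge> 3 \<Longrightarrow> collision_const d > 0"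
  using theta_integral_pos[of d] by (simp add: collision_const_eq)

text \<open>Thresholds rather than a limit along one sequence: the limits of integration to which
  this is applied depend on the scale and on the place and time of the collision.\<close>

lemma theta_integral_approx:
  assumes "d \<ge> 3" "\<eta> > 0"
  shows "\<exists>\<alpha>0>0. \<exists>\<beta>0>0. \<forall>\<alpha> \<beta>. \<alpha> \<le> \<alpha>0 \<longrightarrow> \<beta> \<ge> \<beta>0 \<longrightarrow>
    (LINT v:{\<alpha>..\<beta>}|lborel. theta d v) \<le> (LINT v|lborel. theta d v) \<and>
    (LINT v:{\<alpha>..\<beta>}|lborel. theta d v) \<ge> (LINT v|lborel. theta d v) - \<eta>"
proof -
  note int = theta_integrable[OF assms(1)]
  have iS: "integrable lborel (\<lambda>v. indicator {a..b} v *\<^sub>R theta d v)" for a b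
    using int by (rule integrable_mult_indicator[rotated]) auto
  have "(\<lambda>n. LINT v|lborel. indicator {1 / real (Suc n)..real (Suc n)} v *\<^sub>R theta d v) \<longlonglongrightarrow> (LINT v|lborel. theta d v)"
  proof (rule integral_dominated_convergence[OF _ _ int])
    show "AE v in lborel. (\<lambda>n. indicator {1 / real (Suc n)..real (Suc n)} v *\<^sub>R theta d v) \<longlonglongrightarrow> theta d v"
    proof (rule AE_I2)
      fix v :: real
      show "(\<lambda>n. indicator {1 / real (Suc n)..real (Suc n)} v *\<^sub>R theta d v) \<longlonglongrightarrow> theta d v"
      proof (cases "v > 0")
        case True
        obtain n where n: "real n \<ge> v" "real n \<ge> 1 / v" using real_arch_simple[of "max v (1 / v)"] by auto
        have "eventually (\<lambda>m. indicator {1 / real (Suc m)..real (Suc m)} v *\<^sub>R theta d v = theta d v) sequentially"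
          using eventually_ge_at_top[of n]
        proof eventually_elim
          case (elim m)
          then have "v \<le> real (Suc m)" "1 / v \<le> real (Suc m)" using n by auto
          then show ?case using True by (auto simp: field_simps)
        qed
        then show ?thesis by (simp add: tendsto_eventually)
      qed (simp add: theta_def)
    qed
  qed (auto split: split_indicator)
  then have "eventually (\<lambda>n. (LINT v|lborel. indicator {1 / real (Suc n)..real (Suc n)} v *\<^sub>R theta d v) > (LINT v|lborel. theta d v) - \<eta>) sequentially"
    using assms by (intro order_tendstoD) auto
  then obtain n where n: "(LINT v|lborel. indicator {1 / real (Suc n)..real (Suc n)} v *\<^sub>R theta d v) > (LINT v|lborel. theta d v) - \<eta>"
    by (auto simp: eventually_sequentially)
  show ?thesis
  proof (rule exI[of _ "1 / real (Suc n)"], intro conjI, simp, rule exI[of _ "real (Suc n)"], intro conjI allI impI)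
    fix \<alpha> \<beta> :: real
    assume ab: "\<alpha> \<le> 1 / real (Suc n)" "\<beta> \<ge> real (Suc n)"
    show "(LINT v:{\<alpha>..\<beta>}|lborel. theta d v) \<le> (LINT v|lborel. theta d v)"
      unfolding set_lebesgue_integral_def by (rule integral_mono[OF iS int]) (auto split: split_indicator)
    have "(LINT v|lborel. indicator {1 / real (Suc n)..real (Suc n)} v *\<^sub>R theta d v) \<le> (LINT v:{\<alpha>..\<beta>}|lborel. theta d v)"
      unfolding set_lebesgue_integral_def by (rule integral_mono[OF iS iS]) (use ab in \<open>auto split: split_indicator\<close>)
    then show "(LINT v:{\<alpha>..\<beta>}|lborel. theta d v) \<ge> (LINT v|lborel. theta d v) - \<eta>"
      using n by simp
  qed simp
qed

text \<open>Scaling space by the length of \<open>y\<close> and time by its square reduces the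
  kernel at \<open>y\<close> to the kernel at a unit vector.\<close>

lemma gauss_eq_theta:
  fixes y :: "'a::euclidean_space"
  assumes "y \<noteq> 0" "v > 0"
  shows "gauss ((norm y)\<^sup>2 * v) y = norm y powr (- real DIM('a)) * theta DIM('a) v"
proof -
  have "(2 * pi * ((norm y)\<^sup>2 * v)) powr (- real DIM('a) / 2) 
      = (2 * pi * v) powr (- real DIM('a) / 2) * ((norm y)\<^sup>2) powr (- real DIM('a) / 2)"
    using assms by (subst powr_mult[symmetric]) (auto simp: ac_simps)
  also have "((norm y)\<^sup>2) powr (- real DIM('a) / 2) = norm y powr (- real DIM('a))"
    using assms powr_powr[of "norm y" 2 "- real DIM('a) / 2"] by simp
  finally have "gauss ((norm y)\<^sup>2 * v) y = (2 * pi * v) powr (- real DIM('a) / 2) * norm y powr (- real DIM('a)) * exp (- 1 / (2 * v))"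
    using assms by (simp add: gauss_def)
  then show ?thesis using assms by (simp add: theta_def powr_minus_divide)
qed

text \<open>The substitution \<open>\<delta> + a (t - s) = (norm y)\<^sup>2 v\<close>.\<close>

lemma integral_gauss_time:
  fixes y :: "'a::euclidean_space"
  assumes "y \<noteq> 0" "a > 0" "\<delta> > 0"
  shows "(LINT t:{s..K}|lborel. gauss (\<delta> + a * (t - s)) y)
     = norm y powr (2 - real DIM('a)) / a * 
       (LINT v:{\<delta> / (norm y)\<^sup>2..(\<delta> + a * (K - s)) / (norm y)\<^sup>2}|lborel. theta DIM('a) v)"
proof -
  define c where "c = (norm y)\<^sup>2 / a"
  have c: "c > 0" using assms by (simp add: c_def)
  have "(LINT t:{s..K}|lborel. gauss (\<delta> + a * (t - s)) y)
     = \<bar>c\<bar> *\<^sub>R (LINT v|lborel. indicator {s..K} ((s - \<delta> / a) + c * v) *\<^sub>R gauss (\<delta> + a * ((s - \<delta> / a) + c * v - s)) y)"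
    unfolding set_lebesgue_integral_def using c by (intro lborel_integral_real_affine) auto
  also have "(\<lambda>v. indicator {s..K} ((s - \<delta> / a) + c * v) *\<^sub>R gauss (\<delta> + a * ((s - \<delta> / a) + c * v - s)) y)
    = (\<lambda>v. norm y powr (- real DIM('a)) * (indicator {\<delta> / (norm y)\<^sup>2..(\<delta> + a * (K - s)) / (norm y)\<^sup>2} v *\<^sub>R theta DIM('a) v))"
  proof
    fix v
    have eq: "\<delta> + a * ((s - \<delta> / a) + c * v - s) = (norm y)\<^sup>2 * v"
      using assms by (simp add: c_def field_simps)
    have n2: "(norm y)\<^sup>2 > 0" using assms by simp
    have "s \<le> (s - \<delta> / a) + c * v \<longleftrightarrow> \<delta> / (norm y)\<^sup>2 \<le> v"
      using assms n2 by (simp add: c_def field_simps)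
    moreover have "(s - \<delta> / a) + c * v \<le> K \<longleftrightarrow> v \<le> (\<delta> + a * (K - s)) / (norm y)\<^sup>2"
    proof -
      have "(s - \<delta> / a) + c * v \<le> K \<longleftrightarrow> a * ((s - \<delta> / a) + c * v) \<le> a * K" using assms by simp
      also have "\<dots> \<longleftrightarrow> v * (norm y)\<^sup>2 \<le> \<delta> + a * (K - s)" using assms by (simp add: c_def algebra_simps)
      finally show ?thesis using n2 by (simp add: pos_le_divide_eq)
    qed
    moreover have "v > 0" if "\<delta> / (norm y)\<^sup>2 \<le> v"
    proof -
      have "0 < \<delta> / (norm y)\<^sup>2" using assms by simp
      then show ?thesis using that by linarith
    qed
    ultimately show "indicator {s..K} ((s - \<delta> / a) + c * v) *\<^sub>R gauss (\<delta> + a * ((s - \<delta> / a) + c * v - s)) y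
      = norm y powr (- real DIM('a)) * (indicator {\<delta> / (norm y)\<^sup>2..(\<delta> + a * (K - s)) / (norm y)\<^sup>2} v *\<^sub>R theta DIM('a) v)"
      unfolding eq using gauss_eq_theta[OF assms(1), of v] by (auto simp: indicator_def)
  qed
  also have "\<bar>c\<bar> *\<^sub>R (LINT v|lborel. norm y powr (- real DIM('a)) * (indicator {\<delta> / (norm y)\<^sup>2..(\<delta> + a * (K - s)) / (norm y)\<^sup>2} v *\<^sub>R theta DIM('a) v))
     = (c * norm y powr (- real DIM('a))) * (LINT v:{\<delta> / (norm y)\<^sup>2..(\<delta> + a * (K - s)) / (norm y)\<^sup>2}|lborel. theta DIM('a) v)"
    using c unfolding set_lebesgue_integral_def by simp
  also have "c * norm y powr (- real DIM('a)) = norm y powr (2 - real DIM('a)) / a"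
    using assms by (simp add: c_def powr_diff powr_minus divide_inverse)
  finally show ?thesis .
qed

section \<open>Brownian motion relative to a filtration\<close>

text \<open>Rounding time down to a multiple of 1 / (n + 1) leaves countably many time values, for
  which joint measurability is clear; path continuity gives the limit. The map \<open>c\<close>
  folds the whole real line into the time set \<open>S\<close>, so that no restricted Borel space is
  needed.\<close>

lemma continuous_process_jointly_measurable:
  fixes w :: "real \<Rightarrow> 'w \<Rightarrow> 'b::metric_space" and c :: "real \<Rightarrow> real"
  assumes cont: "\<And>\<omega>. \<omega> \<in> space F \<Longrightarrow> continuous_on S (\<lambda>s. w s \<omega>)"
    and meas: "\<And>s. s \<in> S \<Longrightarrow> w s \<in> borel_measurable F"
    and c: "continuous_on UNIV c" "range c \<subseteq> S"
  shows "(\<lambda>(s, \<omega>). w (c s) \<omega>) \<in> borel_measurable (borel \<Otimes>\<^sub>M F)"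
proof -
  have 1: "(\<lambda>(s, \<omega>). w (c (real_of_int \<lfloor>s * real (Suc n)\<rfloor> / real (Suc n))) \<omega>) \<in> borel_measurable (borel \<Otimes>\<^sub>M F)" for n
  proof -
    have "(\<lambda>p. w (c (real_of_int \<lfloor>fst p * real (Suc n)\<rfloor> / real (Suc n))) (snd p))
        \<in> borel_measurable (borel \<Otimes>\<^sub>M F)"
    proof (rule measurable_compose_countable[where
        f="\<lambda>k p. w (c (real_of_int k / real (Suc n))) (snd p)" and g="\<lambda>p. \<lfloor>fst p * real (Suc n)\<rfloor>"])
      fix k :: int
      have "c (real_of_int k / real (Suc n)) \<in> S" using c by auto
      from meas[OF this] show "(\<lambda>p. w (c (real_of_int k / real (Suc n))) (snd p)) \<in> borel_measurable (borel \<Otimes>\<^sub>M F)"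
        by measurable
    qed measurable
    then show ?thesis
      by (simp add: case_prod_beta')
  qed
  have 2: "(\<lambda>n. case p of (s, \<omega>) \<Rightarrow> w (c (real_of_int \<lfloor>s * real (Suc n)\<rfloor> / real (Suc n))) \<omega>) \<longlonglongrightarrow> (case p of (s, \<omega>) \<Rightarrow> w (c s) \<omega>)"
    if "p \<in> space (borel \<Otimes>\<^sub>M F)" for p
  proof -
    from that have p: "snd p \<in> space F" by (auto simp: space_pair_measure)
    have "(\<lambda>n. real_of_int \<lfloor>fst p * real (Suc n)\<rfloor> / real (Suc n)) \<longlonglongrightarrow> fst p"
    proof (rule real_tendsto_sandwich[where f="\<lambda>n. fst p - 1 / real (Suc n)" and h="\<lambda>_. fst p"])
      show "(\<lambda>n. fst p - 1 / real (Suc n)) \<longlonglongrightarrow> fst p"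
        by real_asymp
      show "eventually (\<lambda>n. fst p - 1 / real (Suc n) \<le> real_of_int \<lfloor>fst p * real (Suc n)\<rfloor> / real (Suc n)) sequentially"
      proof (intro always_eventually allI)
        fix n 
        have "fst p * real (Suc n) - 1 \<le> real_of_int \<lfloor>fst p * real (Suc n)\<rfloor>" by linarith
        then have "(fst p * real (Suc n) - 1) / real (Suc n) \<le> real_of_int \<lfloor>fst p * real (Suc n)\<rfloor> / real (Suc n)"
          by (intro divide_right_mono) auto
        then show "fst p - 1 / real (Suc n) \<le> real_of_int \<lfloor>fst p * real (Suc n)\<rfloor> / real (Suc n)"
          by (simp add: diff_divide_distrib)
      qed
      show "eventually (\<lambda>n. real_of_int \<lfloor>fst p * real (Suc n)\<rfloor> / real (Suc n) \<le> fst p) sequentially"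
        by (intro always_eventually allI) (simp add: pos_divide_le_eq)
    qed auto
    moreover have "continuous_on UNIV (\<lambda>s. w (c s) (snd p))"
      using continuous_on_compose2[OF cont[OF p] c] .
    ultimately show ?thesis
      using continuous_on_tendsto_compose[of UNIV "\<lambda>s. w (c s) (snd p)" _ "fst p" sequentially]
      by (simp add: case_prod_beta')
  qed
  show ?thesis by (rule borel_measurable_LIMSEQ_metric[OF 1 2])
qed

lemma process_stopped_measurable:
  fixes \<rho> :: "real \<Rightarrow> 'w \<Rightarrow> 'b::metric_space"
  assumes cont: "\<And>\<omega>. \<omega> \<in> space M \<Longrightarrow> continuous_on {0..} (\<lambda>s. \<rho> s \<omega>)"
    and meas: "\<And>s. 0 \<le> s \<Longrightarrow> \<rho> s \<in> borel_measurable M"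
    and [measurable]: "\<tau> \<in> borel_measurable M" and nonneg: "\<And>\<omega>. \<omega> \<in> space M \<Longrightarrow> 0 \<le> \<tau> \<omega>"
  shows "(\<lambda>\<omega>. \<rho> (\<tau> \<omega>) \<omega>) \<in> borel_measurable M"
proof -
  have j: "(\<lambda>(s, \<omega>). \<rho> (max 0 s) \<omega>) \<in> borel_measurable (borel \<Otimes>\<^sub>M M)"
    by (rule continuous_process_jointly_measurable[where S="{0..}"])
       (auto intro!: cont meas continuous_intros)
  have "(\<lambda>\<omega>. case (\<tau> \<omega>, \<omega>) of (s, \<omega>) \<Rightarrow> \<rho> (max 0 s) \<omega>) \<in> borel_measurable M"
    by (rule measurable_compose[OF _ j]) simp
  also have "?this \<longleftrightarrow> ?thesis"
    using nonneg by (intro measurable_cong) (simp add: max_def)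
  finally show ?thesis .
qed

text \<open>\<open>incr\<close> packs independence of the increment from the past and its normal law
  into one product formula, which is what the Markov property consumes. Continuity and the starting
  value hold for every outcome, not almost every one, so that hitting times are stopping times
  without completing the filtration.\<close>

locale brownian = prob_space M for M :: "'w measure" +
  fixes Fil :: "real \<Rightarrow> 'w measure" and W :: "real \<Rightarrow> 'w \<Rightarrow> 'e::euclidean_space"
  assumes subalg: "\<And>s. 0 \<le> s \<Longrightarrow> subalgebra M (Fil s)"
    and Fil_mono: "\<And>s t. 0 \<le> s \<Longrightarrow> s \<le> t \<Longrightarrow> sets (Fil s) \<subseteq> sets (Fil t)"
    and adapted: "\<And>u s. 0 \<le> u \<Longrightarrow> u \<le> s \<Longrightarrow> W u \<in> borel_measurable (Fil s)"
    and cont: "\<And>\<omega>. \<omega> \<in> space M \<Longrightarrow> continuous_on {0..} (\<lambda>t. W t \<omega>)"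
    and start: "\<And>\<omega>. \<omega> \<in> space M \<Longrightarrow> W 0 \<omega> = 0"
    and incr: "\<And>s t A C. 0 \<le> s \<Longrightarrow> s < t \<Longrightarrow> A \<in> sets (Fil s) \<Longrightarrow> C \<in> sets borel \<Longrightarrow>
      prob (A \<inter> {\<omega> \<in> space M. W t \<omega> - W s \<omega> \<in> C}) = prob A * measure std_gauss {z. sqrt (t - s) *\<^sub>R z \<in> C}"
begin

lemma space_Fil: "0 \<le> s \<Longrightarrow> space (Fil s) = space M"
  using subalg[of s] by (simp add: subalgebra_def)

lemma sets_Fil: "0 \<le> s \<Longrightarrow> A \<in> sets (Fil s) \<Longrightarrow> A \<in> sets M"
  using subalg[of s] by (auto simp: subalgebra_def)

lemma measurable_FilD: "0 \<le> s \<Longrightarrow> f \<in> measurable (Fil s) N \<Longrightarrow> f \<in> measurable M N"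
  using measurable_from_subalg[OF subalg] .

lemma W_measurable: "0 \<le> u \<Longrightarrow> W u \<in> borel_measurable M"
  using measurable_FilD[OF _ adapted[of u u]] by auto

lemma W_joint: "(\<lambda>(s, \<omega>). W (max 0 s) \<omega>) \<in> borel_measurable (borel \<Otimes>\<^sub>M M)"
  by (rule continuous_process_jointly_measurable[where S="{0..}"])
     (auto intro!: cont W_measurable continuous_intros)

text \<open>The past and the increment have a product law: on rectangles this is
  \<open>incr\<close>, and rectangles determine the measure. Fubini then integrates out the
  increment with the past held fixed.\<close>

lemma markov:
  fixes f :: "'w \<times> 'e \<Rightarrow> real"
  assumes st: "0 \<le> s" "s \<le> t" and f: "f \<in> borel_measurable (Fil s \<Otimes>\<^sub>M borel)"
    and bdd: "\<And>p. \<bar>f p\<bar> \<le> C"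
  shows "expectation (\<lambda>\<omega>. f (\<omega>, W t \<omega> - W s \<omega>)) = expectation (\<lambda>\<omega>. LINT z|std_gauss. f (\<omega>, sqrt (t - s) *\<^sub>R z))"
proof (cases "s = t")
  case True
  interpret g: prob_space "std_gauss :: 'e measure" by (rule prob_space_std_gauss)
  show ?thesis using True g.prob_space by simp
next
  case False
  then have "s < t" using st by simp
  define D where "D = (\<lambda>\<omega>. W t \<omega> - W s \<omega>)"
  define G where "G = distr std_gauss borel (\<lambda>z::'e. sqrt (t - s) *\<^sub>R z)"
  \<comment> \<open>\<open>M\<close> with its sigma-algebra reduced to \<open>Fil s\<close>: the law
    of the past, as first factor of the product.\<close>
  define P where "P = distr M (Fil s) (\<lambda>\<omega>. \<omega>)"
  interpret g: prob_space "std_gauss :: 'e measure" by (rule prob_space_std_gauss)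
  have idm: "(\<lambda>\<omega>. \<omega>) \<in> measurable M (Fil s)"
    by (rule measurable_FilD[OF st(1)]) simp
  have Dm[measurable]: "D \<in> borel_measurable M" 
    using W_measurable[of s] W_measurable[of t] st unfolding D_def by (intro borel_measurable_diff) auto
  have Xm: "(\<lambda>\<omega>. (\<omega>, D \<omega>)) \<in> measurable M (Fil s \<Otimes>\<^sub>M borel)"
    using idm Dm by (intro measurable_Pair)
  interpret P: prob_space P unfolding P_def by (rule prob_space_distr[OF idm])
  interpret G: prob_space G unfolding G_def by (rule g.prob_space_distr) simp
  interpret PG: pair_prob_space P G ..
  have eq: "P \<Otimes>\<^sub>M G = distr M (Fil s \<Otimes>\<^sub>M borel) (\<lambda>\<omega>. (\<omega>, D \<omega>))"
  proof (rule pair_measure_eqI)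
    show "sets (P \<Otimes>\<^sub>M G) = sets (distr M (Fil s \<Otimes>\<^sub>M borel) (\<lambda>\<omega>. (\<omega>, D \<omega>)))"
      by (simp add: P_def G_def cong: sets_pair_measure_cong)
    fix A B assume "A \<in> sets P" "B \<in> sets G"
    then have AB: "A \<in> sets (Fil s)" "B \<in> sets borel" by (auto simp: P_def G_def)
    have AM: "A \<in> sets M" using AB sets_Fil st by auto
    have "emeasure P A = prob A"
      using AB idm AM sets.sets_into_space[OF AM] unfolding P_def 
      by (subst emeasure_distr) (auto simp: emeasure_eq_measure Int_absorb2)
    moreover have "emeasure G B = measure std_gauss {z::'e. sqrt (t - s) *\<^sub>R z \<in> B}"
      using AB unfolding G_def 
      by (subst emeasure_distr) (auto simp: g.emeasure_eq_measure vimage_def)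
    moreover have "emeasure (distr M (Fil s \<Otimes>\<^sub>M borel) (\<lambda>\<omega>. (\<omega>, D \<omega>))) (A \<times> B) = prob (A \<inter> {\<omega> \<in> space M. W t \<omega> - W s \<omega> \<in> B})"
    proof -
      have "(\<lambda>\<omega>. (\<omega>, D \<omega>)) -` (A \<times> B) \<inter> space M = A \<inter> {\<omega> \<in> space M. W t \<omega> - W s \<omega> \<in> B}"
        by (auto simp: D_def)
      then show ?thesis using AB Xm
        by (subst emeasure_distr) (auto simp: emeasure_eq_measure)
    qed
    ultimately show "emeasure P A * emeasure G B = emeasure (distr M (Fil s \<Otimes>\<^sub>M borel) (\<lambda>\<omega>. (\<omega>, D \<omega>))) (A \<times> B)"
      using incr[OF st(1) \<open>s < t\<close> AB] by (simp add: ennreal_mult')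
  qed unfold_locales
  have "sets (P \<Otimes>\<^sub>M G) = sets (Fil s \<Otimes>\<^sub>M borel)"
    by (simp add: P_def G_def cong: sets_pair_measure_cong)
  then have f': "f \<in> borel_measurable (P \<Otimes>\<^sub>M G)" 
    using f by (simp cong: measurable_cong_sets)
  have "expectation (\<lambda>\<omega>. f (\<omega>, W t \<omega> - W s \<omega>)) = (LINT p|(P \<Otimes>\<^sub>M G). f p)"
    unfolding eq by (subst integral_distr[OF Xm f]) (simp add: D_def)
  also have "\<dots> = (LINT \<omega>|P. LINT z|G. f (\<omega>, z))"
    using bdd f' by (intro PG.integral_fst'[symmetric] PG.P.integrable_const_bound[where B=C]) auto
  also have "\<dots> = expectation (\<lambda>\<omega>. LINT z|G. f (\<omega>, z))"
    unfolding P_def 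
  proof (rule integral_distr[OF idm])
    show "(\<lambda>\<omega>. LINT z|G. f (\<omega>, z)) \<in> borel_measurable (Fil s)"
      using f by (intro G.borel_measurable_lebesgue_integral) (simp add: G_def cong: measurable_cong_sets sets_pair_measure_cong)
  qed
  also have "\<dots> = expectation (\<lambda>\<omega>. LINT z|std_gauss. f (\<omega>, sqrt (t - s) *\<^sub>R z))"
  proof (rule Bochner_Integration.integral_cong[OF refl])
    fix \<omega> assume "\<omega> \<in> space M"
    then have "\<omega> \<in> space (Fil s)" using space_Fil st by auto
    then have "(\<lambda>z. f (\<omega>, z)) \<in> borel_measurable borel" 
      using f by (rule measurable_compose_Pair1)
    then show "(LINT z|G. f (\<omega>, z)) = (LINT z|std_gauss. f (\<omega>, sqrt (t - s) *\<^sub>R z))"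
      unfolding G_def by (subst integral_distr) auto
  qed
  finally show ?thesis .
qed

end

lemma (in prob_space) integrable_bounded:
  fixes f :: "'a \<Rightarrow> real"
  assumes "f \<in> borel_measurable M" "\<And>x. x \<in> space M \<Longrightarrow> \<bar>f x\<bar> \<le> C"
  shows "integrable M f"
  using assms by (intro integrable_const_bound[where B=C]) auto

lemma (in prob_space) expectation_abs_le:
  fixes f :: "'a \<Rightarrow> real"
  assumes "\<And>x. x \<in> space M \<Longrightarrow> \<bar>f x\<bar> \<le> C" 
  shows "\<bar>expectation f\<bar> \<le> C"
proof (cases "integrable M f")
  case True
  have "\<bar>expectation f\<bar> \<le> expectation (\<lambda>x. \<bar>f x\<bar>)" by (rule integral_abs_bound)
  also have "\<dots> \<le> expectation (\<lambda>x. C)"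
    using True assms by (intro integral_mono) auto
  finally show ?thesis by (simp add: prob_space)
next
  \<comment> \<open>A non-integrable function has expectation 0 by convention, and \<open>C\<close>
    is nonnegative because the space is not empty.\<close>
  case False
  obtain x where "x \<in> space M" using not_empty by auto
  then show ?thesis using False assms[of x] by (simp add: not_integrable_integral_eq)
qed

section \<open>Stopping times and the strong Markov property\<close>

context brownian begin

lemma stopping_measurable:
  assumes stop: "\<And>s. 0 \<le> s \<Longrightarrow> {\<omega> \<in> space M. \<tau> \<omega> \<le> s} \<in> sets (Fil s)"
    and nonneg: "\<And>\<omega>. \<omega> \<in> space M \<Longrightarrow> 0 \<le> \<tau> \<omega>"
  shows "\<tau> \<in> borel_measurable M"
  unfolding borel_measurable_iff_le
proof
  fix s :: real
  show "{\<omega> \<in> space M. \<tau> \<omega> \<le> s} \<in> sets M"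
  proof (cases "0 \<le> s")
    case True
    show ?thesis by (rule sets_Fil[OF True stop[OF True]])
  next
    case False
    then have e: "{\<omega> \<in> space M. \<tau> \<omega> \<le> s} = {}" using nonneg by force
    show ?thesis unfolding e by simp
  qed
qed

lemma W_stopped_measurable:
  assumes "\<tau> \<in> borel_measurable M" "\<And>\<omega>. \<omega> \<in> space M \<Longrightarrow> 0 \<le> \<tau> \<omega>"
  shows "(\<lambda>\<omega>. W (\<tau> \<omega>) \<omega>) \<in> borel_measurable M"
  using cont W_measurable assms by (rule process_stopped_measurable)

lemma heat_measurable:
  fixes \<phi> :: "'e \<Rightarrow> real"
  assumes [measurable]: "\<phi> \<in> borel_measurable borel" "\<tau> \<in> borel_measurable M" and nonneg: "\<And>\<omega>. \<omega> \<in> space M \<Longrightarrow> 0 \<le> \<tau> \<omega>"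
  shows "(\<lambda>\<omega>. LINT z|std_gauss. \<phi> (W (\<tau> \<omega>) \<omega> + sqrt (t - \<tau> \<omega>) *\<^sub>R z)) \<in> borel_measurable M"
proof -
  interpret g: prob_space "std_gauss :: 'e measure" by (rule prob_space_std_gauss)
  note W_stopped_measurable[OF assms(2) nonneg, measurable]
  show ?thesis by measurable
qed

text \<open>The time \<open>\<tau>\<close> is approximated from above by \<open>q n\<close>, which takes finitely many values, so that the
  Markov property applies on each of them.\<close>

lemma strong_markov:
  fixes \<phi> :: "'e \<Rightarrow> real"
  assumes stop: "\<And>s. 0 \<le> s \<Longrightarrow> {\<omega> \<in> space M. \<tau> \<omega> \<le> s} \<in> sets (Fil s)"
    and nonneg: "\<And>\<omega>. \<omega> \<in> space M \<Longrightarrow> 0 \<le> \<tau> \<omega>"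
    and \<phi>: "continuous_on UNIV \<phi>" and bdd: "\<And>w. \<bar>\<phi> w\<bar> \<le> C" and t: "0 \<le> t"
  shows "expectation (\<lambda>\<omega>. indicator {..t} (\<tau> \<omega>) * \<phi> (W t \<omega>)) =
    expectation (\<lambda>\<omega>. indicator {..t} (\<tau> \<omega>) * (LINT z|std_gauss. \<phi> (W (\<tau> \<omega>) \<omega> + sqrt (t - \<tau> \<omega>) *\<^sub>R z)))"
    (is "?L = expectation ?R")
proof -
  interpret g: prob_space "std_gauss :: 'e measure" by (rule prob_space_std_gauss)
  note \<tau>m[measurable] = stopping_measurable[OF stop nonneg]
  have [measurable]: "\<phi> \<in> borel_measurable borel" using \<phi> by (rule borel_measurable_continuous_onI)
  \<comment> \<open>Rounding up, not down, so that whether \<open>q n\<close> takes its k-th value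
    is decided by the time of that value. The cap at \<open>t\<close> is harmless, since only
    outcomes with \<open>\<tau>\<close> \<le> \<open>t\<close> count.\<close>
  define q where "q n \<omega> = min t (real_of_int \<lceil>\<tau> \<omega> * real (Suc n)\<rceil> / real (Suc n))" for n \<omega>
  have q0: "0 \<le> q n \<omega>" if "\<omega> \<in> space M" for n \<omega>
  proof -
    have "0 \<le> \<tau> \<omega> * real (Suc n)" using nonneg[OF that] by simp
    then have "0 \<le> real_of_int \<lceil>\<tau> \<omega> * real (Suc n)\<rceil>" by linarith
    then show ?thesis using t unfolding q_def by (intro min.boundedI divide_nonneg_nonneg) auto
  qed
  have qm[measurable]: "q n \<in> borel_measurable M" for n unfolding q_def by measurable
  define H where "H s \<omega> = (LINT z|std_gauss. \<phi> (W s \<omega> + sqrt (t - s) *\<^sub>R z))" for s \<omega>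
  have Hb: "\<bar>H s \<omega>\<bar> \<le> C" for s \<omega>
    unfolding H_def by (rule g.expectation_abs_le) (rule bdd)
  have step: "?L = expectation (\<lambda>\<omega>. indicator {..t} (\<tau> \<omega>) * H (q n \<omega>) \<omega>)" for n
  proof -
    define m where "m = nat \<lceil>t * real (Suc n)\<rceil>"
    define s where "s k = min t (real k / real (Suc n))" for k
    define A where "A k = {\<omega> \<in> space M. \<tau> \<omega> \<le> t \<and> \<lceil>\<tau> \<omega> * real (Suc n)\<rceil> = int k}" for k
    have s0: "0 \<le> s k" "s k \<le> t" for k using t by (auto simp: s_def)
    have AF: "A k \<in> sets (Fil (s k))" for k
    proof -
      have A: "A k = {\<omega> \<in> space M. \<tau> \<omega> \<le> s k} - {\<omega> \<in> space M. \<tau> \<omega> \<le> (real k - 1) / real (Suc n)}"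
      proof -
        have "\<lceil>x * real (Suc n)\<rceil> = int k \<longleftrightarrow> x \<le> real k / real (Suc n) \<and> \<not> x \<le> (real k - 1) / real (Suc n)" for x
        proof -
          have "\<lceil>x * real (Suc n)\<rceil> = int k \<longleftrightarrow> real k - 1 < x * real (Suc n) \<and> x * real (Suc n) \<le> real k"
            by (simp add: ceiling_eq_iff)
          also have "real k - 1 < x * real (Suc n) \<longleftrightarrow> \<not> x \<le> (real k - 1) / real (Suc n)"
            by (subst pos_le_divide_eq) auto
          also have "x * real (Suc n) \<le> real k \<longleftrightarrow> x \<le> real k / real (Suc n)"
            by (subst pos_le_divide_eq) auto
          finally show ?thesis by blast
        qed
        then show ?thesis by (auto simp: A_def s_def)
      qed
      \<comment> \<open>The left endpoint may be negative, namely for \<open>k\<close> = 0, or may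
        exceed the cap \<open>t\<close>. Then \<open>stop\<close> and \<open>Fil_mono\<close> say
        nothing about it, but the set removed, respectively \<open>A k\<close> itself, is
        empty.\<close>
      show ?thesis
      proof (cases "0 \<le> (real k - 1) / real (Suc n) \<and> (real k - 1) / real (Suc n) \<le> s k")
        case True
        have "{\<omega> \<in> space M. \<tau> \<omega> \<le> (real k - 1) / real (Suc n)} \<in> sets (Fil (s k))"
          using stop[OF conjunct1[OF True]] Fil_mono[OF conjunct1[OF True] conjunct2[OF True]] by (rule rev_subsetD)
        then show ?thesis unfolding A using stop[OF s0(1)] by (rule sets.Diff[rotated])
      next
        case False
        then consider "(real k - 1) / real (Suc n) < 0" | "(real k - 1) / real (Suc n) > s k" by linarith
        then show ?thesis
        proof cases
          case 1
          then have e: "{\<omega> \<in> space M. \<tau> \<omega> \<le> (real k - 1) / real (Suc n)} = {}" using nonneg by force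
          show ?thesis unfolding A e using stop s0 by simp
        next
          case 2
          then have "A k = {}" unfolding A by force
          then show ?thesis by simp
        qed
      qed
    qed
    then have [measurable]: "A k \<in> sets M" for k using sets_Fil s0 by blast
    have ind: "indicator {..t} (\<tau> \<omega>) = (\<Sum>k\<le>m. indicator (A k) \<omega> :: real)" if "\<omega> \<in> space M" for \<omega>
    proof (cases "\<tau> \<omega> \<le> t")
      case True
      define k where "k = nat \<lceil>\<tau> \<omega> * real (Suc n)\<rceil>"
      have kint: "\<lceil>\<tau> \<omega> * real (Suc n)\<rceil> = int k" 
      proof -
        have "0 \<le> \<tau> \<omega> * real (Suc n)" using nonneg[OF that] by simp
        then have "0 \<le> \<lceil>\<tau> \<omega> * real (Suc n)\<rceil>" by linarith
        then show ?thesis by (simp only: k_def int_nat_eq if_True)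
      qed
      have "k \<le> m" unfolding k_def m_def using True
        by (intro nat_mono ceiling_mono mult_right_mono) auto
      have "(\<Sum>j\<le>m. indicator (A j) \<omega> :: real) = (\<Sum>j\<le>m. if j = k then 1 else 0)"
        using True kint that by (intro sum.cong) (auto simp: A_def indicator_def)
      then show ?thesis using True \<open>k \<le> m\<close> by simp
    qed (simp add: A_def)
    have Wsm[measurable]: "W (s k) \<in> borel_measurable M" "W t \<in> borel_measurable M" for k
      using W_measurable s0 t by auto
    have Hm[measurable]: "(\<lambda>\<omega>. H (s k) \<omega>) \<in> borel_measurable M" for k
      unfolding H_def by measurable
    have k: "expectation (\<lambda>\<omega>. indicator (A k) \<omega> * \<phi> (W t \<omega>)) = expectation (\<lambda>\<omega>. indicator (A k) \<omega> * H (s k) \<omega>)" for k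
    proof -
      define f where "f = (\<lambda>p. indicator (A k) (fst p) * \<phi> (W (s k) (fst p) + snd p))"
      have [measurable]: "W (s k) \<in> borel_measurable (Fil (s k))" "A k \<in> sets (Fil (s k))"
        using adapted AF s0 by auto
      have fm: "f \<in> borel_measurable (Fil (s k) \<Otimes>\<^sub>M borel)" unfolding f_def by measurable
      have fb: "\<bar>f p\<bar> \<le> C" for p using bdd[of "W (s k) (fst p) + snd p"] bdd[of 0] 
        by (auto simp: f_def indicator_def abs_mult)
      show ?thesis using markov[OF s0(1) s0(2) fm fb] by (simp add: f_def H_def)
    qed
    have "?L = expectation (\<lambda>\<omega>. \<Sum>k\<le>m. indicator (A k) \<omega> * \<phi> (W t \<omega>))"
      by (intro Bochner_Integration.integral_cong) (simp_all add: ind sum_distrib_right)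
    also have "\<dots> = (\<Sum>k\<le>m. expectation (\<lambda>\<omega>. indicator (A k) \<omega> * \<phi> (W t \<omega>)))"
      using bdd order_trans[OF abs_ge_zero bdd[of 0]]
      by (intro Bochner_Integration.integral_sum integrable_bounded[where C=C]) (auto simp: indicator_def)
    also have "\<dots> = (\<Sum>k\<le>m. expectation (\<lambda>\<omega>. indicator (A k) \<omega> * H (s k) \<omega>))"
      by (simp add: k)
    also have "\<dots> = expectation (\<lambda>\<omega>. \<Sum>k\<le>m. indicator (A k) \<omega> * H (s k) \<omega>)"
      using Hb order_trans[OF abs_ge_zero bdd[of 0]]
      by (intro Bochner_Integration.integral_sum[symmetric] integrable_bounded[where C=C]) (auto simp: indicator_def)
    also have "\<dots> = expectation (\<lambda>\<omega>. indicator {..t} (\<tau> \<omega>) * H (q n \<omega>) \<omega>)"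
    proof (rule Bochner_Integration.integral_cong[OF refl])
      fix \<omega> assume "\<omega> \<in> space M"
      have "(\<Sum>k\<le>m. indicator (A k) \<omega> * H (s k) \<omega>) = (\<Sum>k\<le>m. indicator (A k) \<omega> * H (q n \<omega>) \<omega>)"
        by (intro sum.cong) (auto simp: A_def indicator_def s_def q_def)
      then show "(\<Sum>k\<le>m. indicator (A k) \<omega> * H (s k) \<omega>) = indicator {..t} (\<tau> \<omega>) * H (q n \<omega>) \<omega>"
        using ind[OF \<open>\<omega> \<in> space M\<close>] by (simp add: sum_distrib_right)
    qed
    finally show ?thesis .
  qed
  have "(\<lambda>n. expectation (\<lambda>\<omega>. indicator {..t} (\<tau> \<omega>) * H (q n \<omega>) \<omega>)) \<longlonglongrightarrow> expectation ?R"
  proof (rule integral_dominated_convergence[where w="\<lambda>_. C"])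
    show "?R \<in> borel_measurable M"
      using heat_measurable[OF _ \<tau>m nonneg, of \<phi> t] by simp
    show "(\<lambda>\<omega>. indicator {..t} (\<tau> \<omega>) * H (q n \<omega>) \<omega>) \<in> borel_measurable M" for n
      using heat_measurable[OF _ qm q0, of \<phi> n t] unfolding H_def by simp
    show "AE \<omega> in M. norm (indicator {..t} (\<tau> \<omega>) * H (q n \<omega>) \<omega>) \<le> C" for n
      using Hb order_trans[OF abs_ge_zero bdd[of 0]] by (auto simp: indicator_def)
    show "AE \<omega> in M. (\<lambda>n. indicator {..t} (\<tau> \<omega>) * H (q n \<omega>) \<omega>) \<longlonglongrightarrow> ?R \<omega>"
    proof (rule AE_I2)
      fix \<omega> assume \<omega>: "\<omega> \<in> space M"
      show "(\<lambda>n. indicator {..t} (\<tau> \<omega>) * H (q n \<omega>) \<omega>) \<longlonglongrightarrow> ?R \<omega>"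
      proof (cases "\<tau> \<omega> \<le> t")
        case True
        have "(\<lambda>n. real_of_int \<lceil>\<tau> \<omega> * real (Suc n)\<rceil> / real (Suc n)) \<longlonglongrightarrow> \<tau> \<omega>"
        proof (rule real_tendsto_sandwich[where h="\<lambda>n. \<tau> \<omega> + 1 / real (Suc n)" and f="\<lambda>_. \<tau> \<omega>"])
          show "(\<lambda>n. \<tau> \<omega> + 1 / real (Suc n)) \<longlonglongrightarrow> \<tau> \<omega>" by real_asymp
          show "eventually (\<lambda>n. real_of_int \<lceil>\<tau> \<omega> * real (Suc n)\<rceil> / real (Suc n) \<le> \<tau> \<omega> + 1 / real (Suc n)) sequentially"
          proof (intro always_eventually allI)
            fix n 
            have "real_of_int \<lceil>\<tau> \<omega> * real (Suc n)\<rceil> \<le> \<tau> \<omega> * real (Suc n) + 1" by linarith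
            then have "real_of_int \<lceil>\<tau> \<omega> * real (Suc n)\<rceil> / real (Suc n) \<le> (\<tau> \<omega> * real (Suc n) + 1) / real (Suc n)"
              by (intro divide_right_mono) auto
            then show "real_of_int \<lceil>\<tau> \<omega> * real (Suc n)\<rceil> / real (Suc n) \<le> \<tau> \<omega> + 1 / real (Suc n)"
              by (simp add: add_divide_distrib)
          qed
          show "eventually (\<lambda>n. \<tau> \<omega> \<le> real_of_int \<lceil>\<tau> \<omega> * real (Suc n)\<rceil> / real (Suc n)) sequentially"
            by (intro always_eventually allI) (subst pos_le_divide_eq, auto)
        qed auto
        then have "(\<lambda>n. q n \<omega>) \<longlonglongrightarrow> min t (\<tau> \<omega>)"
          unfolding q_def by (intro tendsto_min tendsto_const)
        then have qlim: "(\<lambda>n. q n \<omega>) \<longlonglongrightarrow> \<tau> \<omega>"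
          using True by (simp only: min.absorb2)
        have Wlim: "(\<lambda>n. W (q n \<omega>) \<omega>) \<longlonglongrightarrow> W (\<tau> \<omega>) \<omega>"
        proof (rule continuous_on_tendsto_compose[OF cont[OF \<omega>] qlim])
          show "\<tau> \<omega> \<in> {0..}" using nonneg[OF \<omega>] by simp
          show "eventually (\<lambda>n. q n \<omega> \<in> {0..}) sequentially" using q0[OF \<omega>] by simp
        qed
        \<comment> \<open>Continuity of \<open>\<phi>\<close> is used here: together with the
          continuous path and the bound \<open>C\<close> it carries the limit through the Gaussian
          integral.\<close>
        have "(\<lambda>n. H (q n \<omega>) \<omega>) \<longlonglongrightarrow> H (\<tau> \<omega>) \<omega>"
          unfolding H_def
        proof (rule integral_dominated_convergence[where w="\<lambda>_. C"])
          show "AE z in std_gauss. (\<lambda>n. \<phi> (W (q n \<omega>) \<omega> + sqrt (t - q n \<omega>) *\<^sub>R z)) \<longlonglongrightarrow> \<phi> (W (\<tau> \<omega>) \<omega> + sqrt (t - \<tau> \<omega>) *\<^sub>R z)"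
            by (intro AE_I2 continuous_on_tendsto_compose[OF \<phi>] tendsto_intros Wlim qlim) auto
        qed (use bdd in auto)
        then show ?thesis using True by (simp add: H_def)
      qed simp
    qed
  qed simp
  then have "(\<lambda>n::nat. ?L) \<longlonglongrightarrow> expectation ?R"
    by (simp only: step[symmetric])
  then show ?thesis by (simp only: LIMSEQ_const_iff)
qed

end

section \<open>A pair of independent Brownian motions\<close>

lemma gauss_Pair:
  fixes x :: "'a::euclidean_space" and y :: "'b::euclidean_space"
  assumes "s > 0"
  shows "gauss s (x, y) = gauss s x * gauss s y"
proof -
  have "(2 * pi * s) powr (- real DIM('a \<times> 'b) / 2) = (2 * pi * s) powr (- real DIM('a) / 2) * (2 * pi * s) powr (- real DIM('b) / 2)"
    by (subst powr_add[symmetric]) (simp add: add_divide_distrib diff_divide_distrib)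
  moreover have "exp (- (norm (x, y))\<^sup>2 / (2 * s)) = exp (- (norm x)\<^sup>2 / (2 * s)) * exp (- (norm y)\<^sup>2 / (2 * s))"
    by (subst exp_add[symmetric]) (simp add: norm_Pair add_divide_distrib diff_divide_distrib)
  ultimately show ?thesis unfolding gauss_def by (simp only: mult_ac)
qed

lemma std_gauss_prod:
  "(std_gauss :: ('a::euclidean_space \<times> 'b::euclidean_space) measure) = std_gauss \<Otimes>\<^sub>M std_gauss"
proof -
  interpret b: prob_space "std_gauss :: 'b measure" by (rule prob_space_std_gauss)
  have "(std_gauss :: 'a measure) \<Otimes>\<^sub>M (std_gauss :: 'b measure) 
      = density (lborel \<Otimes>\<^sub>M lborel) (\<lambda>(x, y). ennreal (gauss 1 x) * ennreal (gauss 1 y))"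
    unfolding std_gauss_def
    by (rule pair_measure_density) (auto intro: sigma_finite_lborel b.sigma_finite_measure_axioms[unfolded std_gauss_def])
  also have "\<dots> = density lborel (\<lambda>z. ennreal (gauss 1 z))"
  proof -
    have "(\<lambda>(x::'a, y::'b). ennreal (gauss 1 x) * ennreal (gauss 1 y)) = (\<lambda>z. ennreal (gauss 1 z))"
      by (auto simp: fun_eq_iff gauss_Pair ennreal_mult')
    then show ?thesis by (simp add: lborel_prod)
  qed
  finally show ?thesis by (simp add: std_gauss_def)
qed

lemma brownian_increment_prob:
  fixes B :: "real \<Rightarrow> 'w \<Rightarrow> real ^ 'd"
  assumes "std_brownian_motion M B" "0 \<le> s" "s < t" "C \<in> sets borel"
  shows "measure M {\<omega> \<in> space M. B t \<omega> - B s \<omega> \<in> C} = measure std_gauss {z. sqrt (t - s) *\<^sub>R z \<in> C}"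
proof -
  interpret prob_space M using assms by (simp add: std_brownian_motion_def)
  have D: "distributed M lborel (\<lambda>\<omega>. B t \<omega> - B s \<omega>) (\<lambda>z. ennreal (gauss (t - s) z))"
    using assms by (simp add: std_brownian_motion_def bm_density_eq_gauss)
  have rv[measurable]: "(\<lambda>\<omega>. B t \<omega> - B s \<omega>) \<in> borel_measurable M"
    using distributed_measurable[OF D] by simp
  note [measurable] = assms(4)
  have "measure M {\<omega> \<in> space M. B t \<omega> - B s \<omega> \<in> C} = expectation (\<lambda>\<omega>. indicator C (B t \<omega> - B s \<omega>) :: real)"
  proof -
    have "expectation (\<lambda>\<omega>. indicator C (B t \<omega> - B s \<omega>) :: real) = expectation (indicat_real {\<omega> \<in> space M. B t \<omega> - B s \<omega> \<in> C})"
      by (intro Bochner_Integration.integral_cong) (auto simp: indicator_def)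
    then show ?thesis by (simp add: Int_absorb2)
  qed
  also have "\<dots> = (LINT v|lborel. gauss (t - s) v * indicator C v)"
    by (rule distributed_integral[OF D, symmetric]) auto
  also have "\<dots> = (LINT v|lborel. gauss ((sqrt (t - s))\<^sup>2) (v - 0) * indicator C v)"
    using assms by simp
  also have "\<dots> = (LINT z|std_gauss. indicator C (0 + sqrt (t - s) *\<^sub>R z))"
    using assms by (intro integral_std_gauss_affine[symmetric]) auto
  also have "\<dots> = (LINT z|std_gauss. indicator {z. sqrt (t - s) *\<^sub>R z \<in> C} z)"
    by (intro Bochner_Integration.integral_cong) (auto simp: indicator_def)
  also have "\<dots> = measure std_gauss {z. sqrt (t - s) *\<^sub>R z \<in> C}"
    by simp
  finally show ?thesis .
qed

text \<open>Order the past times, adjoin 0 and \<open>s\<close>, and append \<open>t\<close>: each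
  past value is almost surely a sum of increments before \<open>s\<close>, and these are independent
  of the increment from \<open>s\<close> to \<open>t\<close>.\<close>

lemma brownian_past_indep_increment:
  fixes B :: "real \<Rightarrow> 'w \<Rightarrow> real ^ 'd"
  assumes bm: "std_brownian_motion M B" and st: "0 \<le> s" "s < t" 
    and J: "finite J" "J \<subseteq> {0..s}" and A: "\<And>u. A u \<in> sets borel" and C: "C \<in> sets borel"
  shows "measure M {\<omega> \<in> space M. (\<forall>u\<in>J. B u \<omega> \<in> A u) \<and> B t \<omega> - B s \<omega> \<in> C}
    = measure M {\<omega> \<in> space M. \<forall>u\<in>J. B u \<omega> \<in> A u} * measure M {\<omega> \<in> space M. B t \<omega> - B s \<omega> \<in> C}"
proof -
  interpret prob_space M using bm by (simp add: std_brownian_motion_def)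
  have Bm: "B u \<in> borel_measurable M" if "0 \<le> u" for u using bm that by (simp add: std_brownian_motion_def)
  have B0: "AE \<omega> in M. B 0 \<omega> = 0" using bm by (simp add: std_brownian_motion_def)
  \<comment> \<open>Adjoining 0 makes the partial sums of increments start at \<open>B 0\<close>;
    adjoining \<open>s\<close> makes the last increment exactly the one from \<open>s\<close> to
    \<open>t\<close>.\<close>
  define xs where "xs = sorted_list_of_set (J \<union> {0, s})"
  define l where "l = length xs - 1"
  have "finite (J \<union> {0, s})" using J by simp
  then have set_xs: "set xs = J \<union> {0, s}" and sorted: "sorted xs"
    unfolding xs_def by (rule set_sorted_list_of_set, intro sorted_sorted_list_of_set)
  then have xs_ne: "xs \<noteq> []" by auto
  have len: "length xs = Suc l" using xs_ne by (simp add: l_def)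
  define T where "T k = (if k \<le> l then xs ! k else t)" for k
  have Tin: "T k \<in> J \<union> {0, s}" if "k \<le> l" for k
    using that len nth_mem[of k xs] set_xs by (simp add: T_def)
  have T_ge: "0 \<le> T k" for k
  proof (cases "k \<le> l")
    case True
    then show ?thesis using Tin[OF True] J st by auto
  qed (use st in \<open>simp add: T_def\<close>)
  have T_le: "T k \<le> s" if "k \<le> l" for k
    using Tin[OF that] J st by auto
  have T0: "T 0 = 0"
  proof -
    obtain k where "k < length xs" "xs ! k = 0" using set_xs by (metis UnI2 in_set_conv_nth insertI1)
    then have "xs ! 0 \<le> 0" using sorted_nth_mono[OF sorted, of 0 k] by simp
    then show ?thesis using T_ge[of 0] by (simp add: T_def)
  qed
  have Tl: "T l = s"
  proof -
    obtain k where "k < length xs" "xs ! k = s" using set_xs by (metis UnCI in_set_conv_nth insertCI)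
    then have "s \<le> xs ! l" using sorted_nth_mono[OF sorted, of k l] len by simp
    then show ?thesis using T_le[of l] by (simp add: T_def)
  qed
  have TSl: "T (Suc l) = t" by (simp add: T_def)
  have T_mono: "T k \<le> T (Suc k)" if "k < Suc l" for k
  proof (cases "k = l")
    case True
    then show ?thesis using Tl TSl st by simp
  next
    case False
    then show ?thesis using that sorted_nth_mono[OF sorted, of k "Suc k"] len by (simp add: T_def)
  qed
  define inc where "inc k \<omega> = B (T (Suc k)) \<omega> - B (T k) \<omega>" for k \<omega>
  have ind: "indep_vars (\<lambda>_. borel) inc {..<Suc l}"
    using bm T_ge T_mono unfolding std_brownian_motion_def inc_def by blast
  have incm[measurable]: "inc k \<in> borel_measurable M" for k
    unfolding inc_def by (intro borel_measurable_diff Bm T_ge)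
  have tele: "(\<Sum>k<j. inc k \<omega>) = B (T j) \<omega> - B 0 \<omega>" for j \<omega>
    unfolding inc_def by (subst sum_lessThan_telescope) (simp add: T0)
  have "\<exists>idx. \<forall>u\<in>J. idx u \<le> l \<and> T (idx u) = u"
  proof (rule bchoice, rule ballI)
    fix u assume "u \<in> J"
    then have "u \<in> set xs" using set_xs by simp
    then obtain k where "k < length xs" "xs ! k = u" by (auto simp: in_set_conv_nth)
    then show "\<exists>k. k \<le> l \<and> T k = u" using len by (intro exI[of _ k]) (simp add: T_def)
  qed
  then obtain idx where idx: "\<And>u. u \<in> J \<Longrightarrow> idx u \<le> l" "\<And>u. u \<in> J \<Longrightarrow> T (idx u) = u" by blast
  \<comment> \<open>Both events are rewritten as events for the vector of increments, split into the
    first \<open>l\<close> coordinates and the last one.\<close>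
  define S where "S = {f \<in> space (Pi\<^sub>M {..<l} (\<lambda>_. borel :: (real ^ 'd) measure)). \<forall>u\<in>J. (\<Sum>k<idx u. f k) \<in> A u}"
  define S' where "S' = {f \<in> space (Pi\<^sub>M {l} (\<lambda>_. borel :: (real ^ 'd) measure)). f l \<in> C}"
  have SS: "S \<in> sets (Pi\<^sub>M {..<l} (\<lambda>_. borel :: (real ^ 'd) measure))"
    unfolding S_def
  proof (rule sets.sets_Collect_finite_All)
    fix u assume u: "u \<in> J"
    have "(\<lambda>f. \<Sum>k<idx u. f k) \<in> measurable (Pi\<^sub>M {..<l} (\<lambda>_. borel :: (real ^ 'd) measure)) borel"
      using idx(1)[OF u] by (intro borel_measurable_sum measurable_component_singleton) auto
    from measurable_sets[OF this A[of u]]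
    show "{f \<in> space (Pi\<^sub>M {..<l} (\<lambda>_. borel :: (real ^ 'd) measure)). (\<Sum>k<idx u. f k) \<in> A u} \<in> sets (Pi\<^sub>M {..<l} (\<lambda>_. borel :: (real ^ 'd) measure))"
      by (simp add: vimage_def Int_def conj_commute)
  qed (use J in auto)
  have SS': "S' \<in> sets (Pi\<^sub>M {l} (\<lambda>_. borel :: (real ^ 'd) measure))"
    unfolding S'_def using C by measurable
  have iv: "indep_var (Pi\<^sub>M {..<l} (\<lambda>_. borel)) (\<lambda>\<omega>. restrict (\<lambda>i. inc i \<omega>) {..<l}) (Pi\<^sub>M {l} (\<lambda>_. borel)) (\<lambda>\<omega>. restrict (\<lambda>i. inc i \<omega>) {l})"
    by (rule indep_var_restrict[OF ind]) auto
  have sum_restrict: "(\<Sum>k<idx u. restrict (\<lambda>i. inc i \<omega>) {..<l} k) = B u \<omega> - B 0 \<omega>" if "u \<in> J" for u \<omega>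
  proof -
    have "(\<Sum>k<idx u. restrict (\<lambda>i. inc i \<omega>) {..<l} k) = (\<Sum>k<idx u. inc k \<omega>)"
      using idx(1)[OF that] by (intro sum.cong) auto
    then show ?thesis using tele[of \<omega> "idx u"] idx(2)[OF that] by simp
  qed
  have S_iff: "restrict (\<lambda>i. inc i \<omega>) {..<l} \<in> S \<longleftrightarrow> (\<forall>u\<in>J. B u \<omega> - B 0 \<omega> \<in> A u)" for \<omega>
  proof -
    have "restrict (\<lambda>i. inc i \<omega>) {..<l} \<in> space (Pi\<^sub>M {..<l} (\<lambda>_. borel))" by (simp add: space_PiM)
    then show ?thesis unfolding S_def by (simp only: mem_Collect_eq sum_restrict simp_thms cong: ball_cong)
  qed
  have S'_iff: "restrict (\<lambda>i. inc i \<omega>) {l} \<in> S' \<longleftrightarrow> B t \<omega> - B s \<omega> \<in> C" for \<omega>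
    by (simp add: S'_def space_PiM inc_def Tl TSl)
  have setJ: "{\<omega> \<in> space M. \<forall>u\<in>J. B u \<omega> \<in> A u} \<in> sets M"
  proof (rule sets.sets_Collect_finite_All)
    fix u assume u: "u \<in> J"
    then have "0 \<le> u" using J by auto
    from measurable_sets[OF Bm[OF this] A[of u]] show "{\<omega> \<in> space M. B u \<omega> \<in> A u} \<in> sets M" 
      by (simp add: vimage_def Int_def conj_commute)
  qed (use J in auto)
  have setJ0: "{\<omega> \<in> space M. \<forall>u\<in>J. B u \<omega> - B 0 \<omega> \<in> A u} \<in> sets M"
  proof (rule sets.sets_Collect_finite_All)
    fix u assume u: "u \<in> J"
    then have "0 \<le> u" using J by auto
    then have "(\<lambda>\<omega>. B u \<omega> - B 0 \<omega>) \<in> borel_measurable M" by (intro borel_measurable_diff Bm) auto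
    from measurable_sets[OF this A[of u]] show "{\<omega> \<in> space M. B u \<omega> - B 0 \<omega> \<in> A u} \<in> sets M" 
      by (simp add: vimage_def Int_def conj_commute)
  qed (use J in auto)
  have setC: "{\<omega> \<in> space M. B t \<omega> - B s \<omega> \<in> C} \<in> sets M"
  proof -
    have "(\<lambda>\<omega>. B t \<omega> - B s \<omega>) \<in> borel_measurable M" using st by (intro borel_measurable_diff Bm) auto
    from measurable_sets[OF this C] show ?thesis by (simp add: vimage_def Int_def conj_commute)
  qed
  \<comment> \<open>The sums of increments give \<open>B u - B 0\<close>; replacing it by
    \<open>B u\<close> changes the events on a null set only.\<close>
  have e1: "prob {\<omega> \<in> space M. \<forall>u\<in>J. B u \<omega> \<in> A u} = prob {\<omega> \<in> space M. \<forall>u\<in>J. B u \<omega> - B 0 \<omega> \<in> A u}"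
    using B0 by (intro finite_measure_eq_AE setJ setJ0) (auto elim!: eventually_mono)
  have e2: "prob ({\<omega> \<in> space M. \<forall>u\<in>J. B u \<omega> \<in> A u} \<inter> {\<omega> \<in> space M. B t \<omega> - B s \<omega> \<in> C}) 
     = prob ({\<omega> \<in> space M. \<forall>u\<in>J. B u \<omega> - B 0 \<omega> \<in> A u} \<inter> {\<omega> \<in> space M. B t \<omega> - B s \<omega> \<in> C})"
    using B0 setC by (intro finite_measure_eq_AE sets.Int setJ setJ0) (auto elim!: eventually_mono)
  have "prob ((\<lambda>\<omega>. (restrict (\<lambda>i. inc i \<omega>) {..<l}, restrict (\<lambda>i. inc i \<omega>) {l})) -` (S \<times> S') \<inter> space M)
     = prob ((\<lambda>\<omega>. restrict (\<lambda>i. inc i \<omega>) {..<l}) -` S \<inter> space M) * prob ((\<lambda>\<omega>. restrict (\<lambda>i. inc i \<omega>) {l}) -` S' \<inter> space M)"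
    by (rule indep_varD[OF iv SS SS'])
  also have "(\<lambda>\<omega>. (restrict (\<lambda>i. inc i \<omega>) {..<l}, restrict (\<lambda>i. inc i \<omega>) {l})) -` (S \<times> S') \<inter> space M
     = {\<omega> \<in> space M. \<forall>u\<in>J. B u \<omega> - B 0 \<omega> \<in> A u} \<inter> {\<omega> \<in> space M. B t \<omega> - B s \<omega> \<in> C}"
    by (auto simp only: vimage_def mem_Times_iff fst_conv snd_conv S_iff S'_iff)
  also have "(\<lambda>\<omega>. restrict (\<lambda>i. inc i \<omega>) {..<l}) -` S \<inter> space M = {\<omega> \<in> space M. \<forall>u\<in>J. B u \<omega> - B 0 \<omega> \<in> A u}"
    by (auto simp only: vimage_def S_iff)
  also have "(\<lambda>\<omega>. restrict (\<lambda>i. inc i \<omega>) {l}) -` S' \<inter> space M = {\<omega> \<in> space M. B t \<omega> - B s \<omega> \<in> C}"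
    by (auto simp only: vimage_def S'_iff)
  finally show ?thesis unfolding e1[symmetric] e2[symmetric]
    by (simp add: Collect_conj_eq[symmetric] Int_def conj_ac) 
qed

text \<open>The given paths are well behaved only almost surely, so \<open>W\<close> is the pair
  altered on a null set. Its natural filtration is generated by an intersection-stable family of
  cylinder events; the product formula is checked on generators and extended to the
  sigma-algebras.\<close>

lemma brownian_pair_exists:
  fixes B :: "nat \<Rightarrow> real \<Rightarrow> 'w \<Rightarrow> real ^ 'd"
  assumes prob: "prob_space M"
    and bm: "\<And>i. i \<in> {1, 2} \<Longrightarrow> std_brownian_motion M (B i)"
    and indep: "prob_space.indep_vars M (\<lambda>_. Pi\<^sub>M {0..} (\<lambda>_. borel)) (\<lambda>i \<omega>. \<lambda>t\<in>{0..}. B i t \<omega>) {1, 2}"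
  shows "\<exists>Fil W. brownian M Fil W \<and> (AE \<omega> in M. \<forall>t\<ge>0. W t \<omega> = (B 1 t \<omega>, B 2 t \<omega>))"
proof -
  interpret prob_space M by (rule prob)
  note [simp del] = fst_diff snd_diff One_nat_def
  have bm12: "std_brownian_motion M (B 1)" "std_brownian_motion M (B 2)" using bm by auto
  have Bm: "B 1 u \<in> borel_measurable M" "B 2 u \<in> borel_measurable M" if "0 \<le> u" for u 
    using bm12 that by (simp_all add: std_brownian_motion_def)
  define good where "good \<omega> \<longleftrightarrow> B 1 0 \<omega> = 0 \<and> B 2 0 \<omega> = 0 \<and> continuous_on {0..} (\<lambda>t. B 1 t \<omega>) \<and> continuous_on {0..} (\<lambda>t. B 2 t \<omega>)" for \<omega>
  have "AE \<omega> in M. good \<omega>"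
    using bm12 by (auto simp: good_def std_brownian_motion_def)
  then obtain N where N: "{\<omega> \<in> space M. \<not> good \<omega>} \<subseteq> N" "emeasure M N = 0" "N \<in> sets M" by (rule AE_E)
  define G where "G = space M - N"
  have [measurable]: "G \<in> sets M" using N by (simp add: G_def)
  have G_AE: "AE \<omega> in M. \<omega> \<in> G" 
    using AE_not_in[of N M] N by (auto simp: G_def null_sets_def)
  have goodG: "good \<omega>" if "\<omega> \<in> G" for \<omega> using that N by (auto simp: G_def)
  \<comment> \<open>On the exceptional null set the path is replaced by the zero path, which is
    continuous and starts at 0.\<close>
  define W where "W t \<omega> = (if \<omega> \<in> G then (B 1 t \<omega>, B 2 t \<omega>) else 0)" for t \<omega>
  have W_AE: "AE \<omega> in M. \<forall>t\<ge>0. W t \<omega> = (B 1 t \<omega>, B 2 t \<omega>)"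
    using G_AE by eventually_elim (simp add: W_def)
  have W_meas: "W t \<in> borel_measurable M" if "0 \<le> t" for t
    unfolding W_def using Bm[OF that] by (intro measurable_If_set borel_measurable_Pair) auto
  define E where "E J A A' = {\<omega> \<in> space M. \<forall>u\<in>J. fst (W u \<omega>) \<in> A u \<and> snd (W u \<omega>) \<in> A' u}" 
    for J :: "real set" and A A' :: "real \<Rightarrow> (real ^ 'd) set"
  \<comment> \<open>Rectangles in the two components at finitely many times form a family closed
    under intersection, as the passage from generators to sigma-algebras requires.\<close>
  define gen where "gen s = {E J A A' | J A A'. finite J \<and> J \<subseteq> {0..s} \<and> (\<forall>u. A u \<in> sets borel) \<and> (\<forall>u. A' u \<in> sets borel)}" for s
  define Fil where "Fil s = sigma (space M) (gen s)" for s
  have E_sets: "E J A A' \<in> sets M" if "finite J" "J \<subseteq> {0..s}" "\<forall>u. A u \<in> sets borel" "\<forall>u. A' u \<in> sets borel" for s J A A'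
    unfolding E_def
  proof (rule sets.sets_Collect_finite_All)
    fix u assume "u \<in> J"
    then have [measurable]: "W u \<in> borel_measurable M" using that by (intro W_meas) auto
    have f: "(\<lambda>\<omega>. fst (W u \<omega>)) \<in> borel_measurable M" "(\<lambda>\<omega>. snd (W u \<omega>)) \<in> borel_measurable M"
      using \<open>W u \<in> borel_measurable M\<close> by (auto simp: borel_prod[symmetric])
    have "(\<lambda>\<omega>. fst (W u \<omega>)) -` A u \<inter> space M \<inter> ((\<lambda>\<omega>. snd (W u \<omega>)) -` A' u \<inter> space M) \<in> sets M"
      using that by (intro sets.Int measurable_sets[OF f(1)] measurable_sets[OF f(2)]) auto
    also have "(\<lambda>\<omega>. fst (W u \<omega>)) -` A u \<inter> space M \<inter> ((\<lambda>\<omega>. snd (W u \<omega>)) -` A' u \<inter> space M)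
      = {\<omega> \<in> space M. fst (W u \<omega>) \<in> A u \<and> snd (W u \<omega>) \<in> A' u}" by auto
    finally show "{\<omega> \<in> space M. fst (W u \<omega>) \<in> A u \<and> snd (W u \<omega>) \<in> A' u} \<in> sets M" .
  qed (use that in auto)
  have gen_I: "E J A A' \<in> gen s" if "finite J" "J \<subseteq> {0..s}" "\<forall>u. A u \<in> sets borel" "\<forall>u. A' u \<in> sets borel" for s J A A'
    unfolding gen_def using that by blast
  have gen_sub: "gen s \<subseteq> sets M" for s
    unfolding gen_def using E_sets by blast
  have gen_pow: "gen s \<subseteq> Pow (space M)" for s
    using gen_sub sets.space_closed by blast
  have sets_Fil: "sets (Fil s) = sigma_sets (space M) (gen s)" and space_Fil: "space (Fil s) = space M" for s
    using gen_pow by (auto simp: Fil_def)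
  have gen_stable: "Int_stable (gen s)" for s
  proof (rule Int_stableI)
    fix a b assume "a \<in> gen s" "b \<in> gen s"
    then obtain J A A' J' C C' where *: "a = E J A A'" "finite J" "J \<subseteq> {0..s}" "\<forall>u. A u \<in> sets borel" "\<forall>u. A' u \<in> sets borel"
      "b = E J' C C'" "finite J'" "J' \<subseteq> {0..s}" "\<forall>u. C u \<in> sets borel" "\<forall>u. C' u \<in> sets borel"
      unfolding gen_def by blast
    have "a \<inter> b = E (J \<union> J') (\<lambda>u. (if u \<in> J then A u else UNIV) \<inter> (if u \<in> J' then C u else UNIV))
       (\<lambda>u. (if u \<in> J then A' u else UNIV) \<inter> (if u \<in> J' then C' u else UNIV))"
      unfolding *(1) *(6) by (auto simp: E_def split: if_splits)
    moreover have "\<dots> \<in> gen s"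
      by (rule gen_I) (use * in auto)
    ultimately show "a \<inter> b \<in> gen s" by simp
  qed
  \<comment> \<open>Independence of the two motions separates the components, and
    \<open>brownian_past_indep_increment\<close> separates past from increment within each: four
    factors.\<close>
  have rect: "prob (E J A A' \<inter> {\<omega> \<in> space M. fst (W t \<omega> - W s \<omega>) \<in> C \<and> snd (W t \<omega> - W s \<omega>) \<in> C'})
     = (prob {\<omega> \<in> space M. \<forall>u\<in>J. B 1 u \<omega> \<in> A u} * prob {\<omega> \<in> space M. B 1 t \<omega> - B 1 s \<omega> \<in> C}) *
       (prob {\<omega> \<in> space M. \<forall>u\<in>J. B 2 u \<omega> \<in> A' u} * prob {\<omega> \<in> space M. B 2 t \<omega> - B 2 s \<omega> \<in> C'})"
    if st: "0 \<le> s" "s < t" and J: "finite J" "J \<subseteq> {0..s}" and A: "\<forall>u. A u \<in> sets borel" "\<forall>u. A' u \<in> sets borel"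
     and C: "C \<in> sets borel" "C' \<in> sets borel" for s t J A A' C C'
  proof -
    let ?P = "Pi\<^sub>M {0::real..} (\<lambda>_. borel :: (real ^ 'd) measure)"
    define S where "S A C = {f \<in> space ?P. (\<forall>u\<in>J. f u \<in> A u) \<and> f t - f s \<in> C}" for A C
    have SP: "S A C \<in> sets ?P" if "\<forall>u. A u \<in> sets borel" "C \<in> sets borel" for A C
    proof -
      have "(\<lambda>f. f t - f s) \<in> measurable ?P borel"
        using st by (intro borel_measurable_diff measurable_component_singleton) auto
      from measurable_sets[OF this that(2)] have 1: "{f \<in> space ?P. f t - f s \<in> C} \<in> sets ?P"
        by (simp add: vimage_def Int_def conj_commute)
      have 2: "{f \<in> space ?P. \<forall>u\<in>J. f u \<in> A u} \<in> sets ?P"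
      proof (rule sets.sets_Collect_finite_All)
        fix u assume "u \<in> J"
        then have "(\<lambda>f. f u) \<in> measurable ?P borel" using J by (intro measurable_component_singleton) auto
        from measurable_sets[OF this, of "A u"] that(1) show "{f \<in> space ?P. f u \<in> A u} \<in> sets ?P"
          by (simp add: vimage_def Int_def conj_commute)
      qed (use J in auto)
      have "S A C = {f \<in> space ?P. \<forall>u\<in>J. f u \<in> A u} \<inter> {f \<in> space ?P. f t - f s \<in> C}" by (auto simp: S_def)
      with 1 2 show ?thesis by auto
    qed
    define SS where "SS i = (if i = (1::nat) then S A C else S A' C')" for i
    have "prob (\<Inter>i\<in>{1,2}. (\<lambda>\<omega>. \<lambda>t\<in>{0..}. B i t \<omega>) -` SS i \<inter> space M) 
       = (\<Prod>i\<in>{1,2}. prob ((\<lambda>\<omega>. \<lambda>t\<in>{0..}. B i t \<omega>) -` SS i \<inter> space M))"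
      by (rule indep_varsD[OF indep]) (auto simp: SS_def SP A C)
    also have "\<dots> = prob ((\<lambda>\<omega>. \<lambda>t\<in>{0..}. B 1 t \<omega>) -` S A C \<inter> space M) * prob ((\<lambda>\<omega>. \<lambda>t\<in>{0..}. B 2 t \<omega>) -` S A' C' \<inter> space M)"
      by (simp add: SS_def)
    also have "(\<lambda>\<omega>. \<lambda>t\<in>{0..}. B 1 t \<omega>) -` S A C \<inter> space M = {\<omega> \<in> space M. (\<forall>u\<in>J. B 1 u \<omega> \<in> A u) \<and> B 1 t \<omega> - B 1 s \<omega> \<in> C}"
      using st J by (auto simp: S_def space_PiM subset_iff)
    also have "(\<lambda>\<omega>. \<lambda>t\<in>{0..}. B 2 t \<omega>) -` S A' C' \<inter> space M = {\<omega> \<in> space M. (\<forall>u\<in>J. B 2 u \<omega> \<in> A' u) \<and> B 2 t \<omega> - B 2 s \<omega> \<in> C'}"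
      using st J by (auto simp: S_def space_PiM subset_iff)
    finally have 1: "prob (\<Inter>i\<in>{1,2}. (\<lambda>\<omega>. \<lambda>t\<in>{0..}. B i t \<omega>) -` SS i \<inter> space M) = 
       (prob {\<omega> \<in> space M. \<forall>u\<in>J. B 1 u \<omega> \<in> A u} * prob {\<omega> \<in> space M. B 1 t \<omega> - B 1 s \<omega> \<in> C}) *
       (prob {\<omega> \<in> space M. \<forall>u\<in>J. B 2 u \<omega> \<in> A' u} * prob {\<omega> \<in> space M. B 2 t \<omega> - B 2 s \<omega> \<in> C'})"
      unfolding brownian_past_indep_increment[OF bm12(1) st J A(1)[rule_format] C(1)]
        brownian_past_indep_increment[OF bm12(2) st J A(2)[rule_format] C(2)] .
    have rv: "(\<lambda>\<omega>. \<lambda>t\<in>{0..}. B i t \<omega>) \<in> measurable M ?P" if "i \<in> {1,2}" for i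
      using that Bm by (intro measurable_restrict) auto
    have Wd: "(\<lambda>\<omega>. W t \<omega> - W s \<omega>) \<in> borel_measurable M" using st by (intro borel_measurable_diff W_meas) auto
    have "prob (\<Inter>i\<in>{1,2}. (\<lambda>\<omega>. \<lambda>t\<in>{0..}. B i t \<omega>) -` SS i \<inter> space M) = 
      prob (E J A A' \<inter> ((\<lambda>\<omega>. W t \<omega> - W s \<omega>) -` (C \<times> C') \<inter> space M))"
    proof (rule finite_measure_eq_AE)
      show "(\<Inter>i\<in>{1,2}. (\<lambda>\<omega>. \<lambda>t\<in>{0..}. B i t \<omega>) -` SS i \<inter> space M) \<in> sets M"
        by (intro sets.finite_INT measurable_sets[OF rv]) (auto simp: SS_def SP A C)
      show "E J A A' \<inter> ((\<lambda>\<omega>. W t \<omega> - W s \<omega>) -` (C \<times> C') \<inter> space M) \<in> sets M"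
        using C by (intro sets.Int E_sets[OF J A] measurable_sets[OF Wd]) (auto simp: borel_prod[symmetric])
      show "AE \<omega> in M. (\<omega> \<in> (\<Inter>i\<in>{1,2}. (\<lambda>\<omega>. \<lambda>t\<in>{0..}. B i t \<omega>) -` SS i \<inter> space M)) = 
        (\<omega> \<in> E J A A' \<inter> ((\<lambda>\<omega>. W t \<omega> - W s \<omega>) -` (C \<times> C') \<inter> space M))"
        using W_AE
      proof eventually_elim
        case (elim \<omega>)
        have "fst (W u \<omega>) = B 1 u \<omega>" "snd (W u \<omega>) = B 2 u \<omega>" if "u \<in> J" for u
          using elim[rule_format, of u] that J by auto
        moreover have "W t \<omega> - W s \<omega> = (B 1 t \<omega> - B 1 s \<omega>, B 2 t \<omega> - B 2 s \<omega>)"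
          using elim st by simp
        ultimately show ?case using J st by (auto simp: SS_def S_def E_def space_PiM subset_iff)
      qed
    qed
    also have "E J A A' \<inter> ((\<lambda>\<omega>. W t \<omega> - W s \<omega>) -` (C \<times> C') \<inter> space M) = E J A A' \<inter> {\<omega> \<in> space M. fst (W t \<omega> - W s \<omega>) \<in> C \<and> snd (W t \<omega> - W s \<omega>) \<in> C'}"
      by (rule set_eqI) (simp only: Int_iff vimage_eq mem_Times_iff mem_Collect_eq, blast)
    finally show ?thesis using 1 by metis
  qed
  have E_empty: "E {} A A' = space M" for A A' by (simp add: E_def)
  have incr_rect: "prob {\<omega> \<in> space M. fst (W t \<omega> - W s \<omega>) \<in> C \<and> snd (W t \<omega> - W s \<omega>) \<in> C'}
     = prob {\<omega> \<in> space M. B 1 t \<omega> - B 1 s \<omega> \<in> C} * prob {\<omega> \<in> space M. B 2 t \<omega> - B 2 s \<omega> \<in> C'}"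
    if "0 \<le> s" "s < t" "C \<in> sets borel" "C' \<in> sets borel" for s t C C'
    using rect[OF that(1,2), of "{}" "\<lambda>_. UNIV" "\<lambda>_. UNIV" C C'] that
    by (simp add: E_empty prob_space Int_absorb1 Collect_restrict)
  have past_rect: "prob (E J A A') = prob {\<omega> \<in> space M. \<forall>u\<in>J. B 1 u \<omega> \<in> A u} * prob {\<omega> \<in> space M. \<forall>u\<in>J. B 2 u \<omega> \<in> A' u}"
    if "0 \<le> s" "finite J" "J \<subseteq> {0..s}" "\<forall>u. A u \<in> sets borel" "\<forall>u. A' u \<in> sets borel" for s J A A'
  proof -
    have "E J A A' \<inter> space M = E J A A'" by (auto simp: E_def)
    \<comment> \<open>Nothing is asked of the increment, so any time after \<open>s\<close> serves;
      \<open>s + 1\<close> is one.\<close>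
    then show ?thesis using rect[OF that(1) _ that(2-5), of "s + 1" UNIV UNIV] by (simp add: prob_space)
  qed
  define rects where "rects s t = {{\<omega> \<in> space M. fst (W t \<omega> - W s \<omega>) \<in> C \<and> snd (W t \<omega> - W s \<omega>) \<in> C'} | C C'. C \<in> sets borel \<and> C' \<in> sets borel}" for s t
  have rects_sub: "rects s t \<subseteq> sets M" if "0 \<le> s" "s < t" for s t
  proof
    fix R assume "R \<in> rects s t"
    then obtain C C' where R: "R = {\<omega> \<in> space M. fst (W t \<omega> - W s \<omega>) \<in> C \<and> snd (W t \<omega> - W s \<omega>) \<in> C'}" 
      "C \<in> sets borel" "C' \<in> sets borel" unfolding rects_def by blast
    have Wd: "(\<lambda>\<omega>. W t \<omega> - W s \<omega>) \<in> borel_measurable M" using that by (intro borel_measurable_diff W_meas) auto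
    have "C \<times> C' \<in> sets borel" using R by (auto simp: borel_prod[symmetric])
    from measurable_sets[OF Wd this] show "R \<in> sets M" unfolding R
      by (simp add: vimage_def Int_def mem_Times_iff conj_ac)
  qed
  have rects_stable: "Int_stable (rects s t)" for s t
  proof (rule Int_stableI)
    fix a b assume "a \<in> rects s t" "b \<in> rects s t"
    then obtain C C' D D' where *: "a = {\<omega> \<in> space M. fst (W t \<omega> - W s \<omega>) \<in> C \<and> snd (W t \<omega> - W s \<omega>) \<in> C'}" 
      "C \<in> sets borel" "C' \<in> sets borel" "b = {\<omega> \<in> space M. fst (W t \<omega> - W s \<omega>) \<in> D \<and> snd (W t \<omega> - W s \<omega>) \<in> D'}" 
      "D \<in> sets borel" "D' \<in> sets borel" unfolding rects_def by blast
    have "a \<inter> b = {\<omega> \<in> space M. fst (W t \<omega> - W s \<omega>) \<in> C \<inter> D \<and> snd (W t \<omega> - W s \<omega>) \<in> C' \<inter> D'}" unfolding * by auto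
    then show "a \<inter> b \<in> rects s t" unfolding rects_def using * by blast
  qed
  have W_adapted: "W u \<in> borel_measurable (Fil s)" if "0 \<le> u" "u \<le> s" for u s
  proof -
    have "(\<lambda>\<omega>. fst (W u \<omega>)) \<in> borel_measurable (Fil s)"
    proof (rule measurableI)
      fix A :: "(real ^ 'd) set" assume "A \<in> sets borel"
      then have "E {u} (\<lambda>_. A) (\<lambda>_. UNIV) \<in> gen s" using that by (intro gen_I) auto
      then have "E {u} (\<lambda>_. A) (\<lambda>_. UNIV) \<in> sets (Fil s)" unfolding sets_Fil by (rule sigma_sets.Basic)
      then show "(\<lambda>\<omega>. fst (W u \<omega>)) -` A \<inter> space (Fil s) \<in> sets (Fil s)"
        by (simp add: E_def space_Fil vimage_def Int_def conj_commute)
    qed simp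
    moreover have "(\<lambda>\<omega>. snd (W u \<omega>)) \<in> borel_measurable (Fil s)"
    proof (rule measurableI)
      fix A :: "(real ^ 'd) set" assume "A \<in> sets borel"
      then have "E {u} (\<lambda>_. UNIV) (\<lambda>_. A) \<in> gen s" using that by (intro gen_I) auto
      then have "E {u} (\<lambda>_. UNIV) (\<lambda>_. A) \<in> sets (Fil s)" unfolding sets_Fil by (rule sigma_sets.Basic)
      then show "(\<lambda>\<omega>. snd (W u \<omega>)) -` A \<inter> space (Fil s) \<in> sets (Fil s)"
        by (simp add: E_def space_Fil vimage_def Int_def conj_commute)
    qed simp
    ultimately have "(\<lambda>\<omega>. (fst (W u \<omega>), snd (W u \<omega>))) \<in> borel_measurable (Fil s)" by (rule borel_measurable_Pair)
    then show ?thesis by simp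
  qed
  \<comment> \<open>Both sides are the product of two scaled Gaussians: the law of the increment
    because the components are independent, the scaled standard Gaussian of the product space
    because it factorises.\<close>
  have law: "prob {\<omega> \<in> space M. W t \<omega> - W s \<omega> \<in> C} = measure std_gauss {z. sqrt (t - s) *\<^sub>R z \<in> C}"
    if st: "0 \<le> s" "s < t" and C: "C \<in> sets borel" for s t C
  proof -
    interpret g: prob_space "std_gauss :: (real ^ 'd) measure" by (rule prob_space_std_gauss)
    interpret gg: prob_space "std_gauss :: ((real ^ 'd) \<times> (real ^ 'd)) measure" by (rule prob_space_std_gauss)
    define Q where "Q = distr std_gauss borel (\<lambda>z::real ^ 'd. sqrt (t - s) *\<^sub>R z)"
    interpret Q: prob_space Q unfolding Q_def by (rule g.prob_space_distr) simp
    have Wd: "(\<lambda>\<omega>. W t \<omega> - W s \<omega>) \<in> borel_measurable M" using st by (intro borel_measurable_diff W_meas) auto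
    have Qe: "emeasure Q A = measure std_gauss {z::real ^ 'd. sqrt (t - s) *\<^sub>R z \<in> A}" if "A \<in> sets borel" for A
      using that unfolding Q_def by (subst emeasure_distr) (auto simp: g.emeasure_eq_measure vimage_def)
    have 1: "Q \<Otimes>\<^sub>M Q = distr M borel (\<lambda>\<omega>. W t \<omega> - W s \<omega>)"
    proof (rule pair_measure_eqI)
      show "sets (Q \<Otimes>\<^sub>M Q) = sets (distr M borel (\<lambda>\<omega>. W t \<omega> - W s \<omega>))"
        by (simp add: Q_def borel_prod[symmetric] cong: sets_pair_measure_cong)
      fix A A' assume "A \<in> sets Q" "A' \<in> sets Q"
      then have A: "A \<in> sets borel" "A' \<in> sets borel" by (auto simp: Q_def)
      then have AA: "A \<times> A' \<in> sets borel" by (auto simp: borel_prod[symmetric])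
      have "emeasure (distr M borel (\<lambda>\<omega>. W t \<omega> - W s \<omega>)) (A \<times> A') = prob {\<omega> \<in> space M. fst (W t \<omega> - W s \<omega>) \<in> A \<and> snd (W t \<omega> - W s \<omega>) \<in> A'}"
        using AA Wd by (subst emeasure_distr) (auto simp: emeasure_eq_measure vimage_def Int_def mem_Times_iff conj_ac)
      then show "emeasure Q A * emeasure Q A' = emeasure (distr M borel (\<lambda>\<omega>. W t \<omega> - W s \<omega>)) (A \<times> A')"
        using A by (simp add: Qe incr_rect st brownian_increment_prob[OF bm12(1) st] brownian_increment_prob[OF bm12(2) st] ennreal_mult')
    qed (unfold_locales)
    have 2: "Q \<Otimes>\<^sub>M Q = distr std_gauss borel (\<lambda>z. sqrt (t - s) *\<^sub>R z)"
    proof -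
      have "Q \<Otimes>\<^sub>M Q = distr (std_gauss \<Otimes>\<^sub>M std_gauss) (borel \<Otimes>\<^sub>M borel) (\<lambda>(x, y). (sqrt (t - s) *\<^sub>R x, sqrt (t - s) *\<^sub>R y))"
        unfolding Q_def by (rule pair_measure_distr) (auto intro: Q.sigma_finite_measure_axioms[unfolded Q_def])
      also have "(\<lambda>(x, y). (sqrt (t - s) *\<^sub>R x, sqrt (t - s) *\<^sub>R y)) = (\<lambda>z::(real ^ 'd) \<times> (real ^ 'd). sqrt (t - s) *\<^sub>R z)"
        by (auto simp: fun_eq_iff)
      finally show ?thesis by (simp add: std_gauss_prod borel_prod)
    qed
    have "prob {\<omega> \<in> space M. W t \<omega> - W s \<omega> \<in> C} = measure (distr M borel (\<lambda>\<omega>. W t \<omega> - W s \<omega>)) C"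
      using C Wd by (subst measure_distr) (auto simp: vimage_def Int_def conj_ac)
    also have "\<dots> = measure std_gauss {z. sqrt (t - s) *\<^sub>R z \<in> C}"
      unfolding 1[symmetric] 2 using C by (subst measure_distr) (auto simp: vimage_def)
    finally show ?thesis .
  qed
  have "brownian M Fil W"
  proof unfold_locales
    fix s :: real assume s: "0 \<le> s"
    show "subalgebra M (Fil s)"
      unfolding subalgebra_def sets_Fil space_Fil using gen_sub sets.sigma_sets_subset by blast
    fix t assume "s \<le> t"
    have "gen s \<subseteq> gen t"
    proof
      fix a assume "a \<in> gen s"
      then obtain J A A' where "a = E J A A'" "finite J" "J \<subseteq> {0..s}" "\<forall>u. A u \<in> sets borel" "\<forall>u. A' u \<in> sets borel"
        unfolding gen_def by blast
      moreover have "{0..s} \<subseteq> {0..t}" using \<open>s \<le> t\<close> by auto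
      ultimately show "a \<in> gen t" using gen_I[of J t A A'] by blast
    qed
    then show "sets (Fil s) \<subseteq> sets (Fil t)" unfolding sets_Fil by (rule sigma_sets_mono')
  next
    fix u s :: real assume "0 \<le> u" "u \<le> s" then show "W u \<in> borel_measurable (Fil s)" by (rule W_adapted)
  next
    fix \<omega> assume "\<omega> \<in> space M"
    show "continuous_on {0..} (\<lambda>t. W t \<omega>)"
      using goodG[of \<omega>] unfolding W_def good_def by (cases "\<omega> \<in> G") (auto intro!: continuous_intros)
    show "W 0 \<omega> = 0" using goodG[of \<omega>] by (auto simp: W_def good_def zero_prod_def)
  next
    fix s t A and C :: "((real ^ 'd) \<times> (real ^ 'd)) set"
    assume st: "0 \<le> s" "s < t" and A: "A \<in> sets (Fil s)" and C: "C \<in> sets borel"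
    have "indep_set (gen s) (rects s t)"
    proof (rule indep_setI[OF gen_sub rects_sub[OF st]])
      fix a b assume "a \<in> gen s" "b \<in> rects s t"
      then obtain J A A' C C' where *: "a = E J A A'" "finite J" "J \<subseteq> {0..s}" "\<forall>u. A u \<in> sets borel" "\<forall>u. A' u \<in> sets borel"
        "b = {\<omega> \<in> space M. fst (W t \<omega> - W s \<omega>) \<in> C \<and> snd (W t \<omega> - W s \<omega>) \<in> C'}" "C \<in> sets borel" "C' \<in> sets borel"
        unfolding gen_def rects_def by blast
      show "prob (a \<inter> b) = prob a * prob b"
        unfolding *(1,6) rect[OF st *(2-5) *(7,8)] past_rect[OF st(1) *(2-5)] incr_rect[OF st *(7,8)] by simp
    qed
    then have ind: "indep_set (sigma_sets (space M) (gen s)) (sigma_sets (space M) (rects s t))"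
      by (rule indep_set_sigma_sets[OF _ gen_stable rects_stable])
    have UB: "UNIV \<in> sets (borel :: (real ^ 'd) measure)" by simp
    \<comment> \<open>Independence is known for the sigma-algebra generated by increment rectangles,
      while \<open>C\<close> is an arbitrary Borel set of the product. Both components are
      measurable for that sigma-algebra, hence so is the pair.\<close>
    define R where "R = sigma (space M) (rects s t)"
    have setsR: "sets R = sigma_sets (space M) (rects s t)" and spR: "space R = space M"
      using rects_sub[OF st] sets.space_closed unfolding R_def by (auto intro!: sets_measure_of space_measure_of)
    have "(\<lambda>\<omega>. fst (W t \<omega> - W s \<omega>)) \<in> borel_measurable R"
    proof (rule measurableI)
      fix A :: "(real ^ 'd) set" assume "A \<in> sets borel"
      then have "{\<omega> \<in> space M. fst (W t \<omega> - W s \<omega>) \<in> A \<and> snd (W t \<omega> - W s \<omega>) \<in> UNIV} \<in> rects s t"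
        unfolding rects_def using \<open>A \<in> sets borel\<close> UB by blast
      then have "{\<omega> \<in> space M. fst (W t \<omega> - W s \<omega>) \<in> A \<and> snd (W t \<omega> - W s \<omega>) \<in> UNIV} \<in> sets R"
        unfolding setsR by (rule sigma_sets.Basic)
      then show "(\<lambda>\<omega>. fst (W t \<omega> - W s \<omega>)) -` A \<inter> space R \<in> sets R"
        unfolding spR by (simp add: vimage_def Int_def conj_commute)
    qed simp
    moreover have "(\<lambda>\<omega>. snd (W t \<omega> - W s \<omega>)) \<in> borel_measurable R"
    proof (rule measurableI)
      fix A :: "(real ^ 'd) set" assume "A \<in> sets borel"
      then have "{\<omega> \<in> space M. fst (W t \<omega> - W s \<omega>) \<in> UNIV \<and> snd (W t \<omega> - W s \<omega>) \<in> A} \<in> rects s t"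
        unfolding rects_def using \<open>A \<in> sets borel\<close> UB by blast
      then have "{\<omega> \<in> space M. fst (W t \<omega> - W s \<omega>) \<in> UNIV \<and> snd (W t \<omega> - W s \<omega>) \<in> A} \<in> sets R"
        unfolding setsR by (rule sigma_sets.Basic)
      then show "(\<lambda>\<omega>. snd (W t \<omega> - W s \<omega>)) -` A \<inter> space R \<in> sets R"
        unfolding spR by (simp add: vimage_def Int_def conj_commute)
    qed simp
    ultimately have "(\<lambda>\<omega>. (fst (W t \<omega> - W s \<omega>), snd (W t \<omega> - W s \<omega>))) \<in> borel_measurable R" by (rule borel_measurable_Pair)
    then have "(\<lambda>\<omega>. W t \<omega> - W s \<omega>) \<in> borel_measurable R" by simp
    from measurable_sets[OF this C] have "{\<omega> \<in> space M. W t \<omega> - W s \<omega> \<in> C} \<in> sigma_sets (space M) (rects s t)"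
      unfolding setsR spR by (simp add: vimage_def Int_def conj_commute)
    with A ind have "prob (A \<inter> {\<omega> \<in> space M. W t \<omega> - W s \<omega> \<in> C}) = prob A * prob {\<omega> \<in> space M. W t \<omega> - W s \<omega> \<in> C}"
      unfolding sets_Fil by (intro indep_setD)
    then show "prob (A \<inter> {\<omega> \<in> space M. W t \<omega> - W s \<omega> \<in> C}) = prob A * measure std_gauss {z. sqrt (t - s) *\<^sub>R z \<in> C}"
      unfolding law[OF st C] .
  qed
  then show ?thesis using W_AE by blast
qed

section \<open>A modulus of continuity off an event of tiny probability\<close>

text \<open>One term of the exponential series. It trades the Gaussian tail for a power of arbitrary
  order, which is easier to sum and still strong enough.\<close>

lemma exp_minus_le_fact:
  assumes "(x::real) > 0"
  shows "exp (- x) \<le> fact p / x ^ p"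
proof -
  have "x ^ p / fact p \<le> exp x"
    using sum_le_suminf[of "\<lambda>n. x ^ n /\<^sub>R fact n" "{p}"] summable_exp_generic[of x] assms
    by (simp add: exp_def divide_inverse mult.commute)
  then have "x ^ p \<le> exp x * fact p" by (simp add: pos_divide_le_eq)
  then show ?thesis using assms by (simp add: exp_minus field_simps)
qed

context brownian begin

text \<open>The ratio \<open>9/10\<close> could be any number strictly between \<open>1/\<surd>2\<close> and \<open>1\<close>: the thresholds decay more slowly
  than the typical increments \<open>(N 2\<^sup>m)\<^sup>-\<^sup>1\<^sup>/\<^sup>2\<close>, and yet they are summable.\<close>

definition chain_event :: "nat \<Rightarrow> nat \<Rightarrow> real \<Rightarrow> 'w set" where
  "chain_event K N l = {\<omega> \<in> space M. \<forall>m. \<forall>k<K * N * 2 ^ m.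
     norm (W (real (Suc k) / (real N * 2 ^ m)) \<omega> - W (real k / (real N * 2 ^ m)) \<omega>) \<le> l * (9 / 10) ^ m}"

lemma W_dist_measurable:
  assumes "0 \<le> s" "0 \<le> t"
  shows "(\<lambda>\<omega>. norm (W t \<omega> - W s \<omega>)) \<in> borel_measurable M"
  using W_measurable[OF assms(1)] W_measurable[OF assms(2)] by measurable

lemma chain_event_sets [measurable]: "chain_event K N l \<in> sets M"
proof -
  have [measurable]: "W (real (Suc k) / (real N * 2 ^ m)) \<in> borel_measurable M" "W (real k / (real N * 2 ^ m)) \<in> borel_measurable M" for k m
    by (auto intro!: W_measurable)
  show ?thesis unfolding chain_event_def by measurable
qed

lemma increment_tail:
  assumes "0 \<le> s" "s < t" "l > 0"
  shows "prob {\<omega> \<in> space M. norm (W t \<omega> - W s \<omega>) > l} \<le> 2 powr (real DIM('e) / 2) * exp (- l\<^sup>2 / (4 * (t - s)))"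
proof -
  interpret g: prob_space "std_gauss :: 'e measure" by (rule prob_space_std_gauss)
  have "prob {\<omega> \<in> space M. norm (W t \<omega> - W s \<omega>) > l} = prob (space M \<inter> {\<omega> \<in> space M. W t \<omega> - W s \<omega> \<in> {v. norm v > l}})"
    by (simp add: Int_absorb1 Collect_restrict)
  also have "\<dots> = prob (space M) * measure std_gauss {z::'e. sqrt (t - s) *\<^sub>R z \<in> {v. norm v > l}}"
    using assms sets.top[of "Fil s"] space_Fil[of s] by (intro incr) auto
  also have "\<dots> \<le> measure std_gauss {z::'e. norm z \<ge> l / sqrt (t - s)}"
  proof -
    have "measure std_gauss {z::'e. sqrt (t - s) *\<^sub>R z \<in> {v. norm v > l}} \<le> measure std_gauss {z::'e. norm z \<ge> l / sqrt (t - s)}"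
      using assms by (intro g.finite_measure_mono) (auto simp: pos_divide_le_eq mult.commute)
    then show ?thesis by (simp add: prob_space)
  qed
  also have "\<dots> \<le> 2 powr (real DIM('e) / 2) * exp (- (l / sqrt (t - s))\<^sup>2 / 4)"
    using assms by (intro std_gauss_tail) auto
  also have "(l / sqrt (t - s))\<^sup>2 = l\<^sup>2 / (t - s)" using assms by (simp add: power_divide)
  finally show ?thesis by (simp add: mult.commute)
qed

text \<open>A union bound over the K N 2^m increments of each level m. The scaled squared threshold
  grows like (81/50)^m, so after \<open>exp_minus_le_fact\<close> the levels form a geometric series
  whose sum is at most twice its first term.\<close>

lemma chain_event_prob:
  assumes N: "N \<ge> 1" and l: "l > 0" and p: "p \<ge> 3"
  shows "prob (space M - chain_event K N l) \<le> 2 * (real K * real N * 2 powr (real DIM('e) / 2) * fact p * 4 ^ p / (real N * l\<^sup>2) ^ p)"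
proof -
  define c where "c = real K * real N * 2 powr (real DIM('e) / 2) * fact p * 4 ^ p / (real N * l\<^sup>2) ^ p"
  have c0: "c \<ge> 0" by (simp add: c_def)
  define bad where "bad m k = {\<omega> \<in> space M. norm (W (real (Suc k) / (real N * 2 ^ m)) \<omega> - W (real k / (real N * 2 ^ m)) \<omega>) > l * (9 / 10) ^ m}" for m k
  define Bad where "Bad m = (\<Union>k<K * N * 2 ^ m. bad m k)" for m
  have bad_sets[measurable]: "bad m k \<in> sets M" for m k
  proof -
    have [measurable]: "(\<lambda>\<omega>. norm (W (real (Suc k) / (real N * 2 ^ m)) \<omega> - W (real k / (real N * 2 ^ m)) \<omega>)) \<in> borel_measurable M"
      by (intro W_dist_measurable) auto
    show ?thesis unfolding bad_def by measurable
  qed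
  have Bad_sets: "Bad m \<in> sets M" for m unfolding Bad_def by (intro sets.finite_UN) auto
  have eq: "space M - chain_event K N l = (\<Union>m. Bad m)"
    unfolding chain_event_def Bad_def bad_def by (rule set_eqI) (simp add: not_le[symmetric] Bex_def del: not_le, blast)
  have pb: "prob (bad m k) \<le> 2 powr (real DIM('e) / 2) * (fact p / (real N * l\<^sup>2 * (81/50) ^ m / 4) ^ p)" for m k
  proof -
    have h: "real (Suc k) / (real N * 2 ^ m) - real k / (real N * 2 ^ m) = 1 / (real N * 2 ^ m)"
      by (simp add: diff_divide_distrib[symmetric])
    have "prob (bad m k) \<le> 2 powr (real DIM('e) / 2) * exp (- (l * (9 / 10) ^ m)\<^sup>2 / (4 * (real (Suc k) / (real N * 2 ^ m) - real k / (real N * 2 ^ m))))"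
      unfolding bad_def using l N by (intro increment_tail) (auto simp: divide_strict_right_mono)
    also have "- (l * (9 / 10) ^ m)\<^sup>2 / (4 * (real (Suc k) / (real N * 2 ^ m) - real k / (real N * 2 ^ m))) = - (real N * l\<^sup>2 * (81/50) ^ m / 4)"
    proof -
      \<comment> \<open>The square of the threshold loses (9/10)^2 per level and the variance loses
        1/2, so their ratio gains 2 (9/10)^2 = 81/50.\<close>
      have "((9 / 10) ^ m)\<^sup>2 * 2 ^ m = (((9/10)\<^sup>2 * 2) ^ m :: real)"
        by (simp add: power_mult_distrib power_mult[symmetric] mult.commute)
      also have "(9/10)\<^sup>2 * 2 = (81/50 :: real)" by (simp add: power2_eq_square)
      finally show ?thesis unfolding h by (simp add: power_mult_distrib)
    qed
    also have "exp (- (real N * l\<^sup>2 * (81/50) ^ m / 4)) \<le> fact p / (real N * l\<^sup>2 * (81/50) ^ m / 4) ^ p"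
      using N l by (intro exp_minus_le_fact) auto
    finally show ?thesis by simp
  qed
  have pB: "prob (Bad m) \<le> c * (1/2) ^ m" for m
  proof -
    have "prob (Bad m) \<le> (\<Sum>k<K * N * 2 ^ m. prob (bad m k))"
      unfolding Bad_def by (intro finite_measure_subadditive_finite) auto
    also have "\<dots> \<le> (\<Sum>k<K * N * 2 ^ m. 2 powr (real DIM('e) / 2) * (fact p / (real N * l\<^sup>2 * (81/50) ^ m / 4) ^ p))"
      by (intro sum_mono pb)
    also have "\<dots> = c * (2 ^ m / ((81/50) ^ m) ^ p)"
      by (simp add: c_def power_mult_distrib power_divide)
    also have "\<dots> = c * ((2 / (81/50) ^ p) ^ m)"
      by (simp add: power_divide power_mult[symmetric] mult.commute)
    also have "\<dots> \<le> c * (1/2) ^ m"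
    proof (intro mult_left_mono power_mono c0)
      \<comment> \<open>Each level doubles the number of increments, so (81/50)^p \<ge> 4 is needed
        for the ratio 1/2; the exponent 3 is the least that achieves it.\<close>
      have "(4::real) \<le> (81/50) ^ 3" by (simp add: power3_eq_cube)
      also have "\<dots> \<le> (81/50) ^ p" using p by (intro power_increasing) auto
      finally show "2 / (81/50) ^ p \<le> (1/2 :: real)" by (simp add: field_simps)
    qed auto
    finally show ?thesis .
  qed
  have geo: "summable (\<lambda>m. c * (1/2) ^ m)" "(\<Sum>m. c * (1/2) ^ m) = 2 * c"
    using suminf_geometric[of "1/2::real"] by (auto simp: suminf_mult summable_geometric)
  have sm: "summable (\<lambda>m. prob (Bad m))"
    by (rule summable_comparison_test'[OF geo(1), of 0]) (use pB in auto)
  have "prob (\<Union>m. Bad m) \<le> (\<Sum>m. prob (Bad m))"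
    using Bad_sets sm by (intro finite_measure_subadditive_countably) auto
  also have "\<dots> \<le> 2 * c"
    unfolding geo(2)[symmetric] by (intro suminf_le pB sm geo(1))
  finally show ?thesis unfolding eq c_def .
qed

lemma floor_double_cases: "\<lfloor>2 * x\<rfloor> = 2 * \<lfloor>x\<rfloor> \<or> \<lfloor>2 * x\<rfloor> = 2 * \<lfloor>x\<rfloor> + 1" for x :: real
  by linarith

text \<open>Chaining: round \<open>t\<close> down to the grids of mesh 1 / (N 2^m). Consecutive
  roundings agree or are one step of the finer grid apart, so the thresholds of the levels m \<ge> 1
  add up, and continuity closes the gap to \<open>t\<close>.\<close>

lemma chain_event_dyadic:
  assumes \<omega>: "\<omega> \<in> chain_event K N l" and N: "N \<ge> 1" and l: "l > 0" and t: "0 \<le> t" "t \<le> real K"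
  shows "norm (W t \<omega> - W (real (nat \<lfloor>t * real N\<rfloor>) / real N) \<omega>) \<le> 9 * l"
proof -
  define q where "q m = nat \<lfloor>t * real N * 2 ^ m\<rfloor>" for m :: nat
  define u where "u m = real (q m) / (real N * 2 ^ m)" for m
  have q_le: "real (q m) \<le> t * real N * 2 ^ m" "t * real N * 2 ^ m \<le> real (q m) + 1" for m
  proof -
    have "0 \<le> t * real N * 2 ^ m" using t by simp
    then show "real (q m) \<le> t * real N * 2 ^ m" "t * real N * 2 ^ m \<le> real (q m) + 1"
      unfolding q_def by linarith+
  qed
  have qK: "q m \<le> K * N * 2 ^ m" for m
  proof -
    have "t * real N * 2 ^ m \<le> real K * real N * 2 ^ m" using t by (intro mult_right_mono) auto
    then have "real (q m) \<le> real (K * N * 2 ^ m)" using q_le(1)[of m] by simp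
    then show ?thesis by (simp only: of_nat_le_iff)
  qed
  have step: "norm (W (u (Suc m)) \<omega> - W (u m) \<omega>) \<le> l * (9/10) ^ Suc m" for m
  proof -
    have "0 \<le> t * real N * 2 ^ m" using t by simp
    then have "q (Suc m) = 2 * q m \<or> q (Suc m) = 2 * q m + 1"
      using floor_double_cases[of "t * real N * 2 ^ m"] unfolding q_def
      by (auto simp: mult.assoc mult.left_commute nat_add_distrib nat_mult_distrib)
    then show ?thesis
    proof
      assume "q (Suc m) = 2 * q m"
      then have "u (Suc m) = u m" using N by (simp add: u_def)
      then show ?thesis using l by simp
    next
      assume qs: "q (Suc m) = 2 * q m + 1"
      then have "2 * q m < K * N * 2 ^ Suc m" using qK[of "Suc m"] by linarith
      then have "norm (W (real (Suc (2 * q m)) / (real N * 2 ^ Suc m)) \<omega> - W (real (2 * q m) / (real N * 2 ^ Suc m)) \<omega>) \<le> l * (9/10) ^ Suc m"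
        using \<omega> unfolding chain_event_def by blast
      moreover have "real (2 * q m) / (real N * 2 ^ Suc m) = u m" by (simp add: u_def)
      moreover have "real (Suc (2 * q m)) / (real N * 2 ^ Suc m) = u (Suc m)" by (simp add: u_def qs)
      ultimately show ?thesis by simp
    qed
  qed
  have "norm (W (u n) \<omega> - W (u 0) \<omega>) \<le> 9 * l" for n
  proof -
    have "norm (W (u n) \<omega> - W (u 0) \<omega>) \<le> (\<Sum>m<n. l * (9/10) ^ Suc m)"
    proof (induction n)
      case (Suc n)
      have "norm (W (u (Suc n)) \<omega> - W (u 0) \<omega>) \<le> norm (W (u (Suc n)) \<omega> - W (u n) \<omega>) + norm (W (u n) \<omega> - W (u 0) \<omega>)"
        using norm_triangle_ineq[of "W (u (Suc n)) \<omega> - W (u n) \<omega>" "W (u n) \<omega> - W (u 0) \<omega>"] by simp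
      then show ?case using Suc step[of n] by simp
    qed simp
    also have "\<dots> = l * (9/10) * (\<Sum>m<n. (9/10) ^ m)"
      by (simp add: sum_distrib_left mult.assoc)
    \<comment> \<open>The geometric series with ratio 9/10 sums to 10, and the first level that
      counts carries a factor 9/10.\<close>
    also have "\<dots> \<le> l * (9/10) * 10"
      using l by (intro mult_left_mono) (simp_all add: sum_gp_strict)
    finally show ?thesis by simp
  qed
  moreover have "(\<lambda>n. W (u n) \<omega>) \<longlonglongrightarrow> W t \<omega>"
  proof (rule continuous_on_tendsto_compose[OF cont])
    show "\<omega> \<in> space M" using \<omega> by (simp add: chain_event_def)
    show "u \<longlonglongrightarrow> t"
    proof (rule real_tendsto_sandwich[where f="\<lambda>n. t - (1/2) ^ n" and h="\<lambda>_. t"])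
      show "eventually (\<lambda>n. t - (1/2) ^ n \<le> u n) sequentially"
      proof (intro always_eventually allI)
        fix n
        have "t * (real N * 2 ^ n) - 1 \<le> real (q n)" using q_le(2)[of n] by (simp add: mult.assoc)
        then have "t - 1 / (real N * 2 ^ n) \<le> u n"
          using N unfolding u_def by (subst pos_le_divide_eq) (auto simp: left_diff_distrib)
        moreover have "1 / (real N * 2 ^ n) \<le> (1/2) ^ n"
          using N by (simp add: power_one_over field_simps)
        ultimately show "t - (1/2) ^ n \<le> u n" by simp
      qed
      show "eventually (\<lambda>n. u n \<le> t) sequentially"
        using N q_le(1) by (intro always_eventually allI) (simp add: u_def pos_divide_le_eq mult.assoc)
      show "(\<lambda>n. t - (1/2) ^ n) \<longlonglongrightarrow> t" by real_asymp
    qed simp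
    show "t \<in> {0..}" using t by simp
    show "eventually (\<lambda>n. u n \<in> {0..}) sequentially" by (simp add: u_def)
  qed
  ultimately have "norm (W t \<omega> - W (u 0) \<omega>) \<le> 9 * l"
    by (intro LIMSEQ_le_const2[of "\<lambda>n. norm (W (u n) \<omega> - W (u 0) \<omega>)"]) (auto intro!: tendsto_intros)
  then show ?thesis by (simp add: u_def q_def)
qed

text \<open>Moving each endpoint to the grid of mesh 1 / N costs 9 \<open>l\<close>, and at most N
  (t - s) + 1 grid steps in between cost \<open>l\<close> each: 9 + 9 + 1 = 19.\<close>

lemma chain_event_modulus:
  assumes \<omega>: "\<omega> \<in> chain_event K N l" and N: "N \<ge> 1" and l: "l > 0" and st: "0 \<le> s" "s \<le> t" "t \<le> real K"
  shows "norm (W t \<omega> - W s \<omega>) \<le> 19 * l * (1 + real N * (t - s))"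
proof -
  define j where "j = nat \<lfloor>s * real N\<rfloor>"
  define i where "i = nat \<lfloor>t * real N\<rfloor>"
  have j: "real j \<le> s * real N" "s * real N \<le> real j + 1" 
    unfolding j_def using mult_nonneg_nonneg[of s "real N"] st by linarith+
  have i: "real i \<le> t * real N" "t * real N \<le> real i + 1" 
    unfolding i_def using mult_nonneg_nonneg[of t "real N"] st by linarith+
  have ji: "j \<le> i" unfolding i_def j_def using st by (intro nat_mono floor_mono mult_right_mono) auto
  have iK: "i \<le> K * N"
  proof -
    have "t * real N \<le> real K * real N" using st by (intro mult_right_mono) auto
    then have "real i \<le> real (K * N)" using i by simp
    then show ?thesis by (simp only: of_nat_le_iff)
  qed
  have "norm (W (real n / real N) \<omega> - W (real j / real N) \<omega>) \<le> (real n - real j) * l" if "j \<le> n" "n \<le> i" for n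
    using that
  proof (induction n rule: dec_induct)
    case (step n)
    have "n < K * N * 2 ^ 0" using step iK by simp
    then have "norm (W (real (Suc n) / (real N * 2 ^ 0)) \<omega> - W (real n / (real N * 2 ^ 0)) \<omega>) \<le> l * (9/10) ^ 0"
      using \<omega> unfolding chain_event_def by blast
    moreover have "norm (W (real (Suc n) / real N) \<omega> - W (real j / real N) \<omega>) \<le> norm (W (real (Suc n) / real N) \<omega> - W (real n / real N) \<omega>) + norm (W (real n / real N) \<omega> - W (real j / real N) \<omega>)"
      using norm_triangle_ineq[of "W (real (Suc n) / real N) \<omega> - W (real n / real N) \<omega>" "W (real n / real N) \<omega> - W (real j / real N) \<omega>"] by simp
    ultimately show ?case using step by (simp add: algebra_simps)
  qed simp
  from this[OF ji order_refl] have 1: "norm (W (real i / real N) \<omega> - W (real j / real N) \<omega>) \<le> (real i - real j) * l" .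
  also have "\<dots> \<le> (real N * (t - s) + 1) * l" using i j l by (intro mult_right_mono) (auto simp: algebra_simps)
  finally have 1: "norm (W (real i / real N) \<omega> - W (real j / real N) \<omega>) \<le> (real N * (t - s) + 1) * l" .
  have 2: "norm (W t \<omega> - W (real i / real N) \<omega>) \<le> 9 * l" unfolding i_def using st by (intro chain_event_dyadic[OF \<omega> N l]) auto
  have 3: "norm (W s \<omega> - W (real j / real N) \<omega>) \<le> 9 * l" unfolding j_def using st by (intro chain_event_dyadic[OF \<omega> N l]) auto
  have "W t \<omega> - W s \<omega> = (W t \<omega> - W (real i / real N) \<omega>) + (W (real i / real N) \<omega> - W (real j / real N) \<omega>) - (W s \<omega> - W (real j / real N) \<omega>)" by simp
  also have "norm \<dots> \<le> 9 * l + (real N * (t - s) + 1) * l + 9 * l"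
    by (intro order_trans[OF norm_triangle_ineq4] order_trans[OF norm_triangle_ineq] add_mono 1 2 3 order_refl)
  also have "\<dots> \<le> 19 * l * (1 + real N * (t - s))"
  proof -
    have "0 \<le> l * (real N * (t - s))" using l st by simp
    then show ?thesis by (simp add: algebra_simps)
  qed
  finally show ?thesis .
qed

end

section \<open>Ornstein--Uhlenbeck positions\<close>

text \<open>\<open>l\<close> times this is the average of the past of \<open>w\<close> under the
  weight l exp(-l (t - s)), of mass 1 - exp(-l t). It is a pathwise solution formula for
  Ornstein-Uhlenbeck positions, so no stochastic integral appears.\<close>

definition memory :: "real \<Rightarrow> (real \<Rightarrow> 'a::euclidean_space) \<Rightarrow> real \<Rightarrow> 'a" where
  "memory l w t = exp (- l * t) *\<^sub>R integral {0..t} (\<lambda>s. exp (l * s) *\<^sub>R w s)"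

text \<open>The integral U of \<open>V\<close> solves U' = c w - l U, and the integrating factor
  exp(l s) makes this an exact derivative.\<close>

lemma ou_integral_eq_memory:
  fixes V w :: "real \<Rightarrow> 'a::euclidean_space"
  assumes V: "continuous_on {0..} V"
    and eq: "\<And>t. 0 \<le> t \<Longrightarrow> V t = c *\<^sub>R w t - l *\<^sub>R integral {0..t} V" and t: "0 \<le> t"
  shows "integral {0..t} V = c *\<^sub>R memory l w t"
proof -
  have Vc: "continuous_on {0..t} V" using V by (rule continuous_on_subset) auto
  have "((\<lambda>s. (exp (l * s) * c) *\<^sub>R w s) has_integral exp (l * t) *\<^sub>R integral {0..t} V - exp (l * 0) *\<^sub>R integral {0..0} V) {0..t}"
  proof (rule fundamental_theorem_of_calculus[OF t])
    fix s assume s: "s \<in> {0..t}"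
    have "((\<lambda>s. exp (l * s) *\<^sub>R integral {0..s} V) has_vector_derivative exp (l * s) *\<^sub>R V s + (l * exp (l * s)) *\<^sub>R integral {0..s} V) (at s within {0..t})"
      by (rule has_vector_derivative_scaleR[OF _ integral_has_vector_derivative[OF Vc s]])
         (auto intro!: derivative_eq_intros)
    moreover have "exp (l * s) *\<^sub>R V s + (l * exp (l * s)) *\<^sub>R integral {0..s} V = (exp (l * s) * c) *\<^sub>R w s"
      using s by (subst eq) (auto simp: algebra_simps)
    ultimately show "((\<lambda>s. exp (l * s) *\<^sub>R integral {0..s} V) has_vector_derivative (exp (l * s) * c) *\<^sub>R w s) (at s within {0..t})"
      by simp
  qed
  then have "integral {0..t} (\<lambda>s. (exp (l * s) * c) *\<^sub>R w s) = exp (l * t) *\<^sub>R integral {0..t} V"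
    by (simp add: integral_unique)
  moreover have "integral {0..t} (\<lambda>s. (exp (l * s) * c) *\<^sub>R w s) = c *\<^sub>R integral {0..t} (\<lambda>s. exp (l * s) *\<^sub>R w s)"
    by (simp add: mult.commute[of _ c] flip: scaleR_scaleR)
  ultimately have e: "c *\<^sub>R integral {0..t} (\<lambda>s. exp (l * s) *\<^sub>R w s) = exp (l * t) *\<^sub>R integral {0..t} V" by simp
  have "c *\<^sub>R memory l w t = exp (- l * t) *\<^sub>R (c *\<^sub>R integral {0..t} (\<lambda>s. exp (l * s) *\<^sub>R w s))"
    unfolding memory_def by (rule scaleR_left_commute)
  then show ?thesis unfolding e by (simp add: exp_minus)
qed

lemma memory_continuous:
  assumes w: "continuous_on {0..} w"
  shows "continuous_on {0..} (memory l w)"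
proof -
  have "continuous_on {0..T} (memory l w)" for T
  proof -
    have "continuous_on {0..T} w" using w by (rule continuous_on_subset) auto
    then have "(\<lambda>s. exp (l * s) *\<^sub>R w s) integrable_on {0..T}"
      by (intro integrable_continuous_interval continuous_intros)
    then show ?thesis
      unfolding memory_def by (intro continuous_intros indefinite_integral_continuous_1)
  qed
  then have "continuous (at t within {0..}) (memory l w)" if "t \<in> {0..}" for t
  proof -
    have "continuous (at t within {0..t + 1}) (memory l w)"
      using \<open>\<And>T. continuous_on {0..T} (memory l w)\<close>[of "t + 1"] that by (simp add: continuous_on_eq_continuous_within)
    moreover have "at t within {0..t + 1} = at t within {0..}"
      by (rule at_within_nhd[of t "{..<t + 1}"]) auto
    ultimately show ?thesis by simp
  qed
  then show ?thesis unfolding continuous_on_eq_continuous_within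
    by blast
qed

text \<open>The difference is the exponential average of \<open>w s - w t\<close> minus the missing
  mass exp(-l t) times \<open>w t\<close>; the modulus controls the first for all \<open>s\<close>
  and the second through \<open>s\<close> = 0. The term n / l reflects that an exponential variable
  of rate \<open>l\<close> has mean 1 / l.\<close>

lemma memory_close:
  fixes w :: "real \<Rightarrow> 'a::euclidean_space"
  assumes w: "continuous_on {0..t} w" and w0: "w 0 = 0" and l: "l > 0" and t: "0 \<le> t" and A: "A \<ge> 0" "n \<ge> 0"
    and mod: "\<And>s. 0 \<le> s \<Longrightarrow> s \<le> t \<Longrightarrow> norm (w t - w s) \<le> A * (1 + n * (t - s))"
  shows "norm (l *\<^sub>R memory l w t - w t) \<le> A * (1 + n / l)"
proof -
  have i1: "(\<lambda>s. exp (l * s) *\<^sub>R w s) integrable_on {0..t}"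
    using w by (intro integrable_continuous_interval continuous_intros)
  have i2: "((\<lambda>s. l * exp (l * s)) has_integral exp (l * t) - exp (l * 0)) {0..t}"
    by (rule fundamental_theorem_of_calculus[OF t])
       (auto intro!: derivative_eq_intros simp: has_real_derivative_iff_has_vector_derivative[symmetric])
  then have "((\<lambda>s. (l * exp (l * s)) *\<^sub>R w t) has_integral (exp (l * t) - exp (l * 0)) *\<^sub>R w t) {0..t}"
    by (rule has_integral_scaleR_left)
  then have "((\<lambda>s. l *\<^sub>R (exp (l * s) *\<^sub>R w s) - (l * exp (l * s)) *\<^sub>R w t) has_integral 
      l *\<^sub>R integral {0..t} (\<lambda>s. exp (l * s) *\<^sub>R w s) - (exp (l * t) - exp (l * 0)) *\<^sub>R w t) {0..t}"
    using i1 by (intro has_integral_diff has_integral_cmul integrable_integral)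
  then have i3: "((\<lambda>s. (l * exp (l * s)) *\<^sub>R (w s - w t)) has_integral 
      l *\<^sub>R integral {0..t} (\<lambda>s. exp (l * s) *\<^sub>R w s) - (exp (l * t) - 1) *\<^sub>R w t) {0..t}"
    by (simp add: algebra_simps)
  \<comment> \<open>The antiderivative comes from integration by parts; the extra n / l compensates
    the derivative of the linear factor.\<close>
  have i4: "((\<lambda>s. l * exp (l * s) * (A * (1 + n * (t - s)))) has_integral 
     A * exp (l * t) * (1 + n * (t - t) + n / l) - A * exp (l * 0) * (1 + n * (t - 0) + n / l)) {0..t}"
  proof (rule fundamental_theorem_of_calculus[OF t])
    fix s assume "s \<in> {0..t}"
    have "((\<lambda>s. A * exp (l * s) * (1 + n * (t - s) + n / l)) has_real_derivative l * exp (l * s) * (A * (1 + n * (t - s)))) (at s within {0..t})"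
      using l by (auto intro!: derivative_eq_intros simp: field_simps)
    then show "((\<lambda>s. A * exp (l * s) * (1 + n * (t - s) + n / l)) has_vector_derivative l * exp (l * s) * (A * (1 + n * (t - s)))) (at s within {0..t})"
      by (simp add: has_real_derivative_iff_has_vector_derivative)
  qed
  have b: "norm (l *\<^sub>R integral {0..t} (\<lambda>s. exp (l * s) *\<^sub>R w s) - (exp (l * t) - 1) *\<^sub>R w t) 
     \<le> A * exp (l * t) * (1 + n / l) - A * (1 + n * t + n / l)"
  proof -
    have "norm (integral {0..t} (\<lambda>s. (l * exp (l * s)) *\<^sub>R (w s - w t))) \<le> integral {0..t} (\<lambda>s. l * exp (l * s) * (A * (1 + n * (t - s))))"
    proof (rule integral_norm_bound_integral)
      fix s assume "s \<in> {0..t}"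
      then show "norm ((l * exp (l * s)) *\<^sub>R (w s - w t)) \<le> l * exp (l * s) * (A * (1 + n * (t - s)))"
        using mod[of s] l by (simp add: norm_minus_commute)
    qed (use i3 i4 in \<open>auto simp: integrable_on_def\<close>)
    then show ?thesis using integral_unique[OF i3] integral_unique[OF i4] by simp
  qed
  have "l *\<^sub>R memory l w t - w t = exp (- l * t) *\<^sub>R ((l *\<^sub>R integral {0..t} (\<lambda>s. exp (l * s) *\<^sub>R w s) - (exp (l * t) - 1) *\<^sub>R w t) - w t)"
  proof -
    have e: "exp (- l * t) * exp (l * t) = 1" by (simp add: exp_minus)
    have "exp (- l * t) *\<^sub>R ((l *\<^sub>R integral {0..t} (\<lambda>s. exp (l * s) *\<^sub>R w s) - (exp (l * t) - 1) *\<^sub>R w t) - w t) 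
      = l *\<^sub>R memory l w t - (exp (- l * t) * exp (l * t)) *\<^sub>R w t"
      unfolding memory_def by (simp add: algebra_simps)
    then show ?thesis unfolding e by simp
  qed
  also have "norm \<dots> \<le> exp (- l * t) * ((A * exp (l * t) * (1 + n / l) - A * (1 + n * t + n / l)) + A * (1 + n * t))"
  proof -
    have "norm (w t) \<le> A * (1 + n * t)" using mod[of 0] t w0 by simp
    then have "norm ((l *\<^sub>R integral {0..t} (\<lambda>s. exp (l * s) *\<^sub>R w s) - (exp (l * t) - 1) *\<^sub>R w t) - w t) 
       \<le> (A * exp (l * t) * (1 + n / l) - A * (1 + n * t + n / l)) + A * (1 + n * t)"
      by (intro order_trans[OF norm_triangle_ineq4] add_mono b)
    then show ?thesis by (simp add: mult_left_mono)
  qed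
  also have "\<dots> = A * (1 + n / l) - exp (- l * t) * (A * (n / l))"
  proof -
    have e: "exp (- l * t) * exp (l * t) = 1" by (simp add: exp_minus)
    have "exp (- l * t) * ((A * exp (l * t) * (1 + n / l) - A * (1 + n * t + n / l)) + A * (1 + n * t)) = 
      (exp (- l * t) * exp (l * t)) * (A * (1 + n / l)) - exp (- l * t) * (A * (n / l))"
      by (simp add: algebra_simps)
    then show ?thesis unfolding e by simp
  qed
  also have "\<dots> \<le> A * (1 + n / l)" using A l by simp
  finally show ?thesis .
qed

text \<open>Clamping times to [0, t] shows that only the path up to \<open>t\<close> is used, so
  with \<open>F\<close> the sigma-algebra of time \<open>t\<close> this is adaptedness.
  Measurability is that of a Lebesgue integral depending on a parameter.\<close>

lemma memory_measurable:
  fixes w :: "real \<Rightarrow> 'w \<Rightarrow> 'a::euclidean_space"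
  assumes cont: "\<And>\<omega>. \<omega> \<in> space F \<Longrightarrow> continuous_on {0..} (\<lambda>s. w s \<omega>)"
    and meas: "\<And>s. 0 \<le> s \<Longrightarrow> s \<le> t \<Longrightarrow> w s \<in> borel_measurable F" and t: "0 \<le> t"
  shows "(\<lambda>\<omega>. memory l (\<lambda>s. w s \<omega>) t) \<in> borel_measurable F"
proof -
  have "(\<lambda>(s, \<omega>). w (max 0 (min s t)) \<omega>) \<in> borel_measurable (borel \<Otimes>\<^sub>M F)"
  proof (rule continuous_process_jointly_measurable[where S="{0..t}"])
    show "continuous_on {0..t} (\<lambda>s. w s \<omega>)" if "\<omega> \<in> space F" for \<omega>
      using cont[OF that] by (rule continuous_on_subset) auto
  qed (use meas t in \<open>auto intro!: continuous_intros\<close>)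
  then have "(\<lambda>p. w (max 0 (min (fst p) t)) (snd p)) \<in> borel_measurable (borel \<Otimes>\<^sub>M F)"
    by (simp add: case_prod_beta')
  from measurable_compose[OF measurable_pair_swap' this]
  have [measurable]: "(\<lambda>p. w (max 0 (min (snd p) t)) (fst p)) \<in> borel_measurable (F \<Otimes>\<^sub>M borel)"
    by (simp add: case_prod_beta')
  have "(\<lambda>\<omega>. LINT s|lborel. indicator {0..t} s *\<^sub>R (exp (l * s) *\<^sub>R w (max 0 (min s t)) \<omega>)) \<in> borel_measurable F"
    by (rule lborel.borel_measurable_lebesgue_integral) (simp add: case_prod_beta')
  then have "(\<lambda>\<omega>. exp (- l * t) *\<^sub>R (LINT s|lborel. indicator {0..t} s *\<^sub>R (exp (l * s) *\<^sub>R w (max 0 (min s t)) \<omega>))) \<in> borel_measurable F"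
    by simp
  also have "?this \<longleftrightarrow> ?thesis"
  proof (rule measurable_cong)
    fix \<omega> assume \<omega>: "\<omega> \<in> space F"
    have "continuous_on {0..t} (\<lambda>s. w s \<omega>)" using cont[OF \<omega>] by (rule continuous_on_subset) auto
    then have "set_integrable lborel {0..t} (\<lambda>s. exp (l * s) *\<^sub>R w s \<omega>)"
      by (intro borel_integrable_atLeastAtMost' continuous_intros)
    then have "(LINT s:{0..t}|lborel. exp (l * s) *\<^sub>R w s \<omega>) = integral {0..t} (\<lambda>s. exp (l * s) *\<^sub>R w s \<omega>)"
      by (rule set_borel_integral_eq_integral(2))
    moreover have "(LINT s:{0..t}|lborel. exp (l * s) *\<^sub>R w s \<omega>) = (LINT s|lborel. indicator {0..t} s *\<^sub>R (exp (l * s) *\<^sub>R w (max 0 (min s t)) \<omega>))"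
      unfolding set_lebesgue_integral_def
      by (intro Bochner_Integration.integral_cong) (auto simp: indicator_def min_def)
    ultimately show "exp (- l * t) *\<^sub>R (LINT s|lborel. indicator {0..t} s *\<^sub>R (exp (l * s) *\<^sub>R w (max 0 (min s t)) \<omega>)) = memory l (\<lambda>s. w s \<omega>) t"
      by (simp add: memory_def)
  qed
  finally show ?thesis .
qed

section \<open>Hitting times\<close>

text \<open>Inserting \<open>K\<close> makes the set nonempty and the time real and bounded; the
  value \<open>K\<close> also stands for paths that have not hit by then.\<close>

definition hit_time :: "real \<Rightarrow> real \<Rightarrow> (real \<Rightarrow> 'a::real_normed_vector) \<Rightarrow> real" where
  "hit_time K r p = Inf (insert K {t. 0 \<le> t \<and> norm (p t) \<le> r})"

context
  fixes p :: "real \<Rightarrow> 'a::real_normed_vector" and K r :: real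
  assumes p: "continuous_on {0..} p" and K: "0 \<le> K"
begin

lemma hit_set_closed: "closed {t. 0 \<le> t \<and> norm (p t) \<le> r}"
proof -
  have "closed ({0..} \<inter> (\<lambda>t. norm (p t)) -` {..r})"
    using p by (intro continuous_closed_preimage continuous_intros) auto
  moreover have "{0..} \<inter> (\<lambda>t. norm (p t)) -` {..r} = {t. 0 \<le> t \<and> norm (p t) \<le> r}" by auto
  ultimately show ?thesis by simp
qed

lemma hit_set_bdd: "bdd_below (insert K {t. 0 \<le> t \<and> norm (p t) \<le> r})"
  using K by (intro bdd_belowI[of _ 0]) auto

lemma hit_time_in: "hit_time K r p \<in> insert K {t. 0 \<le> t \<and> norm (p t) \<le> r}"
  unfolding hit_time_def using hit_set_closed hit_set_bdd
  by (intro closed_contains_Inf) (auto simp: closed_insert)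

lemma hit_time_bounds: "0 \<le> hit_time K r p" "hit_time K r p \<le> K"
proof -
  show "0 \<le> hit_time K r p" using hit_time_in K by auto
  show "hit_time K r p \<le> K" unfolding hit_time_def using hit_set_bdd by (intro cInf_lower) auto
qed

lemma hit_time_le: "0 \<le> t \<Longrightarrow> norm (p t) \<le> r \<Longrightarrow> hit_time K r p \<le> t"
  unfolding hit_time_def using hit_set_bdd by (intro cInf_lower) auto

lemma before_hit_time: "0 \<le> t \<Longrightarrow> t < hit_time K r p \<Longrightarrow> norm (p t) > r"
  using hit_time_le[of t] by (meson not_le)

text \<open>The hitting set is closed, which gives one inequality; the path stays above
  \<open>r\<close> before the hit, and approaching from the left gives the other. The condition at
  time 0 ensures that there is a left side to approach from.\<close>

lemma norm_at_hit_time: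
  assumes "hit_time K r p < K" "norm (p 0) > r"
  shows "norm (p (hit_time K r p)) = r"
proof (rule antisym)
  let ?h = "hit_time K r p"
  show le: "norm (p ?h) \<le> r" using hit_time_in assms by auto
  then have "?h \<noteq> 0" using assms by auto
  then have h: "0 < ?h" using hit_time_bounds by simp
  have c: "continuous_on {0..} (\<lambda>t. norm (p t))" using p by (intro continuous_intros)
  have lim: "(\<lambda>n. c * (1 - 1 / real (Suc n))) \<longlonglongrightarrow> c" for c :: real by real_asymp
  have "(\<lambda>n. norm (p (?h * (1 - 1 / real (Suc n))))) \<longlonglongrightarrow> norm (p ?h)"
  proof (rule continuous_on_tendsto_compose[OF c lim])
    show "eventually (\<lambda>n. ?h * (1 - 1 / real (Suc n)) \<in> {0..}) sequentially"
      using h by (intro always_eventually allI) (simp only: atLeast_iff, intro mult_nonneg_nonneg, auto)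
  qed (use h in simp)
  moreover have "r \<le> norm (p (?h * (1 - 1 / real (Suc n))))" for n
  proof (rule less_imp_le, rule before_hit_time)
    show "0 \<le> ?h * (1 - 1 / real (Suc n))" using h by (intro mult_nonneg_nonneg) auto
    have "?h * (1 - 1 / real (Suc n)) < ?h * 1" using h by (intro mult_strict_left_mono) auto
    then show "?h * (1 - 1 / real (Suc n)) < ?h" by simp
  qed
  ultimately show "r \<le> norm (p ?h)" by (intro LIMSEQ_le_const) auto
qed

text \<open>Expresses the event through countably many path values at times up to \<open>s\<close>,
  so that it belongs to the sigma-algebra of time \<open>s\<close>. A hit is approximated at
  rational fractions of \<open>s\<close>; conversely the minimum over the compact interval is
  attained. No look beyond \<open>s\<close> is needed because the target is closed.\<close>

lemma hit_time_le_iff: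
  assumes "0 \<le> s"
  shows "hit_time K r p \<le> s \<longleftrightarrow> K \<le> s \<or> (\<forall>n. \<exists>j k::nat. j \<le> k \<and> 0 < k \<and> norm (p (s * (real j / real k))) < r + 1 / real (Suc n))"
proof
  assume h: "hit_time K r p \<le> s"
  show "K \<le> s \<or> (\<forall>n. \<exists>j k::nat. j \<le> k \<and> 0 < k \<and> norm (p (s * (real j / real k))) < r + 1 / real (Suc n))"
  proof (cases "K \<le> s")
    case False
    then have le: "norm (p (hit_time K r p)) \<le> r" using hit_time_in h by auto
    define x where "x = (if s = 0 then 0 else hit_time K r p / s)"
    have x: "0 \<le> x" "x \<le> 1" "s * x = hit_time K r p"
      using hit_time_bounds h assms by (auto simp: x_def)
    have q: "real (nat \<lfloor>x * real (Suc m)\<rfloor>) \<le> x * real (Suc m)" "x * real (Suc m) \<le> real (nat \<lfloor>x * real (Suc m)\<rfloor>) + 1" for m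
      using mult_nonneg_nonneg[of x "real (Suc m)"] x by linarith+
    have lim: "(\<lambda>m. real (nat \<lfloor>x * real (Suc m)\<rfloor>) / real (Suc m)) \<longlonglongrightarrow> x"
    proof (rule real_tendsto_sandwich[where f="\<lambda>m. x - 1 / real (Suc m)" and h="\<lambda>_. x"])
      show "eventually (\<lambda>m. x - 1 / real (Suc m) \<le> real (nat \<lfloor>x * real (Suc m)\<rfloor>) / real (Suc m)) sequentially"
      proof (intro always_eventually allI)
        fix m show "x - 1 / real (Suc m) \<le> real (nat \<lfloor>x * real (Suc m)\<rfloor>) / real (Suc m)"
          using q(2)[of m] by (subst pos_le_divide_eq) (simp_all add: left_diff_distrib)
      qed
      show "eventually (\<lambda>m. real (nat \<lfloor>x * real (Suc m)\<rfloor>) / real (Suc m) \<le> x) sequentially"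
        using q(1) by (intro always_eventually allI) (simp add: pos_divide_le_eq)
      show "(\<lambda>m. x - 1 / real (Suc m)) \<longlonglongrightarrow> x" by real_asymp
    qed simp
    have c: "continuous_on {0..} (\<lambda>t. norm (p t))" using p by (intro continuous_intros)
    have "(\<lambda>m. norm (p (s * (real (nat \<lfloor>x * real (Suc m)\<rfloor>) / real (Suc m))))) \<longlonglongrightarrow> norm (p (s * x))"
    proof (rule continuous_on_tendsto_compose[OF c])
      show "(\<lambda>m. s * (real (nat \<lfloor>x * real (Suc m)\<rfloor>) / real (Suc m))) \<longlonglongrightarrow> s * x"
        by (intro tendsto_intros lim)
      show "s * x \<in> {0..}" using x hit_time_bounds by simp
      show "eventually (\<lambda>m. s * (real (nat \<lfloor>x * real (Suc m)\<rfloor>) / real (Suc m)) \<in> {0..}) sequentially"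
        using assms by (intro always_eventually allI) (simp only: atLeast_iff, intro mult_nonneg_nonneg divide_nonneg_nonneg, auto)
    qed
    then have ev: "eventually (\<lambda>m. norm (p (s * (real (nat \<lfloor>x * real (Suc m)\<rfloor>) / real (Suc m)))) < r + 1 / real (Suc n)) sequentially" for n
      using le x by (intro order_tendstoD) (auto intro: le_less_trans)
    have "\<exists>j k::nat. j \<le> k \<and> 0 < k \<and> norm (p (s * (real j / real k))) < r + 1 / real (Suc n)" for n
    proof -
      obtain m where m: "norm (p (s * (real (nat \<lfloor>x * real (Suc m)\<rfloor>) / real (Suc m)))) < r + 1 / real (Suc n)"
        using ev[of n] by (auto simp: eventually_sequentially)
      have "real (nat \<lfloor>x * real (Suc m)\<rfloor>) \<le> 1 * real (Suc m)"
        using q(1)[of m] mult_right_mono[OF x(2), of "real (Suc m)"] by linarith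
      then have "nat \<lfloor>x * real (Suc m)\<rfloor> \<le> Suc m" by (simp only: mult_1 of_nat_le_iff)
      then show ?thesis using m by blast
    qed
    then show ?thesis by blast
  qed simp
next
  assume "K \<le> s \<or> (\<forall>n. \<exists>j k::nat. j \<le> k \<and> 0 < k \<and> norm (p (s * (real j / real k))) < r + 1 / real (Suc n))"
  then show "hit_time K r p \<le> s"
  proof
    assume "K \<le> s" then show ?thesis using hit_time_bounds by simp
  next
    assume *: "\<forall>n. \<exists>j k::nat. j \<le> k \<and> 0 < k \<and> norm (p (s * (real j / real k))) < r + 1 / real (Suc n)"
    \<comment> \<open>By compactness, near-hits for every \<open>n\<close> force an actual hit in
      [0, s].\<close>
    have "continuous_on {0..s} (\<lambda>t. norm (p t))" using p by (intro continuous_intros continuous_on_subset[OF p]) auto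
    then obtain t where t: "t \<in> {0..s}" "\<And>u. u \<in> {0..s} \<Longrightarrow> norm (p t) \<le> norm (p u)"
      using continuous_attains_inf[of "{0..s}" "\<lambda>t. norm (p t)"] assms by auto
    have "norm (p t) \<le> r + 1 / real (Suc n)" for n
    proof -
      obtain j k where jk: "j \<le> k" "0 < k" "norm (p (s * (real j / real k))) < r + 1 / real (Suc n)" using * by blast
      have "s * (real j / real k) \<le> s * 1" using assms jk by (intro mult_left_mono) (auto simp: divide_le_eq)
      then have "s * (real j / real k) \<in> {0..s}" using assms by simp
      then show ?thesis using t(2)[of "s * (real j / real k)"] jk by simp
    qed
    moreover have "(\<lambda>n. r + 1 / real (Suc n)) \<longlonglongrightarrow> r" by real_asymp
    ultimately have "norm (p t) \<le> r" by (intro LIMSEQ_le_const) auto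
    then show ?thesis using hit_time_le[of t] t by auto
  qed
qed

end

lemma hit_time_event:
  fixes \<rho> :: "real \<Rightarrow> 'w \<Rightarrow> 'a::euclidean_space"
  assumes cont: "\<And>\<omega>. \<omega> \<in> space F \<Longrightarrow> continuous_on {0..} (\<lambda>t. \<rho> t \<omega>)"
    and meas: "\<And>u. 0 \<le> u \<Longrightarrow> u \<le> s \<Longrightarrow> \<rho> u \<in> borel_measurable F" and s: "0 \<le> s" and K: "0 \<le> K"
  shows "{\<omega> \<in> space F. hit_time K r (\<lambda>t. \<rho> t \<omega>) \<le> s} \<in> sets F"
proof (cases "K \<le> s")
  case True
  have "{\<omega> \<in> space F. hit_time K r (\<lambda>t. \<rho> t \<omega>) \<le> s} = space F"
    using True by (auto simp: hit_time_le_iff[OF cont K s])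
  then show ?thesis by simp
next
  case False
  have [measurable]: "(\<lambda>\<omega>. \<rho> (s * (real j / real k)) \<omega>) \<in> borel_measurable F" if "j \<le> k \<and> 0 < k" for j k :: nat
  proof (rule meas)
    have "s * (real j / real k) \<le> s * 1" using that s by (intro mult_left_mono) (auto simp: divide_le_eq)
    then show "s * (real j / real k) \<le> s" by simp
  qed (use s in simp)
  have eq: "{\<omega> \<in> space F. hit_time K r (\<lambda>t. \<rho> t \<omega>) \<le> s} = 
    {\<omega> \<in> space F. \<forall>n. \<exists>j k::nat. (j \<le> k \<and> 0 < k) \<and> norm (\<rho> (s * (real j / real k)) \<omega>) < r + 1 / real (Suc n)}"
    using False by (auto simp: hit_time_le_iff[OF cont K s])
  have c: "{\<omega> \<in> space F. (j \<le> k \<and> 0 < k) \<and> norm (\<rho> (s * (real j / real k)) \<omega>) < r + 1 / real (Suc n)} \<in> sets F" for j k n :: nat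
  proof (cases "j \<le> k \<and> 0 < k")
    case True
    then have [measurable]: "(\<lambda>\<omega>. \<rho> (s * (real j / real k)) \<omega>) \<in> borel_measurable F" by fact
    have "{\<omega> \<in> space F. norm (\<rho> (s * (real j / real k)) \<omega>) < r + 1 / real (Suc n)} \<in> sets F" by measurable
    then show ?thesis by (simp only: True simp_thms)
  next
    case False
    then have e: "{\<omega> \<in> space F. (j \<le> k \<and> 0 < k) \<and> norm (\<rho> (s * (real j / real k)) \<omega>) < r + 1 / real (Suc n)} = {}" by blast
    show ?thesis unfolding e by simp
  qed
  show ?thesis unfolding eq
    by (rule sets.sets_Collect_countable_All, rule sets.sets_Collect_countable_Ex, rule sets.sets_Collect_countable_Ex, rule c)
qed

text \<open>The two times differ only if the paths meet after \<open>K\<close> or never. Then both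
  lie beyond \<open>t1\<close>, where \<open>g\<close> vanishes, in agreement with the value 0
  assigned to an infinite collision time.\<close>

lemma collision_value_eq_hit_time:
  fixes \<xi> \<eta> :: "real \<Rightarrow> real ^ 'd"
  assumes cont: "continuous_on {0..} \<xi>" "continuous_on {0..} \<eta>"
    and supp: "\<And>t z. 0 \<le> t \<Longrightarrow> t \<notin> {t0..t1} \<Longrightarrow> g (t, z) = 0" and K: "0 \<le> K" "t1 < K"
  shows "collision_value g u v r \<xi> \<eta> = 
    (let h = hit_time K r (\<lambda>t. \<xi> t - \<eta> t) in g (h, (u *\<^sub>R \<xi> h + v *\<^sub>R \<eta> h) /\<^sub>R (u + v)))"
proof -
  define S where "S = {t. 0 \<le> t \<and> norm (\<xi> t - \<eta> t) \<le> r}"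
  have bdd: "bdd_below S" by (auto simp: S_def intro!: bdd_belowI[of _ 0])
  have T: "collision_time r \<xi> \<eta> = (INF t\<in>S. ereal t)" by (simp add: collision_time_def S_def)
  have h: "hit_time K r (\<lambda>t. \<xi> t - \<eta> t) = Inf (insert K S)" by (simp add: hit_time_def S_def)
  show ?thesis
  proof (cases "S = {}")
    case True
    have "collision_time r \<xi> \<eta> = \<infinity>" unfolding T True by (simp add: top_ereal_def)
    moreover have "Inf (insert K S) = K" by (simp add: True)
    ultimately show ?thesis using K supp[of K] by (simp add: collision_value_def h)
  next
    case False
    have T': "collision_time r \<xi> \<eta> = ereal (Inf S)" unfolding T using ereal_Inf'[OF bdd False] by simp
    have h': "Inf (insert K S) = min K (Inf S)" using cInf_insert[OF False bdd, of K] by (simp add: inf_min)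
    have S0: "0 \<le> Inf S" using False by (intro cInf_greatest) (auto simp: S_def)
    show ?thesis
    proof (cases "Inf S \<le> K")
      case True
      then show ?thesis by (simp add: collision_value_def h h' T' min_absorb2 Let_def)
    next
      case F: False
      then show ?thesis using K S0 supp[of K] supp[of "Inf S"] by (simp add: collision_value_def h h' T' Let_def)
    qed
  qed
qed

section \<open>Kernel estimates for two particles\<close>

lemma integral_std_gauss_Pair:
  fixes f :: "'a::euclidean_space \<times> 'b::euclidean_space \<Rightarrow> real"
  assumes [measurable]: "f \<in> borel_measurable borel" and bdd: "\<And>z. \<bar>f z\<bar> \<le> C"
  shows "(LINT z|std_gauss. f z) = (LINT u|std_gauss. LINT v|std_gauss. f (u, v))" (is ?fst)
    and "(LINT z|std_gauss. f z) = (LINT v|std_gauss. LINT u|std_gauss. f (u, v))" (is ?snd)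
proof -
  interpret a: prob_space "std_gauss :: 'a measure" by (rule prob_space_std_gauss)
  interpret b: prob_space "std_gauss :: 'b measure" by (rule prob_space_std_gauss)
  interpret ab: pair_prob_space "std_gauss :: 'a measure" "std_gauss :: 'b measure" ..
  have m: "f \<in> borel_measurable (std_gauss \<Otimes>\<^sub>M std_gauss)"
    unfolding std_gauss_prod[symmetric] by measurable
  have i: "integrable (std_gauss \<Otimes>\<^sub>M std_gauss) f"
    by (intro ab.P.integrable_const_bound[where B=C] m) (use bdd in auto)
  show ?fst unfolding std_gauss_prod by (rule ab.integral_fst'[OF i, symmetric])
  show ?snd unfolding std_gauss_prod using ab.integral_snd[of "\<lambda>u v. f (u, v)"] i by simp
qed

lemma integrable_std_gauss_bounded:
  fixes f :: "'a::euclidean_space \<Rightarrow> real"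
  assumes "f \<in> borel_measurable borel" "\<And>z. \<bar>f z\<bar> \<le> C"
  shows "integrable std_gauss f"
proof -
  interpret prob_space "std_gauss :: 'a measure" by (rule prob_space_std_gauss)
  show ?thesis using assms by (intro integrable_bounded) auto
qed

text \<open>Integrating out the second displacement first leaves a kernel of height of order
  u^(-d/2), uniformly in \<open>\<delta>\<close>. The first displacement is long with probability of
  order exp(-\<kappa>^2 / (4 c1^2 u)), which outweighs that height as u tends to 0.\<close>

lemma gauss_tail_first:
  fixes v :: "'a::euclidean_space"
  assumes c: "c1 \<noteq> 0" "c2 \<noteq> 0" and \<kappa>: "\<kappa> > 0"
  shows "\<exists>C. \<forall>u>0. \<forall>\<delta>>0. \<forall>v::'a. 
    (LINT z1|std_gauss. indicator {z. norm (c1 *\<^sub>R sqrt u *\<^sub>R z) \<ge> \<kappa>} z1 * (LINT z2|std_gauss. gauss \<delta> (v + (c1 * sqrt u) *\<^sub>R z1 + (c2 * sqrt u) *\<^sub>R z2))) \<le> C"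
proof -
  interpret prob_space "std_gauss :: 'a measure" by (rule prob_space_std_gauss)
  obtain C where C: "C > 0" "\<And>s. s > 0 \<Longrightarrow> s powr (- (real DIM('a) / 2)) * exp (- (\<kappa>\<^sup>2 / (4 * c1\<^sup>2)) / s) \<le> C"
    using powr_exp_bounded[of "\<kappa>\<^sup>2 / (4 * c1\<^sup>2)" "real DIM('a) / 2"] c \<kappa> by auto
  have "(LINT z1|std_gauss. indicator {z. norm (c1 *\<^sub>R sqrt u *\<^sub>R z) \<ge> \<kappa>} z1 * (LINT z2|std_gauss. gauss \<delta> (v + (c1 * sqrt u) *\<^sub>R z1 + (c2 * sqrt u) *\<^sub>R z2)))
      \<le> (2 * pi * c2\<^sup>2) powr (- real DIM('a) / 2) * 2 powr (real DIM('a) / 2) * C" if u: "u > 0" and \<delta>: "\<delta> > 0" for u \<delta> and v :: 'a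
  proof -
    define S where "S = {z::'a. norm (c1 *\<^sub>R sqrt u *\<^sub>R z) \<ge> \<kappa>}"
    \<comment> \<open>Discarding \<open>\<delta>\<close> from the variance makes the height
      independent of it.\<close>
    define L where "L = (2 * pi * (c2\<^sup>2 * u)) powr (- real DIM('a) / 2)"
    have S: "S = {z. norm z \<ge> \<kappa> / (\<bar>c1\<bar> * sqrt u)}"
      unfolding S_def using c u by (auto simp: pos_divide_le_eq abs_mult mult_ac)
    have [measurable]: "S \<in> sets borel" unfolding S by measurable
    have "(LINT z1|std_gauss. indicator S z1 * (LINT z2|std_gauss. gauss \<delta> (v + (c1 * sqrt u) *\<^sub>R z1 + (c2 * sqrt u) *\<^sub>R z2)))
      = (LINT z1|std_gauss. indicator S z1 * gauss (\<delta> + (c2 * sqrt u)\<^sup>2) (v + (c1 * sqrt u) *\<^sub>R z1))"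
      using \<delta> by (simp add: gauss_convolution)
    also have "\<dots> \<le> (LINT z1|std_gauss. indicator S z1 * L)"
    proof (rule integral_mono)
      show "integrable std_gauss (\<lambda>z1. indicator S z1 * gauss (\<delta> + (c2 * sqrt u)\<^sup>2) (v + (c1 * sqrt u) *\<^sub>R z1))"
        using gauss_le[of "\<delta> + (c2 * sqrt u)\<^sup>2", where 'a='a] \<delta>
        by (intro integrable_std_gauss_bounded[where C="(2 * pi * (\<delta> + (c2 * sqrt u)\<^sup>2)) powr (- real DIM('a) / 2)"])
           (auto simp: indicator_def add_pos_nonneg)
      show "integrable std_gauss (\<lambda>z1. indicator S z1 * L)"
        by (intro integrable_std_gauss_bounded[where C=L]) (auto simp: indicator_def L_def)
      fix z1 :: 'a
      have "gauss (\<delta> + (c2 * sqrt u)\<^sup>2) (v + (c1 * sqrt u) *\<^sub>R z1) \<le> L"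
        unfolding L_def using u \<delta> c by (intro gauss_le_mono) (auto simp: power_mult_distrib)
      then show "indicator S z1 * gauss (\<delta> + (c2 * sqrt u)\<^sup>2) (v + (c1 * sqrt u) *\<^sub>R z1) \<le> indicator S z1 * L"
        by (auto simp: indicator_def)
    qed
    also have "\<dots> = measure std_gauss S * L" by simp
    also have "\<dots> \<le> (2 powr (real DIM('a) / 2) * exp (- (\<kappa> / (\<bar>c1\<bar> * sqrt u))\<^sup>2 / 4)) * L"
      unfolding S using \<kappa> u by (intro mult_right_mono std_gauss_tail) (auto simp: L_def)
    also have "(\<kappa> / (\<bar>c1\<bar> * sqrt u))\<^sup>2 / 4 = (\<kappa>\<^sup>2 / (4 * c1\<^sup>2)) / u"
      using u by (simp add: power_divide power_mult_distrib)
    then have "- (\<kappa> / (\<bar>c1\<bar> * sqrt u))\<^sup>2 / 4 = - (\<kappa>\<^sup>2 / (4 * c1\<^sup>2)) / u" by simp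
    also have "L = (2 * pi * c2\<^sup>2) powr (- real DIM('a) / 2) * u powr (- (real DIM('a) / 2))"
      unfolding L_def using u powr_mult[of "2 * pi * c2\<^sup>2" u "- (real DIM('a) / 2)"] by (simp add: mult.assoc)
    also have "2 powr (real DIM('a) / 2) * exp (- (\<kappa>\<^sup>2 / (4 * c1\<^sup>2)) / u) * ((2 * pi * c2\<^sup>2) powr (- real DIM('a) / 2) * u powr (- (real DIM('a) / 2)))
       = (2 * pi * c2\<^sup>2) powr (- real DIM('a) / 2) * 2 powr (real DIM('a) / 2) * (u powr (- (real DIM('a) / 2)) * exp (- (\<kappa>\<^sup>2 / (4 * c1\<^sup>2)) / u))"
      by (simp only: mult_ac)
    also have "\<dots> \<le> (2 * pi * c2\<^sup>2) powr (- real DIM('a) / 2) * 2 powr (real DIM('a) / 2) * C"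
      using C(2)[OF u] by (intro mult_left_mono) auto
    finally show ?thesis unfolding S_def .
  qed
  then show ?thesis by blast
qed

section \<open>Separation, centre and heat flow of two Brownian particles\<close>

locale pair_geometry =
  fixes x1 x2 :: "'a::euclidean_space" and s1 s2 y1 y2 :: real
  assumes s_pos: "s1 > 0" "s2 > 0" and y_pos: "y1 > 0" "y2 > 0"
begin

text \<open>\<open>s1\<close> and \<open>s2\<close> are the square roots of the diffusivities, later
  b / \<tau>, and \<open>w\<close> is the value of the driving pair:
  \<open>x1 + s1 *\<^sub>R fst w\<close> is the Brownian proxy for the first position.\<close>

definition separation :: "'a \<times> 'a \<Rightarrow> 'a" where
  "separation w = x1 - x2 + s1 *\<^sub>R fst w - s2 *\<^sub>R snd w"

definition center :: "'a \<times> 'a \<Rightarrow> 'a" where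
  "center w = (y1 *\<^sub>R (x1 + s1 *\<^sub>R fst w) + y2 *\<^sub>R (x2 + s2 *\<^sub>R snd w)) /\<^sub>R (y1 + y2)"

definition diffusivity :: real where "diffusivity = s1\<^sup>2 + s2\<^sup>2"

lemma diffusivity_pos: "diffusivity > 0"
  using s_pos by (simp add: diffusivity_def add_pos_pos)

lemma separation_continuous [continuous_intros]: "continuous_on S f \<Longrightarrow> continuous_on S (\<lambda>t. separation (f t))"
  unfolding separation_def by (intro continuous_intros)

lemma center_continuous [continuous_intros]: "continuous_on S f \<Longrightarrow> continuous_on S (\<lambda>t. center (f t))"
  unfolding center_def by (intro continuous_intros)

lemma separation_measurable [measurable]: "separation \<in> borel_measurable borel"
  by (rule borel_measurable_continuous_onI) (rule separation_continuous, rule continuous_on_id)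

lemma center_measurable [measurable]: "center \<in> borel_measurable borel"
  by (rule borel_measurable_continuous_onI) (rule center_continuous, rule continuous_on_id)

lemma separation_add: "separation (w + c *\<^sub>R z) = separation w + (s1 * c) *\<^sub>R fst z + (- s2 * c) *\<^sub>R snd z"
  by (simp add: separation_def algebra_simps)

lemma center_dist: "norm (center (w + v) - center w) \<le> norm (s1 *\<^sub>R fst v) + norm (s2 *\<^sub>R snd v)"
proof -
  have "center (w + v) - center w = (y1 / (y1 + y2)) *\<^sub>R (s1 *\<^sub>R fst v) + (y2 / (y1 + y2)) *\<^sub>R (s2 *\<^sub>R snd v)"
    using y_pos by (simp add: center_def algebra_simps divide_inverse)
  also have "norm \<dots> \<le> (y1 / (y1 + y2)) * norm (s1 *\<^sub>R fst v) + (y2 / (y1 + y2)) * norm (s2 *\<^sub>R snd v)"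
  proof -
    have "norm ((y1 / (y1 + y2)) *\<^sub>R (s1 *\<^sub>R fst v)) = (y1 / (y1 + y2)) * norm (s1 *\<^sub>R fst v)"
      using y_pos by (subst norm_scaleR) simp
    moreover have "norm ((y2 / (y1 + y2)) *\<^sub>R (s2 *\<^sub>R snd v)) = (y2 / (y1 + y2)) * norm (s2 *\<^sub>R snd v)"
      using y_pos by (subst norm_scaleR) simp
    ultimately show ?thesis by (metis norm_triangle_ineq)
  qed
  also have "\<dots> \<le> 1 * norm (s1 *\<^sub>R fst v) + 1 * norm (s2 *\<^sub>R snd v)"
    using y_pos by (intro add_mono mult_right_mono) auto
  finally show ?thesis by simp
qed

text \<open>The separation is affine in the normal vector, with variance
  \<open>diffusivity * u\<close> per coordinate, so the semigroup property merely adds this to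
  \<open>\<delta>\<close>.\<close>

lemma heat_separation:
  assumes "\<delta> > 0" "u \<ge> 0"
  shows "(LINT z|std_gauss. gauss \<delta> (separation (w + sqrt u *\<^sub>R z))) = gauss (\<delta> + diffusivity * u) (separation w)"
proof -
  have "(LINT z|std_gauss. gauss \<delta> (separation (w + sqrt u *\<^sub>R z)))
     = (LINT z1|std_gauss. LINT z2|std_gauss. gauss \<delta> (separation (w + sqrt u *\<^sub>R (z1, z2))))"
    using gauss_le[of \<delta>, where 'a='a] assms by (intro integral_std_gauss_Pair(1)) auto
  also have "\<dots> = (LINT z1|std_gauss. LINT z2|std_gauss. gauss \<delta> (separation w + (s1 * sqrt u) *\<^sub>R z1 + (- s2 * sqrt u) *\<^sub>R z2))"
    unfolding separation_add by simp
  also have "\<dots> = gauss (\<delta> + (- s2 * sqrt u)\<^sup>2 + (s1 * sqrt u)\<^sup>2) (separation w)"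
    using assms by (intro gauss_convolution2)
  also have "\<delta> + (- s2 * sqrt u)\<^sup>2 + (s1 * sqrt u)\<^sup>2 = \<delta> + diffusivity * u"
    using assms by (simp add: diffusivity_def power_mult_distrib algebra_simps)
  finally show ?thesis .
qed

text \<open>Freezing \<open>g\<close> at its value in the starting point costs \<open>\<eta>\<close> times the heat kernel, and a bounded
  amount that comes from late times and from long excursions.\<close>

lemma heat_freeze:
  assumes \<kappa>: "\<kappa> > 0"
  shows "\<exists>C\<ge>0. \<forall>g :: real \<times> 'a \<Rightarrow> real. \<forall>\<eta> \<delta> u s w. continuous_on UNIV g \<longrightarrow> (\<forall>p. \<bar>g p\<bar> \<le> G) \<longrightarrow> 
    (\<forall>t t' z z'. \<bar>t - t'\<bar> \<le> \<kappa> \<longrightarrow> norm (z - z') \<le> \<kappa> \<longrightarrow> \<bar>g (t, z) - g (t', z')\<bar> \<le> \<eta>) \<longrightarrow> \<delta> > 0 \<longrightarrow> u \<ge> 0 \<longrightarrow>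
    \<bar>(LINT z|std_gauss. g (s + u, center (w + sqrt u *\<^sub>R z)) * gauss \<delta> (separation (w + sqrt u *\<^sub>R z))) 
      - g (s, center w) * gauss (\<delta> + diffusivity * u) (separation w)\<bar>
     \<le> \<eta> * gauss (\<delta> + diffusivity * u) (separation w) + C"
proof -
  obtain C1 where C1: "\<And>u \<delta> v. u > 0 \<Longrightarrow> \<delta> > 0 \<Longrightarrow> 
    (LINT z1|std_gauss. indicator {z. norm (s1 *\<^sub>R sqrt u *\<^sub>R z) \<ge> \<kappa> / 2} z1 * (LINT z2|std_gauss. gauss \<delta> (v + (s1 * sqrt u) *\<^sub>R z1 + (- s2 * sqrt u) *\<^sub>R (z2::'a)))) \<le> C1"
    using gauss_tail_first[of s1 "- s2" "\<kappa> / 2", where 'a='a] s_pos \<kappa> by auto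
  obtain C2 where C2: "\<And>u \<delta> v. u > 0 \<Longrightarrow> \<delta> > 0 \<Longrightarrow> 
    (LINT z1|std_gauss. indicator {z. norm ((- s2) *\<^sub>R sqrt u *\<^sub>R z) \<ge> \<kappa> / 2} z1 * (LINT z2|std_gauss. gauss \<delta> (v + (- s2 * sqrt u) *\<^sub>R z1 + (s1 * sqrt u) *\<^sub>R (z2::'a)))) \<le> C2"
    using gauss_tail_first[of "- s2" s1 "\<kappa> / 2", where 'a='a] s_pos \<kappa> by auto
  \<comment> \<open>The height of the kernel at every time later than \<kappa>, where freezing the
    time argument of \<open>g\<close> is not justified.\<close>
  define C3 where "C3 = (2 * pi * (diffusivity * \<kappa>)) powr (- real DIM('a) / 2)"
  define C where "C = 2 * \<bar>G\<bar> * (C3 + \<bar>C1\<bar> + \<bar>C2\<bar>)"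
  show ?thesis
  proof (rule exI[of _ C], intro conjI allI impI)
    show "C \<ge> 0" by (auto simp: C_def C3_def)
    fix g :: "real \<times> 'a \<Rightarrow> real" and \<eta> \<delta> u s :: real and w :: "'a \<times> 'a"
    assume g: "continuous_on UNIV g" and G: "\<forall>p. \<bar>g p\<bar> \<le> G" and
      mod: "\<forall>t t' z z'. \<bar>t - t'\<bar> \<le> \<kappa> \<longrightarrow> norm (z - z') \<le> \<kappa> \<longrightarrow> \<bar>g (t, z) - g (t', z')\<bar> \<le> \<eta>" 
      and \<delta>: "\<delta> > 0" and u: "u \<ge> 0"
    have [measurable]: "g \<in> borel_measurable borel" using g by (rule borel_measurable_continuous_onI)
    have G0: "0 \<le> G" using G[rule_format, of undefined] by linarith
    have \<eta>0: "0 \<le> \<eta>" using mod[rule_format, of 0 0 0 0] \<kappa> by simp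
    have gp: "gauss \<delta> (separation v) \<le> (2 * pi * \<delta>) powr (- real DIM('a) / 2)" for v by (rule gauss_le[OF \<delta>])
    let ?k = "\<lambda>z. gauss \<delta> (separation (w + sqrt u *\<^sub>R z))"
    let ?L = "(2 * pi * \<delta>) powr (- real DIM('a) / 2)"
    \<comment> \<open>Off \<open>S1\<close> and \<open>S2\<close> each particle moves less than
      \<kappa> / 2, so the weighted centre moves less than \<kappa>.\<close>
    define S1 where "S1 = {z :: 'a \<times> 'a. norm (s1 *\<^sub>R sqrt u *\<^sub>R fst z) \<ge> \<kappa> / 2}"
    define S2 where "S2 = {z :: 'a \<times> 'a. norm ((- s2) *\<^sub>R sqrt u *\<^sub>R snd z) \<ge> \<kappa> / 2}"
    have cl: "closed S1" "closed S2" unfolding S1_def S2_def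
      by (intro closed_Collect_le continuous_intros)+
    then have [measurable]: "S1 \<in> sets borel" "S2 \<in> sets borel" by auto
    have gm[measurable]: "(\<lambda>z. g (s + u, center (w + sqrt u *\<^sub>R z))) \<in> borel_measurable borel"
      by (intro borel_measurable_continuous_onI continuous_on_compose2[OF g] continuous_intros) auto
    have [measurable]: "?k \<in> borel_measurable borel" by measurable
    have ik: "integrable std_gauss ?k"
      using gp by (intro integrable_std_gauss_bounded[where C="?L"]) auto
    have igk: "integrable std_gauss (\<lambda>z. g (s + u, center (w + sqrt u *\<^sub>R z)) * ?k z)"
    proof (rule integrable_std_gauss_bounded)
      show "\<bar>g (s + u, center (w + sqrt u *\<^sub>R z)) * ?k z\<bar> \<le> G * ?L" for z
        unfolding abs_mult using gp[of "w + sqrt u *\<^sub>R z"] by (intro mult_mono G[rule_format] G0) simp_all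
    qed measurable
    have iS0: "integrable std_gauss (\<lambda>z. indicator S z * ?k z)" if [measurable]: "S \<in> sets borel" for S
    proof (rule integrable_std_gauss_bounded)
      show "\<bar>indicator S z * ?k z\<bar> \<le> ?L" for z
        using gp[of "w + sqrt u *\<^sub>R z"] by (simp add: indicator_def)
    qed measurable
    have iS: "integrable std_gauss (\<lambda>z. indicator S1 z * ?k z)" "integrable std_gauss (\<lambda>z. indicator S2 z * ?k z)"
      by (rule iS0, simp)+
    have eq: "(LINT z|std_gauss. ?k z) = gauss (\<delta> + diffusivity * u) (separation w)"
      by (rule heat_separation[OF \<delta> u])
    have late: "indicator {\<kappa><..} u * gauss (\<delta> + diffusivity * u) (separation w) \<le> C3"
    proof (cases "u > \<kappa>")
      case True
      have "diffusivity * \<kappa> \<le> \<delta> + diffusivity * u"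
        using \<delta> diffusivity_pos True by (intro order_trans[OF mult_left_mono[of \<kappa> u]]) auto
      then have "gauss (\<delta> + diffusivity * u) (separation w) \<le> C3"
        unfolding C3_def using \<kappa> diffusivity_pos by (intro gauss_le_mono) auto
      then show ?thesis using True by simp
    qed (simp add: C3_def)
    \<comment> \<open>At \<open>u\<close> = 0 nothing moves and the set is empty. Otherwise the
      inner integral runs over the other particle, which is what smooths the kernel.\<close>
    have e1: "(LINT z|std_gauss. indicator S1 z * ?k z) \<le> \<bar>C1\<bar>"
    proof (cases "u = 0")
      case True
      then have "S1 = {}" using \<kappa> by (simp add: S1_def)
      then show ?thesis by simp
    next
      case False
      have "(LINT z|std_gauss. indicator S1 z * ?k z) = (LINT z1|std_gauss. LINT z2|std_gauss. indicator S1 (z1, z2) * ?k (z1, z2))"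
        using gp by (intro integral_std_gauss_Pair(1)[where C="?L"]) (auto simp: indicator_def)
      also have "\<dots> = (LINT z1|std_gauss. indicator {z. norm (s1 *\<^sub>R sqrt u *\<^sub>R z) \<ge> \<kappa> / 2} z1 * (LINT z2|std_gauss. gauss \<delta> (separation w + (s1 * sqrt u) *\<^sub>R z1 + (- s2 * sqrt u) *\<^sub>R (z2::'a))))"
        unfolding separation_add by (intro Bochner_Integration.integral_cong) (auto simp: S1_def indicator_def)
      also have "\<dots> \<le> C1" using False u \<delta> by (intro C1) auto
      finally show ?thesis by simp
    qed
    have e2: "(LINT z|std_gauss. indicator S2 z * ?k z) \<le> \<bar>C2\<bar>"
    proof (cases "u = 0")
      case True
      then have "S2 = {}" using \<kappa> by (simp add: S2_def)
      then show ?thesis by simp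
    next
      case False
      \<comment> \<open>Here the order of integration is reversed, so that the particle with the
        long excursion is again the outer variable.\<close>
      have "(LINT z|std_gauss. indicator S2 z * ?k z) = (LINT z2|std_gauss. LINT z1|std_gauss. indicator S2 (z1, z2) * ?k (z1, z2))"
        using gp by (intro integral_std_gauss_Pair(2)[where C="?L"]) (auto simp: indicator_def)
      also have "\<dots> = (LINT z2|std_gauss. indicator {z. norm ((- s2) *\<^sub>R sqrt u *\<^sub>R z) \<ge> \<kappa> / 2} z2 * (LINT z1|std_gauss. gauss \<delta> (separation w + (- s2 * sqrt u) *\<^sub>R z2 + (s1 * sqrt u) *\<^sub>R (z1::'a))))"
        unfolding separation_add by (intro Bochner_Integration.integral_cong) (auto simp: S2_def indicator_def algebra_simps)
      also have "\<dots> \<le> C2" using False u \<delta> by (intro C2) auto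
      finally show ?thesis by simp
    qed
    \<comment> \<open>The change of \<open>g\<close> is at most \<eta> off the late times and long
      excursions, and at most 2 \<open>G\<close> on them; the exceptional indicators may overlap, so
      they are simply added.\<close>
    have pw: "\<bar>g (s + u, center (w + sqrt u *\<^sub>R z)) * ?k z - g (s, center w) * ?k z\<bar>
      \<le> \<eta> * ?k z + 2 * G * (indicator {\<kappa><..} u * ?k z) + 2 * G * (indicator S1 z * ?k z) + 2 * G * (indicator S2 z * ?k z)" for z
    proof -
      have "\<bar>g (s + u, center (w + sqrt u *\<^sub>R z)) - g (s, center w)\<bar> \<le> \<eta> + 2 * G * indicator {\<kappa><..} u + 2 * G * indicator S1 z + 2 * G * indicator S2 z"
      proof (cases "u > \<kappa> \<or> z \<in> S1 \<or> z \<in> S2")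
        case True
        have "\<bar>g (s + u, center (w + sqrt u *\<^sub>R z)) - g (s, center w)\<bar> \<le> 2 * G"
          using G[rule_format, of "(s + u, center (w + sqrt u *\<^sub>R z))"] G[rule_format, of "(s, center w)"] by linarith
        also have "2 * G \<le> \<eta> + 2 * G * indicator {\<kappa><..} u + 2 * G * indicator S1 z + 2 * G * indicator S2 z"
          using True G0 \<eta>0 by (auto simp: indicator_def)
        finally show ?thesis .
      next
        case False
        have "norm (center (w + sqrt u *\<^sub>R z) - center w) \<le> \<kappa> / 2 + \<kappa> / 2"
          using False by (intro order_trans[OF center_dist] add_mono) (auto simp: S1_def S2_def)
        then have "\<bar>g (s + u, center (w + sqrt u *\<^sub>R z)) - g (s, center w)\<bar> \<le> \<eta>"
          using False u by (intro mod[rule_format]) auto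
        then show ?thesis using False by auto
      qed
      then have "\<bar>g (s + u, center (w + sqrt u *\<^sub>R z)) - g (s, center w)\<bar> * ?k z \<le> (\<eta> + 2 * G * indicator {\<kappa><..} u + 2 * G * indicator S1 z + 2 * G * indicator S2 z) * ?k z"
        by (rule mult_right_mono) simp
      moreover have "\<bar>g (s + u, center (w + sqrt u *\<^sub>R z)) * ?k z - g (s, center w) * ?k z\<bar> = \<bar>g (s + u, center (w + sqrt u *\<^sub>R z)) - g (s, center w)\<bar> * ?k z"
        by (simp add: left_diff_distrib[symmetric] abs_mult)
      ultimately show ?thesis by (simp add: algebra_simps)
    qed
    have eqd: "(LINT z|std_gauss. g (s + u, center (w + sqrt u *\<^sub>R z)) * ?k z) - g (s, center w) * gauss (\<delta> + diffusivity * u) (separation w)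
      = (LINT z|std_gauss. g (s + u, center (w + sqrt u *\<^sub>R z)) * ?k z - g (s, center w) * ?k z)"
      unfolding eq[symmetric] using igk ik by simp
    have "\<bar>(LINT z|std_gauss. g (s + u, center (w + sqrt u *\<^sub>R z)) * ?k z) - g (s, center w) * gauss (\<delta> + diffusivity * u) (separation w)\<bar>
      \<le> (LINT z|std_gauss. \<bar>g (s + u, center (w + sqrt u *\<^sub>R z)) * ?k z - g (s, center w) * ?k z\<bar>)"
      unfolding eqd by (rule integral_abs_bound)
    also have "\<dots> \<le> (LINT z|std_gauss. \<eta> * ?k z + 2 * G * (indicator {\<kappa><..} u * ?k z) + 2 * G * (indicator S1 z * ?k z) + 2 * G * (indicator S2 z * ?k z))"
    proof (rule integral_mono)
      show "integrable std_gauss (\<lambda>z. \<bar>g (s + u, center (w + sqrt u *\<^sub>R z)) * ?k z - g (s, center w) * ?k z\<bar>)"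
        using igk ik by simp
      show "integrable std_gauss (\<lambda>z. \<eta> * ?k z + 2 * G * (indicator {\<kappa><..} u * ?k z) + 2 * G * (indicator S1 z * ?k z) + 2 * G * (indicator S2 z * ?k z))"
        using ik iS by simp
    qed (rule pw)
    also have "\<dots> = \<eta> * gauss (\<delta> + diffusivity * u) (separation w) + 2 * G * (indicator {\<kappa><..} u * gauss (\<delta> + diffusivity * u) (separation w)) 
      + 2 * G * (LINT z|std_gauss. indicator S1 z * ?k z) + 2 * G * (LINT z|std_gauss. indicator S2 z * ?k z)"
      using ik iS by (simp add: eq)
    also have "\<dots> \<le> \<eta> * gauss (\<delta> + diffusivity * u) (separation w) + 2 * G * C3 + 2 * G * \<bar>C1\<bar> + 2 * G * \<bar>C2\<bar>"
      using G0 \<eta>0 late e1 e2 by (intro add_mono mult_left_mono) auto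
    also have "\<dots> = \<eta> * gauss (\<delta> + diffusivity * u) (separation w) + C"
      using G0 by (simp add: C_def algebra_simps)
    finally show "\<bar>(LINT z|std_gauss. g (s + u, center (w + sqrt u *\<^sub>R z)) * ?k z) - g (s, center w) * gauss (\<delta> + diffusivity * u) (separation w)\<bar>
      \<le> \<eta> * gauss (\<delta> + diffusivity * u) (separation w) + C" .
  qed
qed

text \<open>The expected occupation of the smoothed origin during [s, K] by a separation that is at
  \<open>y\<close> at time \<open>s\<close>. For infinite \<open>K\<close> and vanishing
  \<open>\<delta>\<close> it would be the Green function |y|^(2-d) / (a c_d), with a the
  diffusivity.\<close>

definition kernel_time :: "real \<Rightarrow> real \<Rightarrow> real \<Rightarrow> 'a \<Rightarrow> real" where
  "kernel_time K \<delta> s y = (LINT t:{s..K}|lborel. gauss (\<delta> + diffusivity * (t - s)) y)"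

text \<open>By \<open>integral_gauss_time\<close> the value is |y|^(2-d) / a times the mass of
  \<open>theta\<close> between a lower limit of order at most \<epsilon>^2 and an upper limit of
  order at least 1 / r^2. So \<epsilon> comes first, fixing the lower limit and the ratio of |y| to
  r, and \<open>r0\<close> then pushes the upper limit out.\<close>

lemma kernel_time_estimate:
  assumes d: "DIM('a) \<ge> 3" and K: "t1 < K" and \<eta>: "\<eta> > 0"
  shows "\<exists>\<epsilon>0>0. \<epsilon>0 \<le> 1/2 \<and> (\<forall>\<epsilon>. 0 < \<epsilon> \<longrightarrow> \<epsilon> \<le> \<epsilon>0 \<longrightarrow> (\<exists>r0>0. \<forall>r y s. 0 < r \<longrightarrow> r \<le> r0 \<longrightarrow> (1 - \<epsilon>) * r \<le> norm (y::'a) \<longrightarrow> norm y \<le> (1 + \<epsilon>) * r \<longrightarrow> s \<le> t1 \<longrightarrow>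
    \<bar>diffusivity * collision_const DIM('a) * kernel_time K ((\<epsilon> * r)\<^sup>2) s y - r powr (2 - real DIM('a))\<bar> \<le> \<eta> * r powr (2 - real DIM('a))))"
proof -
  define c where "c = collision_const DIM('a)"
  define D where "D = real DIM('a)"
  define a where "a = diffusivity"
  have c: "c > 0" unfolding c_def by (rule collision_const_pos[OF d])
  have a: "a > 0" unfolding a_def by (rule diffusivity_pos)
  have D: "2 - D < 0" using d by (simp add: D_def)
  have \<Theta>: "(LINT v|lborel. theta DIM('a) v) = 1 / c"
    using theta_integral_pos[OF d] by (simp add: c_def collision_const_eq)
  obtain \<alpha>0 \<beta>0 where ab: "\<alpha>0 > 0" "\<beta>0 > 0" and th: "\<And>\<alpha> \<beta>. \<alpha> \<le> \<alpha>0 \<Longrightarrow> \<beta> \<ge> \<beta>0 \<Longrightarrow> 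
     (LINT v:{\<alpha>..\<beta>}|lborel. theta DIM('a) v) \<le> 1 / c \<and> (LINT v:{\<alpha>..\<beta>}|lborel. theta DIM('a) v) \<ge> 1 / c - \<eta> / (4 * c)"
    using theta_integral_approx[OF d, of "\<eta> / (4 * c)"] \<eta> c unfolding \<Theta> by auto
  \<comment> \<open>For the lower bound, \<eta> / 2 is reserved for replacing |y| by r and \<eta> /
    4 for truncating \<open>theta\<close>. The upper bound suffers only from the first, since
    truncation decreases the mass.\<close>
  have "((\<lambda>\<epsilon>. (1 - \<epsilon>) powr (2 - D)) \<longlongrightarrow> (1 - 0) powr (2 - D)) (at_right 0)"
    by (intro tendsto_intros) auto
  then have ev1: "eventually (\<lambda>\<epsilon>. (1 - \<epsilon>) powr (2 - D) < 1 + \<eta>) (at_right 0)"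
    using \<eta> by (intro order_tendstoD(2)) auto
  have "((\<lambda>\<epsilon>. (1 + \<epsilon>) powr (2 - D)) \<longlongrightarrow> (1 + 0) powr (2 - D)) (at_right 0)"
    by (intro tendsto_intros) auto
  then have ev2: "eventually (\<lambda>\<epsilon>. (1 + \<epsilon>) powr (2 - D) > 1 - \<eta> / 2) (at_right 0)"
    using \<eta> by (intro order_tendstoD(1)) auto
  obtain e1 where e1: "e1 > 0" "\<And>\<epsilon>. 0 < \<epsilon> \<Longrightarrow> \<epsilon> < e1 \<Longrightarrow> (1 - \<epsilon>) powr (2 - D) < 1 + \<eta> \<and> (1 + \<epsilon>) powr (2 - D) > 1 - \<eta> / 2"
    using eventually_conj[OF ev1 ev2] by (auto simp: eventually_at_right[of 0 1])
  \<comment> \<open>1/2 gives |y| \<ge> r / 2, \<open>e1 / 2\<close> stays strictly within the range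
    of the two power estimates, and \<open>sqrt \<alpha>0 / 2\<close> brings the lower limit of
    integration below \<open>\<alpha>0\<close>.\<close>
  define \<epsilon>0 where "\<epsilon>0 = min (1/2) (min (e1 / 2) (sqrt \<alpha>0 / 2))"
  show ?thesis
  proof (rule exI[of _ \<epsilon>0], intro conjI allI impI)
    show "\<epsilon>0 > 0" "\<epsilon>0 \<le> 1/2" using e1 ab by (auto simp: \<epsilon>0_def)
    fix \<epsilon> assume \<epsilon>: "0 < \<epsilon>" "\<epsilon> \<le> \<epsilon>0"
    then have \<epsilon>': "\<epsilon> \<le> 1/2" "\<epsilon> < e1" "\<epsilon> \<le> sqrt \<alpha>0 / 2" using e1 by (auto simp: \<epsilon>0_def)
    \<comment> \<open>Solves a (K - t1) = 4 \<beta>0 r0^2. Together with |y| \<le> 2 r and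
      \<open>s\<close> \<le> \<open>t1\<close> < \<open>K\<close> this puts the upper limit above
      \<open>\<beta>0\<close>.\<close>
    define r0 where "r0 = sqrt (a * (K - t1) / (4 * \<beta>0))"
    show "\<exists>r0>0. \<forall>r y s. 0 < r \<longrightarrow> r \<le> r0 \<longrightarrow> (1 - \<epsilon>) * r \<le> norm (y::'a) \<longrightarrow> norm y \<le> (1 + \<epsilon>) * r \<longrightarrow> s \<le> t1 \<longrightarrow>
      \<bar>diffusivity * collision_const DIM('a) * kernel_time K ((\<epsilon> * r)\<^sup>2) s y - r powr (2 - real DIM('a))\<bar> \<le> \<eta> * r powr (2 - real DIM('a))"
    proof (rule exI[of _ r0], intro conjI allI impI)
      show "r0 > 0" using a K ab by (simp add: r0_def)
      fix r s :: real and y :: 'a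
      assume r: "0 < r" "r \<le> r0" and y: "(1 - \<epsilon>) * r \<le> norm y" "norm y \<le> (1 + \<epsilon>) * r" and s: "s \<le> t1"
      have ny: "norm y > 0" using y(1) r \<epsilon>' by (intro less_le_trans[OF _ y(1)]) auto
      define I where "I = (LINT v:{(\<epsilon> * r)\<^sup>2 / (norm y)\<^sup>2..((\<epsilon> * r)\<^sup>2 + a * (K - s)) / (norm y)\<^sup>2}|lborel. theta DIM('a) v)"
      have Q: "a * c * kernel_time K ((\<epsilon> * r)\<^sup>2) s y = norm y powr (2 - D) * (c * I)"
        unfolding kernel_time_def I_def D_def a_def[symmetric]
        using ny a \<epsilon> r by (subst integral_gauss_time) auto
      have "1/2 * r \<le> (1 - \<epsilon>) * r" using \<epsilon>' r by (intro mult_right_mono) auto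
      then have "r / 2 \<le> norm y" using y(1) by linarith
      then have n1: "(r / 2)\<^sup>2 \<le> (norm y)\<^sup>2" using r by (intro power_mono) auto
      have "(1 + \<epsilon>) * r \<le> 2 * r" using \<epsilon>' r by (intro mult_right_mono) auto
      then have "norm y \<le> 2 * r" using y(2) by linarith
      then have n2: "(norm y)\<^sup>2 \<le> (2 * r)\<^sup>2" by (intro power_mono) auto
      have \<alpha>: "(\<epsilon> * r)\<^sup>2 / (norm y)\<^sup>2 \<le> \<alpha>0"
      proof -
        have "(\<epsilon> * r)\<^sup>2 \<le> (sqrt \<alpha>0 / 2 * r)\<^sup>2" using \<epsilon>' \<epsilon> r by (intro power_mono mult_right_mono) auto
        also have "\<dots> = \<alpha>0 * (r / 2)\<^sup>2" using ab by (simp add: power_mult_distrib power_divide)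
        also have "\<dots> \<le> \<alpha>0 * (norm y)\<^sup>2" using n1 ab by simp
        finally show ?thesis using ny by (simp add: divide_le_eq)
      qed
      have \<beta>: "((\<epsilon> * r)\<^sup>2 + a * (K - s)) / (norm y)\<^sup>2 \<ge> \<beta>0"
      proof -
        have "\<beta>0 * (norm y)\<^sup>2 \<le> \<beta>0 * (2 * r)\<^sup>2" using n2 ab by simp
        also have "\<dots> = 4 * \<beta>0 * r\<^sup>2" by (simp add: power_mult_distrib)
        also have "\<dots> \<le> 4 * \<beta>0 * r0\<^sup>2" using r ab by (intro mult_left_mono power_mono) auto
        also have "\<dots> = a * (K - t1)" using a K ab by (simp add: r0_def)
        also have "\<dots> \<le> (\<epsilon> * r)\<^sup>2 + a * (K - s)" using a s by (intro add_increasing mult_left_mono) auto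
        finally show ?thesis using ny by (simp add: le_divide_eq)
      qed
      have I: "c * I \<le> 1" "c * I \<ge> 1 - \<eta> / 4"
        using th[OF \<alpha> \<beta>] c unfolding I_def[symmetric] by (auto simp: field_simps)
      have pr: "r powr (2 - D) > 0" using r by simp
      have up: "norm y powr (2 - D) \<le> r powr (2 - D) * (1 + \<eta>)"
      proof -
        have "norm y powr (2 - D) \<le> ((1 - \<epsilon>) * r) powr (2 - D)"
          using y r \<epsilon>' D by (intro powr_mono2') auto
        also have "\<dots> = (1 - \<epsilon>) powr (2 - D) * r powr (2 - D)" using r \<epsilon>' by (simp add: powr_mult)
        also have "\<dots> \<le> (1 + \<eta>) * r powr (2 - D)" using e1(2)[OF \<epsilon>(1) \<epsilon>'(2)] by (intro mult_right_mono) auto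
        finally show ?thesis by (simp add: mult.commute)
      qed
      have lo: "norm y powr (2 - D) \<ge> r powr (2 - D) * (1 + \<epsilon>) powr (2 - D)"
      proof -
        have "((1 + \<epsilon>) * r) powr (2 - D) \<le> norm y powr (2 - D)" using y ny D by (intro powr_mono2') auto
        then show ?thesis using r \<epsilon> by (simp add: powr_mult mult.commute)
      qed
      have p1: "(1 + \<epsilon>) powr (2 - D) \<le> 1" using \<epsilon> D powr_mono2'[of "2 - D" 1 "1 + \<epsilon>"] by simp
      have "0 \<le> c * I" unfolding I_def set_lebesgue_integral_def using c
        by (intro mult_nonneg_nonneg integral_nonneg_AE) auto
      have "norm y powr (2 - D) * (c * I) \<le> norm y powr (2 - D) * 1" using I by (intro mult_left_mono) auto
      then have u: "norm y powr (2 - D) * (c * I) \<le> r powr (2 - D) * (1 + \<eta>)" using up by simp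
      have "r powr (2 - D) * (1 - \<eta>) \<le> r powr (2 - D) * ((1 + \<epsilon>) powr (2 - D) * (c * I))"
      proof (intro mult_left_mono)
        have "(1 + \<epsilon>) powr (2 - D) * (1 - \<eta> / 4) \<le> (1 + \<epsilon>) powr (2 - D) * (c * I)" using I by (intro mult_left_mono) auto
        moreover have "(1 + \<epsilon>) powr (2 - D) * (\<eta> / 4) \<le> 1 * (\<eta> / 4)" using p1 \<eta> by (intro mult_right_mono) auto
        moreover have "(1 + \<epsilon>) powr (2 - D) > 1 - \<eta> / 2" using e1(2)[OF \<epsilon>(1) \<epsilon>'(2)] by simp
        ultimately show "1 - \<eta> \<le> (1 + \<epsilon>) powr (2 - D) * (c * I)" using \<eta> by (simp only: right_diff_distrib mult_1_right)
      qed (use pr in simp)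
      also have "\<dots> \<le> norm y powr (2 - D) * (c * I)"
        using mult_right_mono[OF lo \<open>0 \<le> c * I\<close>] by (simp add: mult.assoc)
      finally have l: "r powr (2 - D) * (1 - \<eta>) \<le> norm y powr (2 - D) * (c * I)" .
      have "\<bar>a * c * kernel_time K ((\<epsilon> * r)\<^sup>2) s y - r powr (2 - D)\<bar> \<le> \<eta> * r powr (2 - D)"
        using u l unfolding Q by (simp add: abs_le_iff algebra_simps)
      then show "\<bar>diffusivity * collision_const DIM('a) * kernel_time K ((\<epsilon> * r)\<^sup>2) s y - r powr (2 - real DIM('a))\<bar> \<le> \<eta> * r powr (2 - real DIM('a))"
        by (simp add: a_def c_def D_def)
    qed
  qed
qed

end

section \<open>Occupation integrals\<close>

text \<open>Lebesgue measure on [0, K] as a finite measure on the whole line, so that bounded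
  functions are integrable and Fubini with a probability space is immediate.\<close>

definition time_measure :: "real \<Rightarrow> real measure" where
  "time_measure K = density lborel (\<lambda>t. ennreal (indicator {0..K} t))"

lemma sets_time_measure [simp, measurable_cong]: "sets (time_measure K) = sets borel"
  and space_time_measure [simp]: "space (time_measure K) = UNIV"
  by (simp_all add: time_measure_def)

lemma finite_time_measure: "finite_measure (time_measure K)"
proof
  have "emeasure (time_measure K) (space (time_measure K)) = emeasure lborel {0..K}"
    unfolding time_measure_def by (simp add: emeasure_density ennreal_indicator)
  also have "\<dots> \<noteq> \<infinity>" by (simp add: emeasure_lborel_Icc_eq)
  finally show "emeasure (time_measure K) (space (time_measure K)) \<noteq> \<infinity>" .
qed

lemma measure_time_measure: "0 \<le> K \<Longrightarrow> measure (time_measure K) UNIV = K"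
  unfolding time_measure_def measure_def by (simp add: emeasure_density ennreal_indicator)

lemma AE_time_measure: "AE t in time_measure K. 0 \<le> t \<and> t \<le> K"
  unfolding time_measure_def by (subst AE_density) (auto simp: indicator_def)

lemma integral_time_measure:
  fixes f :: "real \<Rightarrow> real"
  assumes "f \<in> borel_measurable borel"
  shows "(LINT t|time_measure K. f t) = (LINT t:{0..K}|lborel. f t)"
  unfolding time_measure_def set_lebesgue_integral_def using assms by (subst integral_density) auto

lemma integrable_time_measure:
  fixes f :: "real \<Rightarrow> real"
  assumes "f \<in> borel_measurable borel" "\<And>t. 0 \<le> t \<Longrightarrow> t \<le> K \<Longrightarrow> \<bar>f t\<bar> \<le> C"
  shows "integrable (time_measure K) f"
proof -
  interpret finite_measure "time_measure K" by (rule finite_time_measure)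
  show ?thesis
  proof (rule integrable_const_bound[where B=C])
    show "AE t in time_measure K. norm (f t) \<le> C"
      using AE_time_measure[of K] by eventually_elim (use assms in auto)
  qed (use assms in simp)
qed

lemma integral_time_measure_le:
  fixes f :: "real \<Rightarrow> real"
  assumes "\<And>t. 0 \<le> t \<Longrightarrow> t \<le> K \<Longrightarrow> \<bar>f t\<bar> \<le> C" and K: "0 \<le> K" and m: "f \<in> borel_measurable borel"
  shows "\<bar>LINT t|time_measure K. f t\<bar> \<le> C * K"
proof -
  interpret finite_measure "time_measure K" by (rule finite_time_measure)
  have "\<bar>LINT t|time_measure K. f t\<bar> \<le> (LINT t|time_measure K. \<bar>f t\<bar>)" by (rule integral_abs_bound)
  also have "\<dots> \<le> (LINT t|time_measure K. C)"
  proof (rule integral_mono_AE)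
    show "AE t in time_measure K. \<bar>f t\<bar> \<le> C"
      using AE_time_measure[of K] by eventually_elim (use assms in auto)
  qed (use integrable_time_measure[OF m assms(1)] in auto)
  also have "\<dots> = C * K" using K by (simp add: measure_time_measure)
  finally show ?thesis .
qed

lemma indicator_greater_measurable [measurable (raw)]:
  fixes f h :: "'n \<Rightarrow> real"
  assumes [measurable]: "f \<in> borel_measurable N" "h \<in> borel_measurable N"
  shows "(\<lambda>x. indicator {f x<..} (h x) :: real) \<in> borel_measurable N"
    and "(\<lambda>x. indicator {..f x} (h x) :: real) \<in> borel_measurable N"
  unfolding indicator_def greaterThan_iff atMost_iff by measurable

context brownian begin

lemma W_law:
  fixes f :: "'e \<Rightarrow> real"
  assumes [measurable]: "f \<in> borel_measurable borel" and bdd: "\<And>w. \<bar>f w\<bar> \<le> C" and t: "0 \<le> t"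
  shows "expectation (\<lambda>\<omega>. f (W t \<omega>)) = (LINT z|std_gauss. f (sqrt t *\<^sub>R z))"
proof -
  have "expectation (\<lambda>\<omega>. f (W t \<omega>)) = expectation (\<lambda>\<omega>. f (snd (\<omega>, W t \<omega> - W 0 \<omega>)))"
    by (intro Bochner_Integration.integral_cong) (auto simp: start)
  also have "\<dots> = expectation (\<lambda>\<omega>. LINT z|std_gauss. f (snd (\<omega>, sqrt (t - 0) *\<^sub>R z)))"
    by (rule markov[OF _ t, where C=C]) (use bdd in auto)
  finally show ?thesis by (simp add: prob_space)
qed

text \<open>The time integral is split at \<open>\<tau>\<close>. At each fixed time the part after
  \<open>\<tau>\<close> is evaluated by the strong Markov property, and Fubini then takes the
  expectation outside. \<open>max 0 t\<close> only extends the process to negative times, so that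
  measurability can be stated on the whole line.\<close>

lemma occupation_decomposition:
  fixes \<phi> :: "real \<times> 'e \<Rightarrow> real"
  assumes stop: "\<And>s. 0 \<le> s \<Longrightarrow> {\<omega> \<in> space M. \<tau> \<omega> \<le> s} \<in> sets (Fil s)"
    and nonneg: "\<And>\<omega>. \<omega> \<in> space M \<Longrightarrow> 0 \<le> \<tau> \<omega>"
    and \<phi>: "continuous_on UNIV \<phi>" and bdd: "\<And>p. \<bar>\<phi> p\<bar> \<le> C"
  shows "(\<lambda>t. expectation (\<lambda>\<omega>. \<phi> (t, W (max 0 t) \<omega>))) \<in> borel_measurable borel" (is ?m1)
    and "(\<lambda>t. expectation (\<lambda>\<omega>. indicator {t<..} (\<tau> \<omega>) * \<phi> (t, W (max 0 t) \<omega>))) \<in> borel_measurable borel" (is ?m2)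
    and "(\<lambda>\<omega>. LINT t|time_measure K. indicator {..t} (\<tau> \<omega>) * (LINT z|std_gauss. \<phi> (t, W (\<tau> \<omega>) \<omega> + sqrt (t - \<tau> \<omega>) *\<^sub>R z))) \<in> borel_measurable M" (is ?m3)
    and "(LINT t|time_measure K. expectation (\<lambda>\<omega>. \<phi> (t, W (max 0 t) \<omega>))) = 
     (LINT t|time_measure K. expectation (\<lambda>\<omega>. indicator {t<..} (\<tau> \<omega>) * \<phi> (t, W (max 0 t) \<omega>))) +
     expectation (\<lambda>\<omega>. LINT t|time_measure K. indicator {..t} (\<tau> \<omega>) * (LINT z|std_gauss. \<phi> (t, W (\<tau> \<omega>) \<omega> + sqrt (t - \<tau> \<omega>) *\<^sub>R z)))" (is ?eq)
proof -
  interpret T: finite_measure "time_measure K" by (rule finite_time_measure)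
  interpret g: prob_space "std_gauss :: 'e measure" by (rule prob_space_std_gauss)
  interpret TM: pair_sigma_finite "time_measure K" M ..
  interpret TMf: finite_measure "time_measure K \<Otimes>\<^sub>M M"
    by (rule finite_measure_pair_measure) unfold_locales
  have C0: "0 \<le> C" using order_trans[OF abs_ge_zero bdd] .
  have [measurable]: "\<phi> \<in> borel_measurable borel" using \<phi> by (rule borel_measurable_continuous_onI)
  have \<phi>m[measurable (raw)]: "(\<lambda>x. \<phi> (f x, h x)) \<in> borel_measurable N" 
    if "f \<in> borel_measurable N" "h \<in> borel_measurable N" for f h and N :: "'n measure"
    using measurable_compose[OF borel_measurable_Pair[OF that], of \<phi> borel] by simp
  note \<tau>m[measurable] = stopping_measurable[OF stop nonneg]
  note W_stopped_measurable[OF \<tau>m nonneg, measurable]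
  have Wj: "(\<lambda>p. W (max 0 (fst p)) (snd p)) \<in> borel_measurable (borel \<Otimes>\<^sub>M M)"
    using W_joint by (simp add: case_prod_beta')
  have [measurable]: "(\<lambda>p. W (max 0 (fst p)) (snd p)) \<in> borel_measurable (time_measure K \<Otimes>\<^sub>M M)"
    using Wj by (simp cong: measurable_cong_sets sets_pair_measure_cong)
  note Wj[measurable]
  define P where "P t \<omega> = (LINT z|std_gauss. \<phi> (t, W (\<tau> \<omega>) \<omega> + sqrt (t - \<tau> \<omega>) *\<^sub>R z))" for t \<omega>
  have Pb: "\<bar>P t \<omega>\<bar> \<le> C" for t \<omega> unfolding P_def by (rule g.expectation_abs_le) (rule bdd)
  have [measurable]: "(\<lambda>p. P (fst p) (snd p)) \<in> borel_measurable (time_measure K \<Otimes>\<^sub>M M)"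
    unfolding P_def by measurable
  show ?m1 by measurable
  show ?m2 by measurable
  show ?m3 by measurable
  have i1: "integrable M (\<lambda>\<omega>. indicator {t<..} (\<tau> \<omega>) * \<phi> (t, W (max 0 t) \<omega>))" "integrable M (\<lambda>\<omega>. indicator {..t} (\<tau> \<omega>) * \<phi> (t, W (max 0 t) \<omega>))" for t
  proof -
    have [measurable]: "W (max 0 t) \<in> borel_measurable M" by (rule W_measurable) simp
    show "integrable M (\<lambda>\<omega>. indicator {t<..} (\<tau> \<omega>) * \<phi> (t, W (max 0 t) \<omega>))" "integrable M (\<lambda>\<omega>. indicator {..t} (\<tau> \<omega>) * \<phi> (t, W (max 0 t) \<omega>))"
      using bdd C0 by (auto intro!: integrable_bounded[where C=C] simp: indicator_def)
  qed
  have m4: "(\<lambda>t. expectation (\<lambda>\<omega>. indicator {..t} (\<tau> \<omega>) * \<phi> (t, W (max 0 t) \<omega>))) \<in> borel_measurable borel" by measurable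
  have "(LINT t|time_measure K. expectation (\<lambda>\<omega>. \<phi> (t, W (max 0 t) \<omega>))) = 
    (LINT t|time_measure K. expectation (\<lambda>\<omega>. indicator {t<..} (\<tau> \<omega>) * \<phi> (t, W (max 0 t) \<omega>)) + expectation (\<lambda>\<omega>. indicator {..t} (\<tau> \<omega>) * \<phi> (t, W (max 0 t) \<omega>)))"
  proof (rule Bochner_Integration.integral_cong[OF refl])
    fix t
    show "expectation (\<lambda>\<omega>. \<phi> (t, W (max 0 t) \<omega>)) = expectation (\<lambda>\<omega>. indicator {t<..} (\<tau> \<omega>) * \<phi> (t, W (max 0 t) \<omega>)) + expectation (\<lambda>\<omega>. indicator {..t} (\<tau> \<omega>) * \<phi> (t, W (max 0 t) \<omega>))"
      unfolding Bochner_Integration.integral_add[OF i1, symmetric]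
      by (intro Bochner_Integration.integral_cong) (auto simp: indicator_def)
  qed
  also have "\<dots> = (LINT t|time_measure K. expectation (\<lambda>\<omega>. indicator {t<..} (\<tau> \<omega>) * \<phi> (t, W (max 0 t) \<omega>))) + (LINT t|time_measure K. expectation (\<lambda>\<omega>. indicator {..t} (\<tau> \<omega>) * \<phi> (t, W (max 0 t) \<omega>)))"
  proof (rule Bochner_Integration.integral_add)
    show "integrable (time_measure K) (\<lambda>t. expectation (\<lambda>\<omega>. indicator {t<..} (\<tau> \<omega>) * \<phi> (t, W (max 0 t) \<omega>)))"
      using bdd C0 by (intro integrable_time_measure[where C=C] \<open>?m2\<close> expectation_abs_le) (auto simp: indicator_def)
    show "integrable (time_measure K) (\<lambda>t. expectation (\<lambda>\<omega>. indicator {..t} (\<tau> \<omega>) * \<phi> (t, W (max 0 t) \<omega>)))"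
      using bdd C0 by (intro integrable_time_measure[where C=C] m4 expectation_abs_le) (auto simp: indicator_def)
  qed
  also have "(LINT t|time_measure K. expectation (\<lambda>\<omega>. indicator {..t} (\<tau> \<omega>) * \<phi> (t, W (max 0 t) \<omega>)))
    = (LINT t|time_measure K. expectation (\<lambda>\<omega>. indicator {..t} (\<tau> \<omega>) * P t \<omega>))"
  proof (rule integral_cong_AE)
    show "AE t in time_measure K. expectation (\<lambda>\<omega>. indicator {..t} (\<tau> \<omega>) * \<phi> (t, W (max 0 t) \<omega>)) = expectation (\<lambda>\<omega>. indicator {..t} (\<tau> \<omega>) * P t \<omega>)"
      using AE_time_measure[of K]
    proof eventually_elim
      case (elim t)
      have "continuous_on UNIV (\<lambda>w. \<phi> (t, w))"
        by (intro continuous_on_compose2[OF \<phi>] continuous_intros) auto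
      from strong_markov[OF stop nonneg this bdd, of t] elim show ?case by (simp add: P_def max_def)
    qed
  qed measurable
  also have "\<dots> = expectation (\<lambda>\<omega>. LINT t|time_measure K. indicator {..t} (\<tau> \<omega>) * P t \<omega>)"
  proof (rule TM.Fubini_integral[symmetric])
    show "integrable (time_measure K \<Otimes>\<^sub>M M) (\<lambda>(t, \<omega>). indicator {..t} (\<tau> \<omega>) * P t \<omega>)"
      using Pb C0 by (intro TMf.integrable_const_bound[where B=C]) (auto simp: indicator_def case_prod_beta')
  qed
  finally show ?eq unfolding P_def .
qed

end

section \<open>One collision scale\<close>

lemma kernel_time_eq_time_measure:
  fixes y :: "'a::euclidean_space"
  assumes "0 \<le> s"
  shows "(LINT t|time_measure K. indicator {..t} s * gauss (\<delta> + a * (t - s)) y) = (LINT t:{s..K}|lborel. gauss (\<delta> + a * (t - s)) y)"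
proof -
  have "(\<lambda>t. gauss (\<delta> + a * (t - s)) y) \<in> borel_measurable borel" unfolding gauss_def by measurable
  then have "(\<lambda>t. indicator {..t} s * gauss (\<delta> + a * (t - s)) y) \<in> borel_measurable borel" by measurable
  then have "(LINT t|time_measure K. indicator {..t} s * gauss (\<delta> + a * (t - s)) y) = (LINT t:{0..K}|lborel. indicator {..t} s * gauss (\<delta> + a * (t - s)) y)"
    by (rule integral_time_measure)
  also have "\<dots> = (LINT t:{s..K}|lborel. gauss (\<delta> + a * (t - s)) y)"
    unfolding set_lebesgue_integral_def using assms
    by (intro Bochner_Integration.integral_cong) (auto simp: indicator_def)
  finally show ?thesis .
qed

locale brownian_pair = brownian M Fil W + pair_geometry x1 x2 s1 s2 y1 y2
  for M :: "'w measure" and Fil and W :: "real \<Rightarrow> 'w \<Rightarrow> 'a::euclidean_space \<times> 'a" and x1 x2 :: 'a and s1 s2 y1 y2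
begin

lemma separation_zero [simp]: "separation 0 = x1 - x2"
  by (simp add: separation_def)

lemma expectation_gauss_separation:
  assumes "\<delta> > 0" "0 \<le> t"
  shows "expectation (\<lambda>\<omega>. gauss \<delta> (separation (W t \<omega>))) = gauss (\<delta> + diffusivity * t) (x1 - x2)"
proof -
  have "expectation (\<lambda>\<omega>. gauss \<delta> (separation (W t \<omega>))) = (LINT z|std_gauss. gauss \<delta> (separation (sqrt t *\<^sub>R z)))"
    using gauss_le[OF assms(1), where 'a='a] by (intro W_law[where f="\<lambda>w. gauss \<delta> (separation w)"] assms(2)) auto
  also have "\<dots> = (LINT z|std_gauss. gauss \<delta> (separation (0 + sqrt t *\<^sub>R z)))" by simp
  also have "\<dots> = gauss (\<delta> + diffusivity * t) (x1 - x2)"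
    using heat_separation[OF assms, of 0] by simp
  finally show ?thesis .
qed

lemma continuous_gauss_separation:
  assumes "\<delta> > 0"
  shows "continuous_on UNIV (\<lambda>p :: real \<times> ('a \<times> 'a). gauss \<delta> (separation (snd p)))"
  using assms by (intro continuous_intros) 

text \<open>All that is used about a single \<open>N\<close>: \<open>h\<close> is the capped
  collision time, \<open>Om\<close> the event on which the positions follow the Brownian ones, and
  the Ornstein-Uhlenbeck dynamics are visible only through \<open>far\<close> and
  \<open>near\<close>. \<open>near\<close> stops at \<open>t1\<close> because at the cap
  \<open>K\<close> nothing need have been hit.\<close>

context
  fixes h :: "'w \<Rightarrow> real" and Om :: "'w set" and r \<epsilon> \<eta> K t1 C0 \<delta> :: real
  assumes d: "DIM('a) \<ge> 3" and r: "0 < r" and \<epsilon>: "0 < \<epsilon>" "\<epsilon> \<le> 1/2" and \<delta>: "\<delta> = (\<epsilon> * r)\<^sup>2"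
    and stop: "\<And>s. 0 \<le> s \<Longrightarrow> {\<omega> \<in> space M. h \<omega> \<le> s} \<in> sets (Fil s)"
    and nonneg: "\<And>\<omega>. \<omega> \<in> space M \<Longrightarrow> 0 \<le> h \<omega>"
    and h_le: "\<And>\<omega>. \<omega> \<in> space M \<Longrightarrow> h \<omega> \<le> K"
    and Om[measurable]: "Om \<in> sets M" and K: "0 \<le> K" "t1 < K"
    and far: "\<And>\<omega> t. \<omega> \<in> Om \<Longrightarrow> 0 \<le> t \<Longrightarrow> t < h \<omega> \<Longrightarrow> (1 - \<epsilon>) * r \<le> norm (separation (W t \<omega>))"
    and near: "\<And>\<omega>. \<omega> \<in> Om \<Longrightarrow> h \<omega> \<le> t1 \<Longrightarrow> (1 - \<epsilon>) * r \<le> norm (separation (W (h \<omega>) \<omega>)) \<and> norm (separation (W (h \<omega>) \<omega>)) \<le> (1 + \<epsilon>) * r"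
    and C0: "\<And>s. s > 0 \<Longrightarrow> gauss s (x1 - x2) \<le> C0"
    and \<eta>: "0 < \<eta>" "\<eta> \<le> 1/2"
    and kernel: "\<And>y s. (1 - \<epsilon>) * r \<le> norm y \<Longrightarrow> norm y \<le> (1 + \<epsilon>) * r \<Longrightarrow> s \<le> t1 \<Longrightarrow>
       \<bar>diffusivity * collision_const DIM('a) * kernel_time K \<delta> s y - r powr (2 - real DIM('a))\<bar> \<le> \<eta> * r powr (2 - real DIM('a))"
begin

lemma \<delta>_pos: "\<delta> > 0" using \<delta> r \<epsilon> by simp

lemma h_measurable [measurable]: "h \<in> borel_measurable M"
  by (rule stopping_measurable[OF stop nonneg])

lemma ac_pos: "diffusivity * collision_const DIM('a) > 0"
  using diffusivity_pos collision_const_pos[OF d] by simp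

lemma kernel_time_hit:
  assumes "\<omega> \<in> space M"
  shows "(LINT t|time_measure K. indicator {..t} (h \<omega>) * (LINT z|std_gauss. gauss \<delta> (separation (W (h \<omega>) \<omega> + sqrt (t - h \<omega>) *\<^sub>R z))))
    = kernel_time K \<delta> (h \<omega>) (separation (W (h \<omega>) \<omega>))"
proof -
  have e: "indicator {..t} (h \<omega>) * (LINT z|std_gauss. gauss \<delta> (separation (W (h \<omega>) \<omega> + sqrt (t - h \<omega>) *\<^sub>R z)))
     = indicator {..t} (h \<omega>) * gauss (\<delta> + diffusivity * (t - h \<omega>)) (separation (W (h \<omega>) \<omega>))" for t
    using heat_separation[OF \<delta>_pos, of "t - h \<omega>" "W (h \<omega>) \<omega>"] by (simp add: indicator_def)
  show ?thesis
    unfolding kernel_time_def kernel_time_eq_time_measure[OF nonneg[OF assms], symmetric] e ..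
qed

lemma kernel_time_nonneg: "0 \<le> kernel_time K \<delta> s y"
  unfolding kernel_time_def set_lebesgue_integral_def by (intro integral_nonneg_AE) auto

text \<open>The expected occupation of the kernel is at most \<open>K * C0\<close>, while every
  collision on \<open>Om\<close> by time \<open>t1\<close> accounts for at least r^(2-d) / (2 a c_d)
  of it, by \<open>kernel\<close> with \<eta> \<le> 1/2. Comparing the two is Markov's
  inequality.\<close>

lemma hit_probability:
  "prob {\<omega> \<in> space M. \<omega> \<in> Om \<and> h \<omega> \<le> t1} \<le> 2 * (diffusivity * collision_const DIM('a)) * (K * C0) * r powr (real DIM('a) - 2)"
proof -
  define ac where "ac = diffusivity * collision_const DIM('a)"
  define R where "R = r powr (2 - real DIM('a))"
  define L where "L = (2 * pi * \<delta>) powr (- real DIM('a) / 2)"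
  define \<phi> where "\<phi> = (\<lambda>p :: real \<times> ('a \<times> 'a). gauss \<delta> (separation (snd p)))"
  have Rp: "R > 0" using r by (simp add: R_def)
  have \<phi>c: "continuous_on UNIV \<phi>" unfolding \<phi>_def by (rule continuous_gauss_separation[OF \<delta>_pos])
  have \<phi>b: "\<bar>\<phi> p\<bar> \<le> L" for p unfolding \<phi>_def L_def using gauss_le[OF \<delta>_pos] by simp
  note dec = occupation_decomposition[OF stop nonneg \<phi>c \<phi>b]
  let ?Q = "\<lambda>\<omega>. LINT t|time_measure K. indicator {..t} (h \<omega>) * (LINT z|std_gauss. \<phi> (t, W (h \<omega>) \<omega> + sqrt (t - h \<omega>) *\<^sub>R z))"
  have Q: "?Q \<omega> = kernel_time K \<delta> (h \<omega>) (separation (W (h \<omega>) \<omega>))" if "\<omega> \<in> space M" for \<omega>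
    unfolding \<phi>_def using kernel_time_hit[OF that] by simp
  interpret g: prob_space "std_gauss :: ('a \<times> 'a) measure" by (rule prob_space_std_gauss)
  have QL: "\<bar>?Q \<omega>\<bar> \<le> L * K" if "\<omega> \<in> space M" for \<omega>
  proof (rule integral_time_measure_le[OF _ K(1)])
    show "\<bar>indicator {..t} (h \<omega>) * (LINT z|std_gauss. \<phi> (t, W (h \<omega>) \<omega> + sqrt (t - h \<omega>) *\<^sub>R z))\<bar> \<le> L" for t
      using g.expectation_abs_le[of "\<lambda>z. \<phi> (t, W (h \<omega>) \<omega> + sqrt (t - h \<omega>) *\<^sub>R z)" L] \<phi>b \<phi>b[of undefined]
      by (auto simp: indicator_def)
    have "(\<lambda>t. LINT z|std_gauss. \<phi> (t, W (h \<omega>) \<omega> + sqrt (t - h \<omega>) *\<^sub>R z)) \<in> borel_measurable borel"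
      unfolding \<phi>_def by measurable
    then show "(\<lambda>t. indicator {..t} (h \<omega>) * (LINT z|std_gauss. \<phi> (t, W (h \<omega>) \<omega> + sqrt (t - h \<omega>) *\<^sub>R z))) \<in> borel_measurable borel"
      by measurable
  qed
  have m1: "expectation ?Q \<le> K * C0"
  proof -
    \<comment> \<open>The occupation before the collision is nonnegative and may be dropped.\<close>
    have "0 \<le> (LINT t|time_measure K. expectation (\<lambda>\<omega>. indicator {t<..} (h \<omega>) * \<phi> (t, W (max 0 t) \<omega>)))"
      by (intro integral_nonneg_AE AE_I2) (auto simp: \<phi>_def)
    moreover have "(LINT t|time_measure K. expectation (\<lambda>\<omega>. \<phi> (t, W (max 0 t) \<omega>))) =
      (LINT t|time_measure K. expectation (\<lambda>\<omega>. indicator {t<..} (h \<omega>) * \<phi> (t, W (max 0 t) \<omega>))) + expectation ?Q"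
      by (rule dec(4))
    ultimately have "expectation ?Q \<le> (LINT t|time_measure K. expectation (\<lambda>\<omega>. \<phi> (t, W (max 0 t) \<omega>)))"
      by linarith
    also have "\<dots> \<le> C0 * K"
    proof (rule order_trans[OF abs_ge_self], rule integral_time_measure_le[OF _ K(1) dec(1)])
      fix t :: real assume "0 \<le> t"
      then have "expectation (\<lambda>\<omega>. \<phi> (t, W (max 0 t) \<omega>)) = gauss (\<delta> + diffusivity * t) (x1 - x2)"
        unfolding \<phi>_def using expectation_gauss_separation[OF \<delta>_pos, of t] by simp
      then show "\<bar>expectation (\<lambda>\<omega>. \<phi> (t, W (max 0 t) \<omega>))\<bar> \<le> C0"
        using C0[of "\<delta> + diffusivity * t"] \<delta>_pos diffusivity_pos \<open>0 \<le> t\<close> by (simp add: add_pos_nonneg)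
    qed
    finally show ?thesis by (simp add: mult.commute)
  qed
  have m2: "R / 2 * prob {\<omega> \<in> space M. \<omega> \<in> Om \<and> h \<omega> \<le> t1} \<le> ac * expectation ?Q"
  proof -
    have "R / 2 * prob {\<omega> \<in> space M. \<omega> \<in> Om \<and> h \<omega> \<le> t1} = expectation (\<lambda>\<omega>. R / 2 * indicator {\<omega> \<in> space M. \<omega> \<in> Om \<and> h \<omega> \<le> t1} \<omega>)"
      by simp
    also have "\<dots> \<le> expectation (\<lambda>\<omega>. ac * ?Q \<omega>)"
    proof (rule integral_mono)
      show "integrable M (\<lambda>\<omega>. R / 2 * indicator {\<omega> \<in> space M. \<omega> \<in> Om \<and> h \<omega> \<le> t1} \<omega>)"
        using Rp by (intro integrable_bounded[where C="R / 2"]) (auto simp: indicator_def)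
      show "integrable M (\<lambda>\<omega>. ac * ?Q \<omega>)"
        using dec(3) QL by (intro integrable_mult_right integrable_bounded[where C="L * K"]) auto
      fix \<omega> assume \<omega>: "\<omega> \<in> space M"
      show "R / 2 * indicator {\<omega> \<in> space M. \<omega> \<in> Om \<and> h \<omega> \<le> t1} \<omega> \<le> ac * ?Q \<omega>"
      proof (cases "\<omega> \<in> Om \<and> h \<omega> \<le> t1")
        case True
        have "\<bar>ac * ?Q \<omega> - R\<bar> \<le> \<eta> * R"
          unfolding Q[OF \<omega>] ac_def R_def using near[of \<omega>] True by (intro kernel) auto
        moreover have "\<eta> * R \<le> 1/2 * R" using \<eta> Rp by (intro mult_right_mono) auto
        ultimately have "R / 2 \<le> ac * ?Q \<omega>" by linarith
        then show ?thesis using True \<omega> by simp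
      next
        case False
        then show ?thesis unfolding Q[OF \<omega>] using kernel_time_nonneg ac_pos by (auto simp: ac_def)
      qed
    qed
    finally show ?thesis by simp
  qed
  have "R / 2 * prob {\<omega> \<in> space M. \<omega> \<in> Om \<and> h \<omega> \<le> t1} \<le> ac * (K * C0)"
    by (rule order_trans[OF m2 mult_left_mono[OF m1]]) (use ac_pos in \<open>simp add: ac_def\<close>)
  then have "prob {\<omega> \<in> space M. \<omega> \<in> Om \<and> h \<omega> \<le> t1} \<le> 2 * ac * (K * C0) * (1 / R)"
    using Rp by (simp add: field_simps)
  also have "1 / R = r powr (real DIM('a) - 2)"
    unfolding R_def by (simp add: powr_minus_divide[symmetric])
  finally show ?thesis by (simp add: ac_def)
qed

text \<open>\<open>Y\<close> is the observed collision value. The bound collects the occupation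
  before the collision (kernel tail \<open>E0\<close> on \<open>Om\<close>, kernel height
  \<open>L\<close> off it), an error per collision times the probability of a collision, and crude
  bounds off \<open>Om\<close>.\<close>

lemma one_scale:
  fixes g :: "real \<times> 'a \<Rightarrow> real" and Y :: "'w \<Rightarrow> real"
  assumes g: "continuous_on UNIV g" and G: "\<And>p. \<bar>g p\<bar> \<le> G" and supp: "\<And>t z. t > t1 \<Longrightarrow> g (t, z) = 0"
    and freeze: "\<And>u s w. u \<ge> 0 \<Longrightarrow> 
      \<bar>(LINT z|std_gauss. g (s + u, center (w + sqrt u *\<^sub>R z)) * gauss \<delta> (separation (w + sqrt u *\<^sub>R z))) 
      - g (s, center w) * gauss (\<delta> + diffusivity * u) (separation w)\<bar>
     \<le> \<eta> * gauss (\<delta> + diffusivity * u) (separation w) + Cf"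
    and Cf: "0 \<le> Cf"
    and Y: "Y \<in> borel_measurable M" "\<And>\<omega>. \<omega> \<in> space M \<Longrightarrow> \<bar>Y \<omega>\<bar> \<le> G" "\<And>\<omega>. \<omega> \<in> Om \<Longrightarrow> h \<omega> > t1 \<Longrightarrow> Y \<omega> = 0"
      "\<And>\<omega>. \<omega> \<in> Om \<Longrightarrow> \<bar>Y \<omega> - g (h \<omega>, center (W (h \<omega>) \<omega>))\<bar> \<le> \<eta>"
  defines "ac \<equiv> diffusivity * collision_const DIM('a)" and "R \<equiv> r powr (2 - real DIM('a))"
    and "L \<equiv> (2 * pi * \<delta>) powr (- real DIM('a) / 2)" 
    and "E0 \<equiv> 2 powr (real DIM('a) / 2) * exp (- (1 - \<epsilon>)\<^sup>2 / (4 * \<epsilon>\<^sup>2))"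
    and "p \<equiv> prob (space M - Om)"
  shows "\<bar>ac * (LINT t|time_measure K. expectation (\<lambda>\<omega>. g (t, center (W (max 0 t) \<omega>)) * gauss \<delta> (separation (W (max 0 t) \<omega>)))) - R * expectation Y\<bar>
    \<le> ac * (G * (E0 * C0 + L * p) * K) + 
      ((3 + G) * \<eta> * R + ac * Cf * K) * prob {\<omega> \<in> space M. \<omega> \<in> Om \<and> h \<omega> \<le> t1} + (ac * (G * L * K) + R * G) * p"
proof -
  have G0: "0 \<le> G" using order_trans[OF abs_ge_zero G] .
  have Rp: "R > 0" using r by (simp add: R_def)
  have acp: "ac > 0" using ac_pos by (simp add: ac_def)
  have L0: "L \<ge> 0" by (simp add: L_def)
  have E00: "E0 \<ge> 0" by (simp add: E0_def)
  interpret gs: prob_space "std_gauss :: ('a \<times> 'a) measure" by (rule prob_space_std_gauss)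
  define \<phi> where "\<phi> = (\<lambda>p :: real \<times> ('a \<times> 'a). g (fst p, center (snd p)) * gauss \<delta> (separation (snd p)))"
  have \<phi>c: "continuous_on UNIV \<phi>" unfolding \<phi>_def
    by (intro continuous_intros continuous_on_compose2[OF g] \<delta>_pos) auto
  then have \<phi>m: "\<phi> \<in> borel_measurable borel" by (rule borel_measurable_continuous_onI)
  have \<phi>b: "\<bar>\<phi> p\<bar> \<le> G * L" for p unfolding \<phi>_def L_def abs_mult using gauss_le[OF \<delta>_pos, of "separation (snd p)"] 
    by (intro mult_mono G G0) auto
  note dec = occupation_decomposition[OF stop nonneg \<phi>c \<phi>b]
  define H where "H = (\<lambda>\<omega>. LINT t|time_measure K. indicator {..t} (h \<omega>) * (LINT z|std_gauss. \<phi> (t, W (h \<omega>) \<omega> + sqrt (t - h \<omega>) *\<^sub>R z)))"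
  have Pm: "(\<lambda>t. LINT z|std_gauss. \<phi> (t, w + sqrt (t - s) *\<^sub>R z)) \<in> borel_measurable borel" for w s
  proof -
    have "(\<lambda>p. \<phi> (fst p, w + sqrt (fst p - s) *\<^sub>R snd p)) \<in> borel_measurable (borel \<Otimes>\<^sub>M std_gauss)"
      by (rule measurable_compose[OF _ \<phi>m], rule borel_measurable_Pair) measurable
    then show ?thesis by (intro gs.borel_measurable_lebesgue_integral) (simp add: case_prod_beta')
  qed
  then have iPm[measurable]: "(\<lambda>t. indicator {..t} s * (LINT z|std_gauss. \<phi> (t, w + sqrt (t - s) *\<^sub>R z))) \<in> borel_measurable borel" for w s
    by measurable
  have Pb: "\<bar>LINT z|std_gauss. \<phi> (t, w + sqrt (t - s) *\<^sub>R z)\<bar> \<le> G * L" for t w s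
    by (rule gs.expectation_abs_le) (rule \<phi>b)
  have iPb: "\<bar>indicator {..t} s * (LINT z|std_gauss. \<phi> (t, w + sqrt (t - s) *\<^sub>R z))\<bar> \<le> G * L" for t w s
    using Pb[of t w s] G0 L0 by (auto simp: indicator_def)
  have Hb: "\<bar>H \<omega>\<bar> \<le> G * L * K" for \<omega>
    unfolding H_def by (rule integral_time_measure_le[OF _ K(1) iPm]) (rule iPb)
  have Hm: "H \<in> borel_measurable M" unfolding H_def by (rule dec(3))
  text \<open>Before the collision the separation is at least \<open>(1 - \<epsilon>) r\<close>, where the kernel is tiny.\<close>
  have first: "\<bar>LINT t|time_measure K. expectation (\<lambda>\<omega>. indicator {t<..} (h \<omega>) * \<phi> (t, W (max 0 t) \<omega>))\<bar> \<le> G * (E0 * C0 + L * p) * K"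
  proof (rule integral_time_measure_le[OF _ K(1) dec(2)])
    fix t assume t: "0 \<le> t" "t \<le> K"
    have [measurable]: "W t \<in> borel_measurable M" using W_measurable t by simp
    have Wt: "W (max 0 t) = W t" using t by (simp add: max_def)
    have i2: "integrable M (\<lambda>\<omega>. gauss (2 * \<delta>) (separation (W t \<omega>)))"
      using gauss_le[of "2 * \<delta>", where 'a='a] \<delta>_pos by (intro integrable_bounded) auto
    have pw: "\<bar>indicator {t<..} (h \<omega>) * \<phi> (t, W t \<omega>)\<bar> \<le> G * E0 * gauss (2 * \<delta>) (separation (W t \<omega>)) + G * L * indicator (space M - Om) \<omega>"
      if \<omega>: "\<omega> \<in> space M" for \<omega>
    proof (cases "\<omega> \<in> Om")
      case False
      have "\<bar>indicator {t<..} (h \<omega>) * \<phi> (t, W t \<omega>)\<bar> \<le> G * L" using \<phi>b[of "(t, W t \<omega>)"] G0 L0 by (auto simp: indicator_def)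
      then show ?thesis using False \<omega> G0 E00 by (simp add: add_increasing)
    next
      case True
      show ?thesis
      proof (cases "t < h \<omega>")
        case th: True
        have "gauss \<delta> (separation (W t \<omega>)) \<le> 2 powr (real DIM('a) / 2) * exp (- ((1 - \<epsilon>) * r)\<^sup>2 / (4 * \<delta>)) * gauss (2 * \<delta>) (separation (W t \<omega>))"
          using far[OF True t(1) th] \<epsilon> r by (intro gauss_off_ball[OF \<delta>_pos]) auto
        \<comment> \<open>Since \<open>\<delta>\<close> is proportional to r^2, the exponent depends
          on \<epsilon> alone.\<close>
        also have "((1 - \<epsilon>) * r)\<^sup>2 / (4 * \<delta>) = (1 - \<epsilon>)\<^sup>2 / (4 * \<epsilon>\<^sup>2)"
          using r by (simp add: \<delta> power_mult_distrib)
        then have "- ((1 - \<epsilon>) * r)\<^sup>2 / (4 * \<delta>) = - (1 - \<epsilon>)\<^sup>2 / (4 * \<epsilon>\<^sup>2)" by simp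
        finally have le: "gauss \<delta> (separation (W t \<omega>)) \<le> E0 * gauss (2 * \<delta>) (separation (W t \<omega>))" by (simp add: E0_def)
        have "\<bar>\<phi> (t, W t \<omega>)\<bar> \<le> G * (E0 * gauss (2 * \<delta>) (separation (W t \<omega>)))"
          unfolding \<phi>_def abs_mult using le by (intro mult_mono G G0) auto
        then show ?thesis using th True by (simp add: mult.assoc)
      qed (use G0 E00 True in simp)
    qed
    have "\<bar>expectation (\<lambda>\<omega>. indicator {t<..} (h \<omega>) * \<phi> (t, W t \<omega>))\<bar> \<le> expectation (\<lambda>\<omega>. \<bar>indicator {t<..} (h \<omega>) * \<phi> (t, W t \<omega>)\<bar>)"
      by (rule integral_abs_bound)
    also have "\<dots> \<le> expectation (\<lambda>\<omega>. G * E0 * gauss (2 * \<delta>) (separation (W t \<omega>)) + G * L * indicator (space M - Om) \<omega>)"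
    proof (rule integral_mono[OF _ _ pw])
      have "(\<lambda>\<omega>. \<phi> (t, W t \<omega>)) \<in> borel_measurable M"
        by (rule measurable_compose[OF _ \<phi>m], rule borel_measurable_Pair) measurable
      then have "integrable M (\<lambda>\<omega>. indicator {t<..} (h \<omega>) * \<phi> (t, W t \<omega>))"
        using \<phi>b G0 L0 by (intro integrable_bounded[where C="G * L"]) (auto simp: indicator_def)
      then show "integrable M (\<lambda>\<omega>. \<bar>indicator {t<..} (h \<omega>) * \<phi> (t, W t \<omega>)\<bar>)" by (rule integrable_abs)
      show "integrable M (\<lambda>\<omega>. G * E0 * gauss (2 * \<delta>) (separation (W t \<omega>)) + G * L * indicator (space M - Om) \<omega>)"
        using i2 by (simp add: emeasure_eq_measure)
    qed
    also have "\<dots> = G * E0 * expectation (\<lambda>\<omega>. gauss (2 * \<delta>) (separation (W t \<omega>))) + G * L * p"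
      using i2 by (simp add: p_def emeasure_eq_measure)
    also have "\<dots> \<le> G * E0 * C0 + G * L * p"
      using expectation_gauss_separation[of "2 * \<delta>" t] C0[of "2 * \<delta> + diffusivity * t"] \<delta>_pos diffusivity_pos t G0 E00 L0
      by (intro add_mono mult_left_mono) (auto simp: add_pos_nonneg)
    finally show "\<bar>expectation (\<lambda>\<omega>. indicator {t<..} (h \<omega>) * \<phi> (t, W (max 0 t) \<omega>))\<bar> \<le> G * (E0 * C0 + L * p)"
      unfolding Wt by (simp add: algebra_simps)
  qed
  text \<open>After the collision the occupation integral is the frozen value times the kernel.\<close>
  have hit: "\<bar>ac * H \<omega> - R * Y \<omega>\<bar> \<le> (3 + G) * \<eta> * R + ac * Cf * K" if \<omega>: "\<omega> \<in> Om" "h \<omega> \<le> t1" for \<omega>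
  proof -
    have \<omega>M: "\<omega> \<in> space M" using \<omega> sets.sets_into_space[OF Om] by auto
    define w where "w = W (h \<omega>) \<omega>"
    define s where "s = h \<omega>"
    define Q where "Q = kernel_time K \<delta> s (separation w)"
    have s0: "0 \<le> s" using nonneg[OF \<omega>M] by (simp add: s_def)
    have Qe: "Q = (LINT t|time_measure K. indicator {..t} s * gauss (\<delta> + diffusivity * (t - s)) (separation w))"
      unfolding Q_def kernel_time_def by (rule kernel_time_eq_time_measure[OF s0, symmetric])
    have gm: "(\<lambda>t. indicator {..t} s * gauss (\<delta> + diffusivity * (t - s)) (separation w)) \<in> borel_measurable borel"
      unfolding gauss_def by measurable
    have gb: "\<bar>indicator {..t} s * gauss (\<delta> + diffusivity * (t - s)) (separation w)\<bar> \<le> L" for t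
    proof (cases "s \<le> t")
      case True
      have "gauss (\<delta> + diffusivity * (t - s)) (separation w) \<le> L" unfolding L_def
        using True \<delta>_pos diffusivity_pos by (intro gauss_le_mono) auto
      then show ?thesis using True by simp
    qed (use L0 in simp)
    have i1: "integrable (time_measure K) (\<lambda>t. indicator {..t} s * gauss (\<delta> + diffusivity * (t - s)) (separation w))"
      by (rule integrable_time_measure[OF gm]) (rule gb)
    have i2: "integrable (time_measure K) (\<lambda>t. indicator {..t} s * (LINT z|std_gauss. \<phi> (t, w + sqrt (t - s) *\<^sub>R z)))"
      by (rule integrable_time_measure[OF iPm]) (rule iPb)
    interpret T: finite_measure "time_measure K" by (rule finite_time_measure)
    have Hw: "H \<omega> = (LINT t|time_measure K. indicator {..t} s * (LINT z|std_gauss. \<phi> (t, w + sqrt (t - s) *\<^sub>R z)))"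
      by (simp only: H_def w_def s_def)
    have "\<bar>H \<omega> - g (s, center w) * Q\<bar> = \<bar>LINT t|time_measure K. indicator {..t} s * (LINT z|std_gauss. \<phi> (t, w + sqrt (t - s) *\<^sub>R z)) - g (s, center w) * (indicator {..t} s * gauss (\<delta> + diffusivity * (t - s)) (separation w))\<bar>"
      unfolding Qe Hw using i1 i2 by simp
    also have "\<dots> \<le> (LINT t|time_measure K. \<bar>indicator {..t} s * (LINT z|std_gauss. \<phi> (t, w + sqrt (t - s) *\<^sub>R z)) - g (s, center w) * (indicator {..t} s * gauss (\<delta> + diffusivity * (t - s)) (separation w))\<bar>)"
      by (rule integral_abs_bound)
    also have "\<dots> \<le> (LINT t|time_measure K. \<eta> * (indicator {..t} s * gauss (\<delta> + diffusivity * (t - s)) (separation w)) + Cf)"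
    proof (rule integral_mono)
      show "integrable (time_measure K) (\<lambda>t. \<bar>indicator {..t} s * (LINT z|std_gauss. \<phi> (t, w + sqrt (t - s) *\<^sub>R z)) - g (s, center w) * (indicator {..t} s * gauss (\<delta> + diffusivity * (t - s)) (separation w))\<bar>)"
        using i1 i2 by (intro integrable_abs Bochner_Integration.integrable_diff integrable_mult_right) auto
      show "integrable (time_measure K) (\<lambda>t. \<eta> * (indicator {..t} s * gauss (\<delta> + diffusivity * (t - s)) (separation w)) + Cf)"
        using i1 by simp
      fix t
      show "\<bar>indicator {..t} s * (LINT z|std_gauss. \<phi> (t, w + sqrt (t - s) *\<^sub>R z)) - g (s, center w) * (indicator {..t} s * gauss (\<delta> + diffusivity * (t - s)) (separation w))\<bar>
        \<le> \<eta> * (indicator {..t} s * gauss (\<delta> + diffusivity * (t - s)) (separation w)) + Cf"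
        using freeze[of "t - s" s w] Cf by (cases "s \<le> t") (simp_all add: \<phi>_def)
    qed
    also have "\<dots> = \<eta> * Q + Cf * K" unfolding Qe using i1 K by (simp add: measure_time_measure)
    finally have a1: "\<bar>H \<omega> - g (s, center w) * Q\<bar> \<le> \<eta> * Q + Cf * K" .
    have a2: "\<bar>ac * Q - R\<bar> \<le> \<eta> * R"
      unfolding Q_def ac_def R_def w_def s_def using near[OF \<omega>] \<omega> by (intro kernel) auto
    have "\<eta> * R \<le> 1 * R" using \<eta> Rp by (intro mult_right_mono) auto
    then have a3: "ac * Q \<le> 2 * R" using a2 by linarith
    have a4: "\<bar>g (s, center w) - Y \<omega>\<bar> \<le> \<eta>" using Y(4)[OF \<omega>(1)] by (simp add: w_def s_def abs_minus_commute)
    \<comment> \<open>Three replacements: freezing \<open>g\<close>, putting the limiting value for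
      the kernel time, and putting the observed value for the Brownian centre. As
      \<open>ac * Q\<close> \<le> 2 \<open>R\<close>, they cost 2, \<open>G\<close> and 1 times
      \<eta> \<open>R\<close>, which is the coefficient 3 + \<open>G\<close>.\<close>
    have "ac * H \<omega> - R * Y \<omega> = ac * (H \<omega> - g (s, center w) * Q) + g (s, center w) * (ac * Q - R) + R * (g (s, center w) - Y \<omega>)"
      by (simp add: algebra_simps)
    then have "\<bar>ac * H \<omega> - R * Y \<omega>\<bar> \<le> \<bar>ac * (H \<omega> - g (s, center w) * Q)\<bar> + \<bar>g (s, center w) * (ac * Q - R)\<bar> + \<bar>R * (g (s, center w) - Y \<omega>)\<bar>"
      by linarith
    also have "\<dots> \<le> ac * (\<eta> * Q + Cf * K) + G * (\<eta> * R) + R * \<eta>"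
      unfolding abs_mult using acp Rp a1 a2 a4 G0 by (intro add_mono mult_mono G) auto
    also have "ac * (\<eta> * Q + Cf * K) \<le> \<eta> * (2 * R) + ac * Cf * K"
      using mult_left_mono[OF a3, of \<eta>] \<eta> by (simp add: algebra_simps)
    finally show ?thesis by (simp add: algebra_simps)
  qed
  \<comment> \<open>A collision after \<open>t1\<close> contributes nothing on either side, because
    \<open>g\<close> vanishes from then on.\<close>
  have miss: "ac * H \<omega> - R * Y \<omega> = 0" if \<omega>: "\<omega> \<in> Om" "h \<omega> > t1" for \<omega>
  proof -
    have e: "indicator {..t} (h \<omega>) * (LINT z|std_gauss. \<phi> (t, W (h \<omega>) \<omega> + sqrt (t - h \<omega>) *\<^sub>R z)) = 0" for t
      using supp[of t] \<omega> by (cases "h \<omega> \<le> t") (auto simp: \<phi>_def)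
    have "H \<omega> = 0" unfolding H_def e by simp
    then show ?thesis using Y(3)[OF \<omega>] by simp
  qed
  have iH: "integrable M H" by (rule integrable_bounded[OF Hm Hb])
  have iY: "integrable M Y" by (rule integrable_bounded[OF Y(1,2)])
  have second: "\<bar>ac * expectation H - R * expectation Y\<bar> \<le> 
     ((3 + G) * \<eta> * R + ac * Cf * K) * prob {\<omega> \<in> space M. \<omega> \<in> Om \<and> h \<omega> \<le> t1} + (ac * (G * L * K) + R * G) * p"
  proof -
    let ?A = "(3 + G) * \<eta> * R + ac * Cf * K" and ?B = "ac * (G * L * K) + R * G" and ?E = "{\<omega> \<in> space M. \<omega> \<in> Om \<and> h \<omega> \<le> t1}"
    have A0: "0 \<le> ?A" using G0 \<eta> Rp acp Cf K by auto
    have B0: "0 \<le> ?B" using G0 L0 Rp acp K by auto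
    have "\<bar>ac * expectation H - R * expectation Y\<bar> = \<bar>expectation (\<lambda>\<omega>. ac * H \<omega> - R * Y \<omega>)\<bar>"
      using iH iY by simp
    also have "\<dots> \<le> expectation (\<lambda>\<omega>. \<bar>ac * H \<omega> - R * Y \<omega>\<bar>)" by (rule integral_abs_bound)
    also have "\<dots> \<le> expectation (\<lambda>\<omega>. ?A * indicator ?E \<omega> + ?B * indicator (space M - Om) \<omega>)"
    proof (rule integral_mono)
      show "integrable M (\<lambda>\<omega>. \<bar>ac * H \<omega> - R * Y \<omega>\<bar>)" using iH iY by simp
      show "integrable M (\<lambda>\<omega>. ?A * indicator ?E \<omega> + ?B * indicator (space M - Om) \<omega>)"
        by (simp add: emeasure_eq_measure)
      fix \<omega> assume \<omega>: "\<omega> \<in> space M"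
      show "\<bar>ac * H \<omega> - R * Y \<omega>\<bar> \<le> ?A * indicator ?E \<omega> + ?B * indicator (space M - Om) \<omega>"
      proof (cases "\<omega> \<in> Om")
        case True
        then show ?thesis using hit[of \<omega>] miss[of \<omega>] \<omega> by (cases "h \<omega> \<le> t1") auto
      next
        case False
        have "\<bar>ac * H \<omega> - R * Y \<omega>\<bar> \<le> ac * \<bar>H \<omega>\<bar> + R * \<bar>Y \<omega>\<bar>"
          using acp Rp abs_triangle_ineq4[of "ac * H \<omega>" "R * Y \<omega>"] by (simp add: abs_mult)
        also have "\<dots> \<le> ?B" using acp Rp Hb Y(2)[OF \<omega>] by (intro add_mono mult_left_mono) auto
        finally show ?thesis using False \<omega> by simp
      qed
    qed
    also have "\<dots> = ?A * prob ?E + ?B * p"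
      by (simp add: p_def emeasure_eq_measure)
    finally show ?thesis .
  qed
  have eq: "(LINT t|time_measure K. expectation (\<lambda>\<omega>. g (t, center (W (max 0 t) \<omega>)) * gauss \<delta> (separation (W (max 0 t) \<omega>)))) 
    = (LINT t|time_measure K. expectation (\<lambda>\<omega>. indicator {t<..} (h \<omega>) * \<phi> (t, W (max 0 t) \<omega>))) + expectation H"
    using dec(4) unfolding H_def by (simp add: \<phi>_def)
  have "\<bar>ac * (LINT t|time_measure K. expectation (\<lambda>\<omega>. indicator {t<..} (h \<omega>) * \<phi> (t, W (max 0 t) \<omega>)))\<bar> \<le> ac * (G * (E0 * C0 + L * p) * K)"
    unfolding abs_mult using first acp by (intro mult_mono) auto
  then show ?thesis using second unfolding eq by (simp add: distrib_left)
qed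

end

end

section \<open>The small-kernel limit of the occupation integral\<close>

context brownian_pair begin

text \<open>Given the first position, the kernel is the density of a second position displaced from
  it with variance \<open>\<delta>\<close>. Sampling the second position from the kernel leaves the
  true density of the second particle as a weight, and this weight, unlike the kernel, stays bounded
  as \<open>\<delta>\<close> tends to 0.\<close>

lemma pair_gauss_eq:
  fixes f :: "'a \<Rightarrow> 'a \<Rightarrow> real"
  assumes t: "t > 0" and \<delta>: "\<delta> > 0" 
    and f: "(\<lambda>p. f (fst p) (snd p)) \<in> borel_measurable borel" and bdd: "\<And>u v. \<bar>f u v\<bar> \<le> C"
  shows "expectation (\<lambda>\<omega>. f (x1 + s1 *\<^sub>R fst (W t \<omega>)) (x2 + s2 *\<^sub>R snd (W t \<omega>)) * gauss \<delta> (separation (W t \<omega>)))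
   = (LINT z|std_gauss. gauss (s2\<^sup>2 * t) (x1 + (s1 * sqrt t) *\<^sub>R fst z + sqrt \<delta> *\<^sub>R snd z - x2) * f (x1 + (s1 * sqrt t) *\<^sub>R fst z) (x1 + (s1 * sqrt t) *\<^sub>R fst z + sqrt \<delta> *\<^sub>R snd z))"
    (is "_ = integral\<^sup>L _ ?R")
proof -
  let ?L = "(2 * pi * \<delta>) powr (- real DIM('a) / 2)"
  have C0: "0 \<le> C" using order_trans[OF abs_ge_zero bdd] .
  have fm: "(\<lambda>x. f (a x) (b x)) \<in> borel_measurable N" if "a \<in> borel_measurable N" "b \<in> borel_measurable N" for a b and N :: "'n measure"
    using measurable_compose[OF borel_measurable_Pair[OF that] f] by simp
  have fst_m: "fst \<in> borel_measurable (borel :: ('a \<times> 'a) measure)" and snd_m: "snd \<in> borel_measurable (borel :: ('a \<times> 'a) measure)"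
    by (auto simp: borel_prod[symmetric])
  note fst_m[measurable] snd_m[measurable]
  define F where "F w = f (x1 + s1 *\<^sub>R fst w) (x2 + s2 *\<^sub>R snd w) * gauss \<delta> (separation w)" for w
  have Fm[measurable]: "F \<in> borel_measurable borel"
    unfolding F_def by (intro borel_measurable_times fm) measurable
  have Fb: "\<bar>F w\<bar> \<le> C * ?L" for w
    unfolding F_def abs_mult using gauss_le[OF \<delta>, of "separation w"] by (intro mult_mono bdd C0) auto
  have "expectation (\<lambda>\<omega>. F (W t \<omega>)) = (LINT z|std_gauss. F (sqrt t *\<^sub>R z))"
    by (rule W_law[OF Fm Fb]) (use t in simp)
  also have "\<dots> = (LINT z1|std_gauss. LINT z2|std_gauss. F (sqrt t *\<^sub>R (z1, z2)))"
    by (rule integral_std_gauss_Pair(1)[OF _ Fb]) measurable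
  also have "\<dots> = (LINT z1|std_gauss. LINT z2|std_gauss. ?R (z1, z2))"
  proof (rule Bochner_Integration.integral_cong[OF refl])
    fix z1 :: 'a
    define X where "X = x1 + (s1 * sqrt t) *\<^sub>R z1"
    define c where "c = s2 * sqrt t"
    have c: "c \<noteq> 0" "c\<^sup>2 = s2\<^sup>2 * t" using s_pos t by (auto simp: c_def power_mult_distrib)
    have fXm[measurable]: "(\<lambda>v. f X v) \<in> borel_measurable borel" by (rule fm) measurable
    have "(LINT z2|std_gauss. F (sqrt t *\<^sub>R (z1, z2))) = (LINT z2|std_gauss. f X (x2 + c *\<^sub>R z2) * gauss \<delta> (X - (x2 + c *\<^sub>R z2)))"
      by (intro Bochner_Integration.integral_cong) (auto simp: F_def X_def c_def separation_def algebra_simps)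
    also have "\<dots> = (LINT v|lborel. gauss (c\<^sup>2) (v - x2) * (f X v * gauss \<delta> (X - v)))"
      by (rule integral_std_gauss_affine[OF _ c(1)]) measurable
    \<comment> \<open>The two Gaussian factors exchange roles: the kernel becomes the sampling law,
      the law of the second particle becomes part of the integrand.\<close>
    also have "\<dots> = (LINT v|lborel. gauss ((sqrt \<delta>)\<^sup>2) (v - X) * (gauss (c\<^sup>2) (v - x2) * f X v))"
    proof (rule Bochner_Integration.integral_cong[OF refl])
      fix v
      have "gauss \<delta> (X - v) = gauss \<delta> (v - X)" using gauss_uminus[of \<delta> "v - X"] by simp
      then show "gauss (c\<^sup>2) (v - x2) * (f X v * gauss \<delta> (X - v)) = gauss ((sqrt \<delta>)\<^sup>2) (v - X) * (gauss (c\<^sup>2) (v - x2) * f X v)"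
        using \<delta> by simp
    qed
    also have "\<dots> = (LINT z|std_gauss. gauss (c\<^sup>2) (X + sqrt \<delta> *\<^sub>R z - x2) * f X (X + sqrt \<delta> *\<^sub>R z))"
      by (rule integral_std_gauss_affine[symmetric]) (use \<delta> in auto)
    finally show "(LINT z2|std_gauss. F (sqrt t *\<^sub>R (z1, z2))) = (LINT z2|std_gauss. ?R (z1, z2))"
      by (simp add: X_def c(2))
  qed
  also have "\<dots> = (LINT z|std_gauss. ?R z)"
  proof (rule integral_std_gauss_Pair(1)[symmetric, where C="(2 * pi * (s2\<^sup>2 * t)) powr (- real DIM('a) / 2) * C"])
    show "?R \<in> borel_measurable borel" by (intro borel_measurable_times fm) measurable
    show "\<bar>?R z\<bar> \<le> (2 * pi * (s2\<^sup>2 * t)) powr (- real DIM('a) / 2) * C" for z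
      unfolding abs_mult using gauss_le[of "s2\<^sup>2 * t", where 'a='a] s_pos t by (intro mult_mono bdd) auto
  qed
  finally show ?thesis by (simp add: F_def)
qed

text \<open>Dominated convergence, first over the displacement of the two particles and then over
  time. After \<open>pair_gauss_eq\<close> the integrand is continuous in the displacement, and a
  support starting at \<open>t0\<close> > 0 supplies the constant bound.\<close>

lemma occupation_limit:
  fixes g :: "real \<times> 'a \<Rightarrow> real" and \<delta> :: "nat \<Rightarrow> real"
  assumes g: "continuous_on UNIV g" and G: "\<And>p. \<bar>g p\<bar> \<le> G" and supp: "\<And>t z. t \<notin> {t0..t1} \<Longrightarrow> g (t, z) = 0"
    and t0: "0 < t0" and K: "t1 < K" "0 \<le> K" and \<delta>: "\<And>n. \<delta> n > 0" "\<delta> \<longlonglongrightarrow> 0"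
  shows "(\<lambda>n. LINT t|time_measure K. expectation (\<lambda>\<omega>. g (t, center (W (max 0 t) \<omega>)) * gauss (\<delta> n) (separation (W (max 0 t) \<omega>))))
    \<longlonglongrightarrow> (LINT t:{t0..t1}|lborel. LINT z|lborel. gauss (s1\<^sup>2 * t) (z - x1) * gauss (s2\<^sup>2 * t) (z - x2) * g (t, z))"
proof -
  have G0: "0 \<le> G" using order_trans[OF abs_ge_zero G] .
  interpret T: finite_measure "time_measure K" by (rule finite_time_measure)
  interpret gs: prob_space "std_gauss :: ('a \<times> 'a) measure" by (rule prob_space_std_gauss)
  interpret ga: prob_space "std_gauss :: 'a measure" by (rule prob_space_std_gauss)
  have gm: "g \<in> borel_measurable borel" using g by (rule borel_measurable_continuous_onI)
  define e where "e n t = expectation (\<lambda>\<omega>. g (t, center (W (max 0 t) \<omega>)) * gauss (\<delta> n) (separation (W (max 0 t) \<omega>)))" for n t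
  define f where "f t = (LINT z|lborel. gauss (s1\<^sup>2 * t) (z - x1) * gauss (s2\<^sup>2 * t) (z - x2) * g (t, z))" for t
  \<comment> \<open>The height of the density of the second particle at all times from
    \<open>t0\<close> on.\<close>
  define B where "B = (2 * pi * (s2\<^sup>2 * t0)) powr (- real DIM('a) / 2)"
  have B0: "0 \<le> B" by (simp add: B_def)
  define mix where "mix u v = (y1 *\<^sub>R u + y2 *\<^sub>R v) /\<^sub>R (y1 + y2)" for u v :: 'a
  have mix_same: "mix u u = u" for u using y_pos by (simp add: mix_def scaleR_add_left[symmetric])
  have center_mix: "center w = mix (x1 + s1 *\<^sub>R fst w) (x2 + s2 *\<^sub>R snd w)" for w by (simp add: center_def mix_def)
  have mixc: "continuous_on S (\<lambda>p. mix (a p) (b p))" if "continuous_on S a" "continuous_on S b" for S :: "'n::topological_space set" and a b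
    unfolding mix_def using that by (intro continuous_intros)
  have small: "e n t = 0" "f t = 0" if "t \<notin> {t0..t1}" for n t
    using supp[OF that] by (simp_all add: e_def f_def)
  \<comment> \<open>\<open>d\<close> is the standard deviation of the displacement,
    \<open>sqrt (\<delta> n)\<close> before the limit. At \<open>d\<close> = 0 both particles sit at
    one point, which is then also their weighted mean.\<close>
  define \<Psi> where "\<Psi> t d z = gauss (s2\<^sup>2 * t) (x1 + (s1 * sqrt t) *\<^sub>R fst z + d *\<^sub>R snd z - x2) * g (t, mix (x1 + (s1 * sqrt t) *\<^sub>R fst z) (x1 + (s1 * sqrt t) *\<^sub>R fst z + d *\<^sub>R snd z))"
    for t d and z :: "'a \<times> 'a"
  have e_eq: "e n t = (LINT z|std_gauss. \<Psi> t (sqrt (\<delta> n)) z)" if t: "0 < t" for n t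
  proof -
    have mg: "(\<lambda>p. (\<lambda>u v. g (t, mix u v)) (fst p) (snd p)) \<in> borel_measurable borel"
      by (intro borel_measurable_continuous_onI continuous_on_compose2[OF g] continuous_intros mixc) auto
    show ?thesis
      using pair_gauss_eq[OF t \<delta>(1) mg G] t by (simp add: e_def \<Psi>_def center_mix max_def)
  qed
  have \<Psi>b: "\<bar>\<Psi> t d z\<bar> \<le> B * G" if "t0 \<le> t" for t d z
  proof -
    have "gauss (s2\<^sup>2 * t) v \<le> B" for v :: 'a
      unfolding B_def by (rule gauss_le_mono) (use that t0 s_pos in auto)
    then show ?thesis unfolding \<Psi>_def abs_mult using G0 B0 by (intro mult_mono G) auto
  qed
  have \<Psi>c: "continuous_on UNIV (\<lambda>p. \<Psi> t (fst p) (snd p))" if "0 < t" for t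
    unfolding \<Psi>_def using that s_pos
    by (intro continuous_intros continuous_on_compose2[OF g] mixc) auto
  have f_eq: "f t = (LINT z|std_gauss. \<Psi> t 0 z)" if t: "t0 \<le> t" for t
  proof -
    have t': "0 < t" using t t0 by simp
    define c where "c = s1 * sqrt t"
    have c: "c \<noteq> 0" "c\<^sup>2 = s1\<^sup>2 * t" using s_pos t' by (auto simp: c_def power_mult_distrib)
    have "(LINT z|std_gauss. \<Psi> t 0 z) = (LINT z1|std_gauss. LINT z2|std_gauss. \<Psi> t 0 (z1, z2))"
    proof (rule integral_std_gauss_Pair(1)[OF _ \<Psi>b[OF t]])
      have "continuous_on UNIV (\<lambda>z. \<Psi> t 0 z)"
        using continuous_on_compose2[OF \<Psi>c[OF t'], of UNIV "\<lambda>z. (0, z)"] by (simp add: continuous_on_Pair)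
      then show "\<Psi> t 0 \<in> borel_measurable borel" by (rule borel_measurable_continuous_onI)
    qed
    also have "\<dots> = (LINT z1|std_gauss. gauss (s2\<^sup>2 * t) (x1 + c *\<^sub>R z1 - x2) * g (t, x1 + c *\<^sub>R z1))"
      using ga.prob_space by (simp add: \<Psi>_def mix_same c_def)
    also have "\<dots> = (LINT v|lborel. gauss (c\<^sup>2) (v - x1) * (gauss (s2\<^sup>2 * t) (v - x2) * g (t, v)))"
    proof (rule integral_std_gauss_affine[OF _ c(1)])
      have "(\<lambda>v. g (t, v)) \<in> borel_measurable borel"
        by (intro borel_measurable_continuous_onI continuous_on_compose2[OF g] continuous_intros) auto
      then show "(\<lambda>v. gauss (s2\<^sup>2 * t) (v - x2) * g (t, v)) \<in> borel_measurable borel" by measurable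
    qed
    finally show ?thesis by (simp add: f_def c(2) mult.assoc)
  qed
  have e_b: "\<bar>e n t\<bar> \<le> B * G" for n t
  proof (cases "t \<in> {t0..t1}")
    case True
    then show ?thesis using t0 unfolding e_eq[of t n, OF less_le_trans[of 0 t0 t]]
      by (subst e_eq) (auto intro!: gs.expectation_abs_le \<Psi>b)
  qed (use small B0 G0 in simp)
  have lim: "(\<lambda>n. e n t) \<longlonglongrightarrow> f t" for t
  proof (cases "t \<in> {t0..t1}")
    case True
    then have t: "t0 \<le> t" "0 < t" using t0 by auto
    have "(\<lambda>n. LINT z|std_gauss. \<Psi> t (sqrt (\<delta> n)) z) \<longlonglongrightarrow> (LINT z|std_gauss. \<Psi> t 0 z)"
    proof (rule integral_dominated_convergence[where w="\<lambda>_. B * G"])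
      have cz: "continuous_on UNIV (\<lambda>z. \<Psi> t d z)" for d
        using continuous_on_compose2[OF \<Psi>c[OF t(2)], of UNIV "\<lambda>z. (d, z)"] by (simp add: continuous_on_Pair)
      have "\<Psi> t d \<in> borel_measurable borel" for d using cz by (rule borel_measurable_continuous_onI)
      then show "\<Psi> t 0 \<in> borel_measurable std_gauss" "\<And>n. \<Psi> t (sqrt (\<delta> n)) \<in> borel_measurable std_gauss" by auto
      show "AE z in std_gauss. (\<lambda>n. \<Psi> t (sqrt (\<delta> n)) z) \<longlonglongrightarrow> \<Psi> t 0 z"
      proof (rule AE_I2)
        fix z :: "'a \<times> 'a"
        have "(\<lambda>n. sqrt (\<delta> n)) \<longlonglongrightarrow> sqrt 0" by (intro tendsto_intros \<delta>)
        then have "(\<lambda>n. (sqrt (\<delta> n), z)) \<longlonglongrightarrow> (0, z)" by (intro tendsto_Pair) auto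
        from continuous_on_tendsto_compose[OF \<Psi>c[OF t(2)] this] show "(\<lambda>n. \<Psi> t (sqrt (\<delta> n)) z) \<longlonglongrightarrow> \<Psi> t 0 z" by simp
      qed
      show "AE z in std_gauss. norm (\<Psi> t (sqrt (\<delta> n)) z) \<le> B * G" for n using \<Psi>b[OF t(1)] by simp
    qed simp
    then show ?thesis using f_eq[OF t(1)] e_eq[OF t(2)] by simp
  qed (use small in simp)
  have em: "e n \<in> borel_measurable borel" for n
  proof -
    define \<phi> where "\<phi> = (\<lambda>p :: real \<times> ('a \<times> 'a). g (fst p, center (snd p)) * gauss (\<delta> n) (separation (snd p)))"
    have \<phi>c: "continuous_on UNIV \<phi>" unfolding \<phi>_def
      by (intro continuous_intros continuous_on_compose2[OF g] \<delta>) auto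
    have \<phi>b: "\<bar>\<phi> p\<bar> \<le> G * (2 * pi * \<delta> n) powr (- real DIM('a) / 2)" for p unfolding \<phi>_def abs_mult 
      using gauss_le[OF \<delta>(1), of n "separation (snd p)"] by (intro mult_mono G G0) auto
    \<comment> \<open>The constant stopping time 0 serves here only to reach the measurability
      statement of the decomposition.\<close>
    have "{\<omega> \<in> space M. (0::real) \<le> s} \<in> sets (Fil s)" if "0 \<le> s" for s
      using that sets.top[of "Fil s"] space_Fil[OF that] by simp
    from occupation_decomposition(1)[OF this _ \<phi>c \<phi>b] show ?thesis
      by (simp add: \<phi>_def e_def[abs_def])
  qed
  have fm: "f \<in> borel_measurable borel"
    by (rule borel_measurable_LIMSEQ_metric[OF em lim])
  have "(\<lambda>n. LINT t|time_measure K. e n t) \<longlonglongrightarrow> (LINT t|time_measure K. f t)"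
    by (rule integral_dominated_convergence[where w="\<lambda>_. B * G"]) (use em fm lim e_b in auto)
  also have "(LINT t|time_measure K. f t) = (LINT t:{t0..t1}|lborel. f t)"
    unfolding integral_time_measure[OF fm] set_lebesgue_integral_def
    using small t0 K by (intro Bochner_Integration.integral_cong) (auto simp: indicator_def)
  finally show ?thesis unfolding e_def f_def .
qed

end

section \<open>The collision limit\<close>

text \<open>The lower bound on \<open>r\<close> makes N r^2 exceed N^(1 - 2 \<alpha>), a positive
  power because \<alpha> < 1/2, so a large \<open>q\<close> outweighs both the factor N and
  r^(-D).\<close>

lemma chain_bound_limit:
  fixes r :: "nat \<Rightarrow> real"
  assumes \<alpha>: "\<alpha> < 1 / 2" and r: "\<And>N. N \<ge> 1 \<Longrightarrow> r N > 0" "\<And>N. N \<ge> 1 \<Longrightarrow> r N > real N powr (- \<alpha>)" and D: "D \<ge> 0"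
    and q: "real q * (1 - 2 * \<alpha>) > \<alpha> * D + 1"
  shows "(\<lambda>N. r N powr (- D) * (real N / (real N * (r N)\<^sup>2) ^ q)) \<longlonglongrightarrow> 0"
proof (rule tendsto_sandwich[where f="\<lambda>_. 0" and h="\<lambda>N. real N powr (\<alpha> * D + 1 - real q * (1 - 2 * \<alpha>))"])
  have "((\<lambda>x. x powr (\<alpha> * D + 1 - real q * (1 - 2 * \<alpha>))) \<longlongrightarrow> 0) at_top"
    using q by (intro tendsto_neg_powr filterlim_ident) auto
  then show "(\<lambda>N. real N powr (\<alpha> * D + 1 - real q * (1 - 2 * \<alpha>))) \<longlonglongrightarrow> 0"
    by (rule filterlim_compose[OF _ filterlim_real_sequentially])
  show "eventually (\<lambda>N. r N powr (- D) * (real N / (real N * (r N)\<^sup>2) ^ q) \<le> real N powr (\<alpha> * D + 1 - real q * (1 - 2 * \<alpha>))) sequentially"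
    using eventually_ge_at_top[of 1]
  proof eventually_elim
    case (elim N)
    have N: "real N > 0" using elim by simp
    have "r N powr (- D) \<le> (real N powr (- \<alpha>)) powr (- D)"
      using r[OF elim] N D by (intro powr_mono2') auto
    also have "\<dots> = real N powr (\<alpha> * D)" by (simp add: powr_powr)
    finally have 1: "r N powr (- D) \<le> real N powr (\<alpha> * D)" .
    have "real N powr (1 - 2 * \<alpha>) = real N * (real N powr (- \<alpha>))\<^sup>2"
    proof -
      have "(real N powr (- \<alpha>))\<^sup>2 = real N powr (- 2 * \<alpha>)" using N by (simp add: powr_power)
      then show ?thesis using N by (simp add: powr_diff powr_minus divide_inverse)
    qed
    also have "\<dots> \<le> real N * (r N)\<^sup>2" using r[OF elim] N by (intro mult_left_mono power_mono) auto
    finally have "(real N powr (1 - 2 * \<alpha>)) ^ q \<le> (real N * (r N)\<^sup>2) ^ q" by (intro power_mono) auto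
    moreover have "(real N powr (1 - 2 * \<alpha>)) ^ q = real N powr (real q * (1 - 2 * \<alpha>))" using N by (simp add: powr_power mult.commute)
    ultimately have "real N / (real N * (r N)\<^sup>2) ^ q \<le> real N / real N powr (real q * (1 - 2 * \<alpha>))"
      using N r[OF elim] by (intro divide_left_mono) auto
    then have "r N powr (- D) * (real N / (real N * (r N)\<^sup>2) ^ q) \<le> real N powr (\<alpha> * D) * (real N / real N powr (real q * (1 - 2 * \<alpha>)))"
      using 1 N by (intro mult_mono) auto
    also have "\<dots> = real N powr (\<alpha> * D + 1 - real q * (1 - 2 * \<alpha>))"
      using N by (simp add: powr_add powr_diff)
    finally show ?case .
  qed
  show "eventually (\<lambda>N. 0 \<le> r N powr (- D) * (real N / (real N * (r N)\<^sup>2) ^ q)) sequentially"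
    by simp
qed simp

section \<open>Ornstein-Uhlenbeck positions as functionals of the driving pair\<close>

locale ou_pair = brownian_pair M Fil W x1 x2 "b1 / l1" "b2 / l2" y1 y2
  for M :: "'w measure" and Fil and W :: "real \<Rightarrow> 'w \<Rightarrow> 'a::euclidean_space \<times> 'a" and x1 x2 :: 'a and b1 l1 b2 l2 y1 y2 :: real +
  assumes l_pos: "l1 > 0" "l2 > 0"
begin

lemma b_pos: "b1 > 0" "b2 > 0" using s_pos l_pos by (simp_all add: zero_less_divide_iff)

text \<open>The explicit solution as a functional of \<open>W\<close> alone: continuous for every
  outcome and adapted to \<open>Fil\<close>. The given positions need to agree with it only almost
  surely.\<close>

definition pos1 :: "nat \<Rightarrow> real \<Rightarrow> 'w \<Rightarrow> 'a" where
  "pos1 N t \<omega> = x1 + (real N * b1) *\<^sub>R memory (real N * l1) (\<lambda>s. fst (W s \<omega>)) t"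

definition pos2 :: "nat \<Rightarrow> real \<Rightarrow> 'w \<Rightarrow> 'a" where
  "pos2 N t \<omega> = x2 + (real N * b2) *\<^sub>R memory (real N * l2) (\<lambda>s. snd (W s \<omega>)) t"

lemma W_components_continuous:
  assumes "\<omega> \<in> space M"
  shows "continuous_on {0..} (\<lambda>s. fst (W s \<omega>))" "continuous_on {0..} (\<lambda>s. snd (W s \<omega>))"
  using cont[OF assms] by (auto intro: continuous_intros)

lemma pos_continuous:
  assumes "\<omega> \<in> space M"
  shows "continuous_on {0..} (\<lambda>t. pos1 N t \<omega>)" "continuous_on {0..} (\<lambda>t. pos2 N t \<omega>)"
  unfolding pos1_def pos2_def using W_components_continuous[OF assms]
  by (auto intro!: continuous_intros memory_continuous)

lemma W_components_adapted:
  assumes "0 \<le> u" "u \<le> s"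
  shows "(\<lambda>\<omega>. fst (W u \<omega>)) \<in> borel_measurable (Fil s)" "(\<lambda>\<omega>. snd (W u \<omega>)) \<in> borel_measurable (Fil s)"
  using adapted[OF assms] by (auto simp: borel_prod[symmetric])

lemma pos_adapted:
  assumes u: "0 \<le> u" "u \<le> s"
  shows "pos1 N u \<in> borel_measurable (Fil s)" "pos2 N u \<in> borel_measurable (Fil s)"
proof -
  have s: "0 \<le> s" using u by simp
  have "(\<lambda>\<omega>. memory (real N * l1) (\<lambda>s. fst (W s \<omega>)) u) \<in> borel_measurable (Fil s)"
    using u by (intro memory_measurable W_components_adapted W_components_continuous) (auto simp: space_Fil[OF s])
  then show "pos1 N u \<in> borel_measurable (Fil s)" unfolding pos1_def by measurable
  have "(\<lambda>\<omega>. memory (real N * l2) (\<lambda>s. snd (W s \<omega>)) u) \<in> borel_measurable (Fil s)"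
    using u by (intro memory_measurable W_components_adapted W_components_continuous) (auto simp: space_Fil[OF s])
  then show "pos2 N u \<in> borel_measurable (Fil s)" unfolding pos2_def by measurable
qed

lemma pos_measurable:
  assumes "0 \<le> u"
  shows "pos1 N u \<in> borel_measurable M" "pos2 N u \<in> borel_measurable M"
  using measurable_FilD[OF assms pos_adapted(1)] measurable_FilD[OF assms pos_adapted(2)] assms by auto

lemma pos_zero [simp]: "pos1 N 0 \<omega> = x1" "pos2 N 0 \<omega> = x2"
  by (simp_all add: pos1_def pos2_def memory_def)

text \<open>19 comes from \<open>chain_event_modulus\<close>, the factors 1 + 1 / l from
  \<open>memory_close\<close>, and b / l from the scaling of the noise; the two particles are added
  to have one constant for both.\<close>

definition lag_const :: real where
  "lag_const = 19 * (b1 / l1 * (1 + 1 / l1) + b2 / l2 * (1 + 1 / l2))"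

lemma lag_const_pos: "lag_const > 0"
  using b_pos l_pos by (simp add: lag_const_def add_pos_pos)

text \<open>The modulus has slope \<open>N\<close> and the relaxation rate is \<open>N\<close> times
  l, so in \<open>memory_close\<close> the ratio does not depend on \<open>N\<close>.\<close>

lemma pos_close:
  assumes \<omega>: "\<omega> \<in> chain_event K N \<mu>" and N: "N \<ge> 1" and \<mu>: "\<mu> > 0" and t: "0 \<le> t" "t \<le> real K"
  shows "norm (pos1 N t \<omega> - (x1 + (b1 / l1) *\<^sub>R fst (W t \<omega>))) \<le> lag_const * \<mu>"
    and "norm (pos2 N t \<omega> - (x2 + (b2 / l2) *\<^sub>R snd (W t \<omega>))) \<le> lag_const * \<mu>"
proof -
  have \<omega>M: "\<omega> \<in> space M" using \<omega> by (simp add: chain_event_def)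
  have "norm (fst (W t \<omega>) - fst (W s \<omega>)) \<le> 19 * \<mu> * (1 + real N * (t - s))" "norm (snd (W t \<omega>) - snd (W s \<omega>)) \<le> 19 * \<mu> * (1 + real N * (t - s))"
    if "0 \<le> s" "s \<le> t" for s
  proof -
    have "norm (fst p) \<le> norm p" "norm (snd p) \<le> norm p" for p :: "'a \<times> 'a"
      using norm_fst_le[of "fst p" "snd p"] norm_snd_le[of "snd p" "fst p"] by simp_all
    from this[of "W t \<omega> - W s \<omega>"] show "norm (fst (W t \<omega>) - fst (W s \<omega>)) \<le> 19 * \<mu> * (1 + real N * (t - s))" 
      "norm (snd (W t \<omega>) - snd (W s \<omega>)) \<le> 19 * \<mu> * (1 + real N * (t - s))"
      using chain_event_modulus[OF \<omega> N \<mu> that t(2)] by simp_all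
  qed
  note mod = this
  have key: "norm ((real N * b) *\<^sub>R memory (real N * l) w t - (b / l) *\<^sub>R w t) \<le> lag_const * \<mu>"
    if w: "continuous_on {0..} w" "w 0 = 0" "\<And>s. 0 \<le> s \<Longrightarrow> s \<le> t \<Longrightarrow> norm (w t - w s) \<le> 19 * \<mu> * (1 + real N * (t - s))"
      and bl: "b > 0" "l > 0" and le: "19 * (b / l * (1 + 1 / l)) \<le> lag_const" for w :: "real \<Rightarrow> 'a" and b l
  proof -
    have Np: "real N > 0" using N by simp
    have "norm ((real N * l) *\<^sub>R memory (real N * l) w t - w t) \<le> (19 * \<mu>) * (1 + real N / (real N * l))"
      using w t bl \<mu> Np by (intro memory_close) (auto intro: continuous_on_subset)
    also have "real N / (real N * l) = 1 / l" using Np by simp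
    finally have m: "norm ((real N * l) *\<^sub>R memory (real N * l) w t - w t) \<le> (19 * \<mu>) * (1 + 1 / l)" .
    have "(real N * b) *\<^sub>R memory (real N * l) w t - (b / l) *\<^sub>R w t = (b / l) *\<^sub>R ((real N * l) *\<^sub>R memory (real N * l) w t - w t)"
      using bl by (simp add: scaleR_diff_right)
    then have "norm ((real N * b) *\<^sub>R memory (real N * l) w t - (b / l) *\<^sub>R w t) = (b / l) * norm ((real N * l) *\<^sub>R memory (real N * l) w t - w t)"
      using bl by (simp only: norm_scaleR) simp
    also have "\<dots> \<le> (b / l) * ((19 * \<mu>) * (1 + 1 / l))" using m bl by (intro mult_left_mono) auto
    also have "\<dots> = 19 * (b / l * (1 + 1 / l)) * \<mu>" by simp
    also have "\<dots> \<le> lag_const * \<mu>" using le \<mu> by (intro mult_right_mono) auto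
    finally show ?thesis .
  qed
  have W0: "fst (W 0 \<omega>) = 0" "snd (W 0 \<omega>) = 0" using start[OF \<omega>M] by simp_all
  have le: "19 * (b1 / l1 * (1 + 1 / l1)) \<le> lag_const" "19 * (b2 / l2 * (1 + 1 / l2)) \<le> lag_const"
    using b_pos l_pos by (simp_all add: lag_const_def)
  show "norm (pos1 N t \<omega> - (x1 + (b1 / l1) *\<^sub>R fst (W t \<omega>))) \<le> lag_const * \<mu>"
    using key[OF W_components_continuous(1)[OF \<omega>M] W0(1) mod(1) b_pos(1) l_pos(1) le(1)] by (simp add: pos1_def)
  show "norm (pos2 N t \<omega> - (x2 + (b2 / l2) *\<^sub>R snd (W t \<omega>))) \<le> lag_const * \<mu>"
    using key[OF W_components_continuous(2)[OF \<omega>M] W0(2) mod(2) b_pos(2) l_pos(2) le(2)] by (simp add: pos2_def)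
qed

definition hit :: "real \<Rightarrow> real \<Rightarrow> nat \<Rightarrow> 'w \<Rightarrow> real" where
  "hit K \<rho> N \<omega> = hit_time K \<rho> (\<lambda>t. pos1 N t \<omega> - pos2 N t \<omega>)"

definition hit_value :: "(real \<times> 'a \<Rightarrow> real) \<Rightarrow> real \<Rightarrow> real \<Rightarrow> nat \<Rightarrow> 'w \<Rightarrow> real" where
  "hit_value g K \<rho> N \<omega> = g (hit K \<rho> N \<omega>, (y1 *\<^sub>R pos1 N (hit K \<rho> N \<omega>) \<omega> + y2 *\<^sub>R pos2 N (hit K \<rho> N \<omega>) \<omega>) /\<^sub>R (y1 + y2))"

lemma gap_continuous: "\<omega> \<in> space M \<Longrightarrow> continuous_on {0..} (\<lambda>t. pos1 N t \<omega> - pos2 N t \<omega>)"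
  by (intro continuous_intros pos_continuous)

lemma hit_stopping:
  assumes "0 \<le> s" "0 \<le> K"
  shows "{\<omega> \<in> space M. hit K \<rho> N \<omega> \<le> s} \<in> sets (Fil s)"
proof -
  have "{\<omega> \<in> space (Fil s). hit_time K \<rho> (\<lambda>t. pos1 N t \<omega> - pos2 N t \<omega>) \<le> s} \<in> sets (Fil s)"
    using assms by (intro hit_time_event borel_measurable_diff pos_adapted gap_continuous) (auto simp: space_Fil)
  then show ?thesis using assms by (simp add: hit_def space_Fil)
qed

lemma hit_bounds:
  assumes "\<omega> \<in> space M" "0 \<le> K"
  shows "0 \<le> hit K \<rho> N \<omega>" "hit K \<rho> N \<omega> \<le> K"
  unfolding hit_def using hit_time_bounds[OF gap_continuous[OF assms(1)] assms(2)] by auto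

lemma hit_value_measurable:
  assumes g: "continuous_on UNIV g" and K: "0 \<le> K"
  shows "hit_value g K \<rho> N \<in> borel_measurable M"
proof -
  have hm[measurable]: "hit K \<rho> N \<in> borel_measurable M"
    by (rule stopping_measurable[OF hit_stopping hit_bounds(1)]) (use K in auto)
  have [measurable]: "(\<lambda>\<omega>. pos1 N (hit K \<rho> N \<omega>) \<omega>) \<in> borel_measurable M" "(\<lambda>\<omega>. pos2 N (hit K \<rho> N \<omega>) \<omega>) \<in> borel_measurable M"
    using K by (auto intro!: process_stopped_measurable hm pos_continuous hit_bounds pos_measurable)
  have gm: "g \<in> borel_measurable borel" using g by (rule borel_measurable_continuous_onI)
  have "(\<lambda>\<omega>. (hit K \<rho> N \<omega>, (y1 *\<^sub>R pos1 N (hit K \<rho> N \<omega>) \<omega> + y2 *\<^sub>R pos2 N (hit K \<rho> N \<omega>) \<omega>) /\<^sub>R (y1 + y2))) \<in> borel_measurable M"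
    by (rule borel_measurable_Pair) measurable
  from measurable_compose[OF this gm] show ?thesis unfolding hit_value_def .
qed

lemma mix_close:
  assumes "norm (u - (x1 + (b1 / l1) *\<^sub>R fst w)) \<le> c" "norm (v - (x2 + (b2 / l2) *\<^sub>R snd w)) \<le> c"
  shows "norm ((y1 *\<^sub>R u + y2 *\<^sub>R v) /\<^sub>R (y1 + y2) - center w) \<le> c"
proof -
  have "(y1 *\<^sub>R u + y2 *\<^sub>R v) /\<^sub>R (y1 + y2) - center w = 
    (y1 / (y1 + y2)) *\<^sub>R (u - (x1 + (b1 / l1) *\<^sub>R fst w)) + (y2 / (y1 + y2)) *\<^sub>R (v - (x2 + (b2 / l2) *\<^sub>R snd w))"
  proof -
    have "(y1 *\<^sub>R u + y2 *\<^sub>R v) /\<^sub>R Y - (y1 *\<^sub>R p + y2 *\<^sub>R q) /\<^sub>R Y = (y1 / Y) *\<^sub>R (u - p) + (y2 / Y) *\<^sub>R (v - q)" for p q Y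
      by (simp add: algebra_simps divide_inverse)
    then show ?thesis unfolding center_def .
  qed
  also have "norm \<dots> \<le> norm ((y1 / (y1 + y2)) *\<^sub>R (u - (x1 + (b1 / l1) *\<^sub>R fst w))) + norm ((y2 / (y1 + y2)) *\<^sub>R (v - (x2 + (b2 / l2) *\<^sub>R snd w)))"
    by (rule norm_triangle_ineq)
  also have "\<dots> = (y1 / (y1 + y2)) * norm (u - (x1 + (b1 / l1) *\<^sub>R fst w)) + (y2 / (y1 + y2)) * norm (v - (x2 + (b2 / l2) *\<^sub>R snd w))"
    using y_pos by (simp only: norm_scaleR) simp
  also have "\<dots> \<le> (y1 / (y1 + y2)) * c + (y2 / (y1 + y2)) * c"
    using assms y_pos by (intro add_mono mult_left_mono) auto
  also have "\<dots> = (y1 / (y1 + y2) + y2 / (y1 + y2)) * c" by (rule distrib_right[symmetric])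
  also have "y1 / (y1 + y2) + y2 / (y1 + y2) = 1" using y_pos by (simp add: add_divide_distrib[symmetric])
  finally show ?thesis by simp
qed

end

section \<open>Choice of the parameters and passage to the limit\<close>

context ou_pair begin

text \<open>A threshold proportional to r is far above the typical increment N^(-1/2), so the bad
  event stays negligible even after multiplication by the largest powers of 1 / r that the kernel
  produces.\<close>

lemma chain_complement_prob:
  fixes r :: "nat \<Rightarrow> real"
  assumes \<alpha>: "\<alpha> < 1 / 2" and r: "\<And>N. N \<ge> 1 \<Longrightarrow> r N > 0" "\<And>N. N \<ge> 1 \<Longrightarrow> r N > real N powr (- \<alpha>)" and D: "D \<ge> 0" and c: "c > 0"
  shows "(\<lambda>N. r N powr (- D) * prob (space M - chain_event K N (c * r N))) \<longlonglongrightarrow> 0"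
proof -
  \<comment> \<open>The order of the tail bound must exceed this ratio for
    \<open>chain_bound_limit\<close>, and be at least 3 for \<open>chain_event_prob\<close>.\<close>
  obtain q0 :: nat where q0: "real q0 > (\<alpha> * D + 1) / (1 - 2 * \<alpha>)" using reals_Archimedean2 by blast
  define q where "q = max 3 q0"
  have "real q > (\<alpha> * D + 1) / (1 - 2 * \<alpha>)" using q0 by (simp add: q_def)
  then have q: "q \<ge> 3" "real q * (1 - 2 * \<alpha>) > \<alpha> * D + 1"
    using \<alpha> by (simp_all add: q_def pos_divide_less_eq)
  define C where "C = 2 * (real K * 2 powr (real DIM('a \<times> 'a) / 2) * fact q * 4 ^ q / (c\<^sup>2) ^ q)"
  have lim: "(\<lambda>N. C * (r N powr (- D) * (real N / (real N * (r N)\<^sup>2) ^ q))) \<longlonglongrightarrow> 0"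
    using tendsto_mult_right_zero[OF chain_bound_limit[OF \<alpha> r D q(2)], of C] by simp
  show ?thesis
  proof (rule tendsto_sandwich[OF _ _ tendsto_const lim])
    show "eventually (\<lambda>N. r N powr (- D) * prob (space M - chain_event K N (c * r N)) \<le> C * (r N powr (- D) * (real N / (real N * (r N)\<^sup>2) ^ q))) sequentially"
      using eventually_ge_at_top[of 1]
    proof eventually_elim
      case (elim N)
      have rp: "r N > 0" using r elim by simp
      have "prob (space M - chain_event K N (c * r N)) \<le> 2 * (real K * real N * 2 powr (real DIM('a \<times> 'a) / 2) * fact q * 4 ^ q / (real N * (c * r N)\<^sup>2) ^ q)"
        using c rp q elim by (intro chain_event_prob) auto
      also have "\<dots> = C * (real N / (real N * (r N)\<^sup>2) ^ q)"
      proof -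
        have "(real N * (c * r N)\<^sup>2) ^ q = (c\<^sup>2) ^ q * (real N * (r N)\<^sup>2) ^ q"
          by (simp add: power_mult_distrib mult_ac)
        then show ?thesis by (simp add: C_def)
      qed
      finally have "r N powr (- D) * prob (space M - chain_event K N (c * r N)) \<le> r N powr (- D) * (C * (real N / (real N * (r N)\<^sup>2) ^ q))"
        by (intro mult_left_mono) auto
      then show ?case by (simp only: mult.left_commute)
    qed
    show "eventually (\<lambda>N. 0 \<le> r N powr (- D) * prob (space M - chain_event K N (c * r N))) sequentially" by simp
  qed
qed

lemma kernel_scale:
  assumes "\<epsilon> > 0" "r > 0"
  shows "(2 * pi * (\<epsilon> * r)\<^sup>2) powr (- real DIM('a) / 2) = (2 * pi * \<epsilon>\<^sup>2) powr (- real DIM('a) / 2) * r powr (- real DIM('a))"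
proof -
  have "(2 * pi * (\<epsilon> * r)\<^sup>2) powr (- real DIM('a) / 2) = (2 * pi * \<epsilon>\<^sup>2) powr (- real DIM('a) / 2) * (r\<^sup>2) powr (- real DIM('a) / 2)"
    using assms by (subst powr_mult[symmetric]) (auto simp: power_mult_distrib mult_ac)
  also have "(r\<^sup>2) powr (- real DIM('a) / 2) = r powr (- real DIM('a))"
    using assms powr_powr[of r 2 "- real DIM('a) / 2"] by simp
  finally show ?thesis .
qed

text \<open>All errors of \<open>one_scale\<close> are made small in turn: \<eta> settles the error
  per collision and determines \<kappa> and the freezing constant; \<epsilon> settles the kernel
  tail before the collision; only then is \<open>N\<close> taken large. \<open>K\<close> is a
  natural number because the chaining grid has K N cells.\<close>

lemma collision_limit:
  fixes g :: "real \<times> 'a \<Rightarrow> real" and r :: "nat \<Rightarrow> real" and K :: nat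
  assumes d: "DIM('a) \<ge> 3" and x12: "x1 \<noteq> x2"
    and \<alpha>: "\<alpha> < 1 / 2" and r: "\<And>N. N \<ge> 1 \<Longrightarrow> r N > 0" "\<And>N. N \<ge> 1 \<Longrightarrow> r N > real N powr (- \<alpha>)" "r \<longlonglongrightarrow> 0"
    and t0: "0 < t0" and t1: "t1 < real K"
    and g: "uniformly_continuous_on UNIV g" and G: "\<And>p. \<bar>g p\<bar> \<le> G" and supp: "\<And>t z. t \<notin> {t0..t1} \<Longrightarrow> g (t, z) = 0"
  shows "(\<lambda>N. r N powr (2 - real DIM('a)) * expectation (hit_value g (real K) (r N) N)) \<longlonglongrightarrow>
    diffusivity * collision_const DIM('a) * 
    (LINT t:{t0..t1}|lborel. LINT z|lborel. gauss ((b1 / l1)\<^sup>2 * t) (z - x1) * gauss ((b2 / l2)\<^sup>2 * t) (z - x2) * g (t, z))"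
proof -
  define D where "D = real DIM('a)"
  define ac where "ac = diffusivity * collision_const DIM('a)"
  define I where "I = (LINT t:{t0..t1}|lborel. LINT z|lborel. gauss ((b1 / l1)\<^sup>2 * t) (z - x1) * gauss ((b2 / l2)\<^sup>2 * t) (z - x2) * g (t, z))"
  have D3: "D \<ge> 3" using d by (simp add: D_def)
  have ac: "ac > 0" using diffusivity_pos collision_const_pos[OF d] by (simp add: ac_def)
  have gc: "continuous_on UNIV g" using g by (rule uniformly_continuous_imp_continuous)
  have G0: "0 \<le> G" using order_trans[OF abs_ge_zero G] .
  obtain C0 where C0: "C0 > 0" "\<And>s. s > 0 \<Longrightarrow> gauss s (x1 - x2) \<le> C0" using gauss_bounded_off_origin[of "x1 - x2"] x12 by auto
  define P where "P = 2 * ac * (real K * C0)"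
  have P0: "0 \<le> P" using ac C0 by (simp add: P_def)
  have main: "eventually (\<lambda>N. \<bar>r N powr (2 - D) * expectation (hit_value g (real K) (r N) N) - ac * I\<bar> < e) sequentially" if e: "e > 0" for e
  proof -
    \<comment> \<open>The error (3 + G) \<eta> r^(2-d) is paid with probability at most P r^(d-2),
      so its total is (3 + G) \<eta> P, and the choice brings this below e / 8. The 1 keeps the
      denominator positive.\<close>
    define \<eta> where "\<eta> = min (1/2) (e / (8 * ((3 + G) * P + 1)))"
    have den: "(3 + G) * P + 1 > 0" using G0 P0 by (simp add: add_nonneg_pos)
    have "0 < \<eta>" using e den by (simp add: \<eta>_def)
    moreover have "\<eta> \<le> 1/2" unfolding \<eta>_def by (rule min.cobounded1)
    ultimately have \<eta>: "0 < \<eta>" "\<eta> \<le> 1/2" by auto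
    have \<eta>e: "(3 + G) * \<eta> * P \<le> e / 8"
    proof -
      have "\<eta> \<le> e / (8 * ((3 + G) * P + 1))" unfolding \<eta>_def by (rule min.cobounded2)
      moreover have "0 < 8 * ((3 + G) * P + 1)" by (rule mult_pos_pos[OF _ den]) simp
      ultimately have "\<eta> * (8 * ((3 + G) * P + 1)) \<le> e" by (simp only: pos_le_divide_eq)
      then have "((3 + G) * P + 1) * \<eta> \<le> e / 8" by (simp add: algebra_simps)
      moreover have "(3 + G) * \<eta> * P \<le> ((3 + G) * P + 1) * \<eta>" using \<eta> by (simp add: algebra_simps)
      ultimately show ?thesis by linarith
    qed
    obtain dd where dd: "dd > 0" "\<And>p p'. dist p' p < dd \<Longrightarrow> dist (g p') (g p) < \<eta>"
      using g \<eta>(1) unfolding uniformly_continuous_on_def by (metis UNIV_I)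
    \<comment> \<open>A third suffices: the distance of two pairs is at most the sum of the two
      coordinate distances, hence at most 2 \<open>dd\<close> / 3.\<close>
    define \<kappa> where "\<kappa> = dd / 3"
    have \<kappa>: "\<kappa> > 0" using dd by (simp add: \<kappa>_def)
    have mod: "\<bar>g (t, z) - g (t', z')\<bar> \<le> \<eta>" if "\<bar>t - t'\<bar> \<le> \<kappa>" "norm (z - z') \<le> \<kappa>" for t t' z z'
    proof -
      have "dist (t, z) (t', z') \<le> dist t t' + dist z z'" by (simp add: dist_Pair_Pair sqrt_sum_squares_le_sum)
      also have "\<dots> < dd" using that dd(1) by (simp add: dist_norm \<kappa>_def)
      finally show ?thesis using dd(2) by (force simp: dist_real_def)
    qed
    obtain Cf where Cf: "Cf \<ge> 0" and freeze: "\<And>\<delta> u s w. \<delta> > 0 \<Longrightarrow> u \<ge> 0 \<Longrightarrow> 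
      \<bar>(LINT z|std_gauss. g (s + u, center (w + sqrt u *\<^sub>R z)) * gauss \<delta> (separation (w + sqrt u *\<^sub>R z))) 
      - g (s, center w) * gauss (\<delta> + diffusivity * u) (separation w)\<bar>
     \<le> \<eta> * gauss (\<delta> + diffusivity * u) (separation w) + Cf"
    proof -
      obtain C where "C \<ge> 0" and *: "\<forall>g :: real \<times> 'a \<Rightarrow> real. \<forall>\<eta> \<delta> u s w. continuous_on UNIV g \<longrightarrow> (\<forall>p. \<bar>g p\<bar> \<le> G) \<longrightarrow> 
        (\<forall>t t' z z'. \<bar>t - t'\<bar> \<le> \<kappa> \<longrightarrow> norm (z - z') \<le> \<kappa> \<longrightarrow> \<bar>g (t, z) - g (t', z')\<bar> \<le> \<eta>) \<longrightarrow> \<delta> > 0 \<longrightarrow> u \<ge> 0 \<longrightarrow>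
        \<bar>(LINT z|std_gauss. g (s + u, center (w + sqrt u *\<^sub>R z)) * gauss \<delta> (separation (w + sqrt u *\<^sub>R z))) 
        - g (s, center w) * gauss (\<delta> + diffusivity * u) (separation w)\<bar>
        \<le> \<eta> * gauss (\<delta> + diffusivity * u) (separation w) + C"
        using heat_freeze[OF \<kappa>, of G] by blast
      show ?thesis
        by (rule that[OF \<open>C \<ge> 0\<close>], rule *[rule_format, OF gc]) (use G mod in auto)
    qed
    obtain \<epsilon>0 where \<epsilon>0: "\<epsilon>0 > 0" "\<epsilon>0 \<le> 1/2" and kt: "\<And>\<epsilon>. 0 < \<epsilon> \<Longrightarrow> \<epsilon> \<le> \<epsilon>0 \<Longrightarrow> \<exists>r0>0. \<forall>r y s. 0 < r \<longrightarrow> r \<le> r0 \<longrightarrow> (1 - \<epsilon>) * r \<le> norm (y::'a) \<longrightarrow> norm y \<le> (1 + \<epsilon>) * r \<longrightarrow> s \<le> t1 \<longrightarrow>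
      \<bar>diffusivity * collision_const DIM('a) * kernel_time (real K) ((\<epsilon> * r)\<^sup>2) s y - r powr (2 - real DIM('a))\<bar> \<le> \<eta> * r powr (2 - real DIM('a))"
      using kernel_time_estimate[OF d t1 \<eta>(1)] by blast
    define E0 where "E0 \<epsilon> = 2 powr (real DIM('a) / 2) * exp (- (1 - \<epsilon>)\<^sup>2 / (4 * \<epsilon>\<^sup>2))" for \<epsilon> :: real
    have "((\<lambda>\<epsilon>::real. exp (- (1 - \<epsilon>)\<^sup>2 / (4 * \<epsilon>\<^sup>2))) \<longlongrightarrow> 0) (at_right 0)" by real_asymp
    then have "((\<lambda>\<epsilon>. ac * G * C0 * real K * 2 powr (real DIM('a) / 2) * exp (- (1 - \<epsilon>)\<^sup>2 / (4 * \<epsilon>\<^sup>2))) \<longlongrightarrow> 0) (at_right 0)"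
      by (rule tendsto_mult_right_zero)
    then have "eventually (\<lambda>\<epsilon>. ac * G * C0 * real K * 2 powr (real DIM('a) / 2) * exp (- (1 - \<epsilon>)\<^sup>2 / (4 * \<epsilon>\<^sup>2)) < e / 8) (at_right 0)"
      using e by (intro order_tendstoD(2)) auto
    then obtain \<epsilon>1 where \<epsilon>1: "\<epsilon>1 > 0" "\<And>\<epsilon>. 0 < \<epsilon> \<Longrightarrow> \<epsilon> < \<epsilon>1 \<Longrightarrow> ac * G * C0 * real K * 2 powr (real DIM('a) / 2) * exp (- (1 - \<epsilon>)\<^sup>2 / (4 * \<epsilon>\<^sup>2)) < e / 8"
      by (auto simp: eventually_at_right[of 0 1])
    define \<epsilon> where "\<epsilon> = min \<epsilon>0 (\<epsilon>1 / 2)"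
    have \<epsilon>: "0 < \<epsilon>" "\<epsilon> \<le> \<epsilon>0" "\<epsilon> < \<epsilon>1" "\<epsilon> \<le> 1/2" using \<epsilon>0 \<epsilon>1 by (auto simp: \<epsilon>_def)
    have E0e: "ac * (G * (E0 \<epsilon> * C0) * real K) < e / 8" using \<epsilon>1(2)[OF \<epsilon>(1,3)] by (simp add: E0_def mult_ac)
    obtain r0 where r0: "r0 > 0" and kernel: "\<And>r y s. 0 < r \<Longrightarrow> r \<le> r0 \<Longrightarrow> (1 - \<epsilon>) * r \<le> norm (y::'a) \<Longrightarrow> norm y \<le> (1 + \<epsilon>) * r \<Longrightarrow> s \<le> t1 \<Longrightarrow>
      \<bar>diffusivity * collision_const DIM('a) * kernel_time (real K) ((\<epsilon> * r)\<^sup>2) s y - r powr (2 - real DIM('a))\<bar> \<le> \<eta> * r powr (2 - real DIM('a))"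
      using kt[OF \<epsilon>(1,2)] by blast
    \<comment> \<open>Each particle then lags by at most \<epsilon> r / 2, so the gap between the
      two is off by at most \<epsilon> r.\<close>
    define c where "c = \<epsilon> / (2 * lag_const)"
    have c: "c > 0" using \<epsilon> lag_const_pos by (simp add: c_def)
    define p where "p N = prob (space M - chain_event K N (c * r N))" for N
    define cL where "cL = (2 * pi * \<epsilon>\<^sup>2) powr (- real DIM('a) / 2)"
    define occ where "occ N = (LINT t|time_measure (real K). expectation (\<lambda>\<omega>. g (t, center (W (max 0 t) \<omega>)) * gauss ((\<epsilon> * r N)\<^sup>2) (separation (W (max 0 t) \<omega>))))" for N
    have occ_lim: "occ \<longlonglongrightarrow> I"
    proof -
      \<comment> \<open>Nothing is known about \<open>r 0\<close>. The value 1 makes the sequence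
        positive at every index, as \<open>occupation_limit\<close> demands, without affecting the
        limit.\<close>
      define \<delta> where "\<delta> N = (if N = 0 then 1 else (\<epsilon> * r N)\<^sup>2)" for N
      have dp: "\<delta> N > 0" for N using r(1)[of N] \<epsilon> by (cases N) (auto simp: \<delta>_def)
      have ev: "eventually (\<lambda>N. (\<epsilon> * r N)\<^sup>2 = \<delta> N) sequentially"
        using eventually_gt_at_top[of 0] by eventually_elim (simp add: \<delta>_def)
      have "(\<lambda>N. (\<epsilon> * r N)\<^sup>2) \<longlonglongrightarrow> (\<epsilon> * 0)\<^sup>2" by (intro tendsto_intros r)
      then have "\<delta> \<longlonglongrightarrow> 0" using ev by (simp add: tendsto_cong[OF ev])
      from occupation_limit[OF gc G supp t0 t1 _ dp this]
      have "(\<lambda>n. LINT t|time_measure (real K). expectation (\<lambda>\<omega>. g (t, center (W (max 0 t) \<omega>)) * gauss (\<delta> n) (separation (W (max 0 t) \<omega>)))) \<longlonglongrightarrow> I"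
        unfolding I_def by simp
      then show ?thesis unfolding occ_def
        by (rule Lim_transform_eventually) (use ev in \<open>eventually_elim, simp\<close>)
    qed
    have ev_occ: "eventually (\<lambda>N. \<bar>ac * occ N - ac * I\<bar> < e / 8) sequentially"
    proof -
      have "(\<lambda>N. ac * occ N) \<longlonglongrightarrow> ac * I" by (intro tendsto_intros occ_lim)
      then show ?thesis using e tendstoD[of "\<lambda>N. ac * occ N" "ac * I" sequentially "e / 8"] by (simp add: dist_real_def)
    qed
    have ev_r: "eventually (\<lambda>N. r N < x) sequentially" if "x > 0" for x
      using r(3) that by (rule order_tendstoD(2))
    have ev_Cf: "eventually (\<lambda>N. ac * Cf * real K * P * r N powr (D - 2) < e / 8) sequentially"
    proof -
      have "(\<lambda>N. r N powr (D - 2)) \<longlonglongrightarrow> 0 powr (D - 2)"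
      proof (rule tendsto_powr2[OF r(3) tendsto_const])
        show "eventually (\<lambda>N. 0 \<le> r N) sequentially"
          using eventually_ge_at_top[of 1] by eventually_elim (use r(1) in \<open>auto intro: less_imp_le\<close>)
      qed (use D3 in simp)
      then have "(\<lambda>N. ac * Cf * real K * P * r N powr (D - 2)) \<longlonglongrightarrow> 0" by (intro tendsto_mult_right_zero) simp
      then show ?thesis using e by (intro order_tendstoD(2)) auto
    qed
    \<comment> \<open>The power r^(-d) dominates both the kernel height \<open>L\<close> and, for r
      < 1, the factor r^(2-d). The 2 arises because \<open>L\<close> enters both before and after
      the collision.\<close>
    have ev_p: "eventually (\<lambda>N. (2 * ac * G * real K * cL + G) * (r N powr (- D) * p N) < e / 8) sequentially"
    proof -
      have "(\<lambda>N. r N powr (- D) * p N) \<longlonglongrightarrow> 0" unfolding p_def using D3 by (intro chain_complement_prob[OF \<alpha> r(1,2) _ c]) auto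
      then have "(\<lambda>N. (2 * ac * G * real K * cL + G) * (r N powr (- D) * p N)) \<longlonglongrightarrow> 0" by (rule tendsto_mult_right_zero)
      then show ?thesis using e by (intro order_tendstoD(2)) auto
    qed
    have nx: "0 < norm (x1 - x2)" using x12 by simp
    show ?thesis
      using eventually_ge_at_top[of 1] ev_r[OF r0] ev_r[OF nx] ev_r[OF zero_less_one] ev_r[OF \<kappa>] ev_occ ev_Cf ev_p
    proof eventually_elim
      case (elim N)
      have N: "N \<ge> 1" and rp: "r N > 0" and r0N: "r N \<le> r0" and rx: "r N < norm (x1 - x2)" and r1: "r N < 1" and r\<kappa>: "r N < \<kappa>"
        using elim r by auto
      define h where "h = hit (real K) (r N) N"
      define Om where "Om = chain_event K N (c * r N)"
      define Y where "Y = hit_value g (real K) (r N) N"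
      have OmM: "\<omega> \<in> space M" if "\<omega> \<in> Om" for \<omega> using that by (simp add: Om_def chain_event_def)
      have K0: "0 \<le> real K" by simp
      have lag: "lag_const * (c * r N) = \<epsilon> * r N / 2" using lag_const_pos by (simp add: c_def)
      have close: "norm (pos1 N t \<omega> - (x1 + (b1 / l1) *\<^sub>R fst (W t \<omega>))) \<le> \<epsilon> * r N / 2" 
         "norm (pos2 N t \<omega> - (x2 + (b2 / l2) *\<^sub>R snd (W t \<omega>))) \<le> \<epsilon> * r N / 2" if "\<omega> \<in> Om" "0 \<le> t" "t \<le> real K" for t \<omega>
        using pos_close[of \<omega> K N "c * r N" t] that N c rp unfolding Om_def lag by auto
      have gap: "\<bar>norm (pos1 N t \<omega> - pos2 N t \<omega>) - norm (separation (W t \<omega>))\<bar> \<le> \<epsilon> * r N" if "\<omega> \<in> Om" "0 \<le> t" "t \<le> real K" for t \<omega>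
      proof -
        have "\<bar>norm (pos1 N t \<omega> - pos2 N t \<omega>) - norm (separation (W t \<omega>))\<bar> \<le> norm ((pos1 N t \<omega> - pos2 N t \<omega>) - separation (W t \<omega>))"
          by (rule norm_triangle_ineq3)
        also have "(pos1 N t \<omega> - pos2 N t \<omega>) - separation (W t \<omega>) = (pos1 N t \<omega> - (x1 + (b1 / l1) *\<^sub>R fst (W t \<omega>))) - (pos2 N t \<omega> - (x2 + (b2 / l2) *\<^sub>R snd (W t \<omega>)))"
          by (simp add: separation_def)
        also have "norm \<dots> \<le> \<epsilon> * r N / 2 + \<epsilon> * r N / 2"
          by (intro order_trans[OF norm_triangle_ineq4] add_mono close that)
        finally show ?thesis by simp
      qed
      have stop: "{\<omega> \<in> space M. h \<omega> \<le> s} \<in> sets (Fil s)" if "0 \<le> s" for s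
        unfolding h_def by (rule hit_stopping[OF that K0])
      have hb: "0 \<le> h \<omega>" "h \<omega> \<le> real K" if "\<omega> \<in> space M" for \<omega>
        unfolding h_def using hit_bounds[OF that K0] by auto
      have far: "(1 - \<epsilon>) * r N \<le> norm (separation (W t \<omega>))" if "\<omega> \<in> Om" "0 \<le> t" "t < h \<omega>" for \<omega> t
      proof -
        have "norm (pos1 N t \<omega> - pos2 N t \<omega>) > r N"
          using before_hit_time[OF gap_continuous[OF OmM[OF that(1)]] K0 that(2)] that(3) unfolding h_def hit_def by simp
        then show ?thesis using gap[of \<omega> t] that hb[OF OmM[OF that(1)]] by (simp add: left_diff_distrib)
      qed
      have near: "(1 - \<epsilon>) * r N \<le> norm (separation (W (h \<omega>) \<omega>)) \<and> norm (separation (W (h \<omega>) \<omega>)) \<le> (1 + \<epsilon>) * r N" if "\<omega> \<in> Om" "h \<omega> \<le> t1" for \<omega>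
      proof -
        \<comment> \<open>Equality needs a hit before the cap, from \<open>t1\<close> <
          \<open>K\<close>, and a start at distance more than \<open>r N\<close>, which holds for
          large \<open>N\<close>.\<close>
        have "norm (pos1 N (h \<omega>) \<omega> - pos2 N (h \<omega>) \<omega>) = r N"
          using norm_at_hit_time[OF gap_continuous[OF OmM[OF that(1)]] K0, of "r N" N] that(2) t1 rx unfolding h_def hit_def by simp
        then show ?thesis using gap[of \<omega> "h \<omega>"] that hb[OF OmM[OF that(1)]] by (simp add: left_diff_distrib distrib_right abs_le_iff)
      qed
      have \<delta>p: "0 < (\<epsilon> * r N)\<^sup>2" using \<epsilon> rp by simp
      have Ym: "Y \<in> borel_measurable M" unfolding Y_def by (rule hit_value_measurable[OF gc K0])
      have Yb: "\<bar>Y \<omega>\<bar> \<le> G" for \<omega> unfolding Y_def hit_value_def by (rule G)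
      have Y0: "Y \<omega> = 0" if "h \<omega> > t1" for \<omega>
        unfolding Y_def hit_value_def using that supp by (simp add: h_def)
      have Yc: "\<bar>Y \<omega> - g (h \<omega>, center (W (h \<omega>) \<omega>))\<bar> \<le> \<eta>" if "\<omega> \<in> Om" for \<omega>
        unfolding Y_def hit_value_def h_def[symmetric]
      proof (rule mod)
        have "\<epsilon> * r N \<le> 1 * r N" using \<epsilon> rp by (intro mult_right_mono) auto
        then have "\<epsilon> * r N / 2 \<le> \<kappa>" using rp r\<kappa> by linarith
        then show "norm ((y1 *\<^sub>R pos1 N (h \<omega>) \<omega> + y2 *\<^sub>R pos2 N (h \<omega>) \<omega>) /\<^sub>R (y1 + y2) - center (W (h \<omega>) \<omega>)) \<le> \<kappa>"
          using mix_close[OF close[OF that hb[OF OmM[OF that]]]] by linarith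
      qed (use \<kappa> in simp)
      have suppt: "g (t, z) = 0" if "t > t1" for t z using supp that by simp
      have OmS: "Om \<in> sets M" unfolding Om_def by (rule chain_event_sets)
      define R where "R = r N powr (2 - D)"
      define L where "L = (2 * pi * (\<epsilon> * r N)\<^sup>2) powr (- real DIM('a) / 2)"
      define Pn where "Pn = prob {\<omega> \<in> space M. \<omega> \<in> Om \<and> h \<omega> \<le> t1}"
      note kern = kernel[OF rp r0N]
      have os: "\<bar>ac * occ N - R * expectation Y\<bar> \<le> ac * (G * (E0 \<epsilon> * C0 + L * p N) * real K) + ((3 + G) * \<eta> * R + ac * Cf * real K) * Pn + (ac * (G * L * real K) + R * G) * p N"
        unfolding ac_def occ_def R_def D_def L_def Pn_def E0_def p_def Om_def[symmetric]
        by (rule one_scale[where h=h and Om=Om and r="r N" and \<epsilon>=\<epsilon> and \<eta>=\<eta> and K="real K" and ?t1.0=t1 and ?C0.0=C0 and \<delta>="(\<epsilon> * r N)\<^sup>2" and g=g and Y=Y and Cf=Cf and G=G,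
              OF d rp \<epsilon>(1) \<epsilon>(4) refl stop hb OmS K0 t1 far near C0(2) \<eta> kern gc G suppt freeze[OF \<delta>p] Cf Ym Yb Y0 Yc])
      have Pn: "Pn \<le> P * r N powr (D - 2)"
        unfolding Pn_def P_def ac_def D_def
        by (rule hit_probability[where h=h and Om=Om and r="r N" and \<epsilon>=\<epsilon> and \<eta>=\<eta> and K="real K" and ?t1.0=t1 and ?C0.0=C0 and \<delta>="(\<epsilon> * r N)\<^sup>2",
              OF d rp \<epsilon>(1) \<epsilon>(4) refl stop hb OmS K0 t1 far near C0(2) \<eta> kern])
      have Rr: "R * r N powr (D - 2) = 1" unfolding R_def using rp by (simp add: powr_add[symmetric])
      have Rp: "0 \<le> R" by (simp add: R_def)
      have RL: "R \<le> r N powr (- D)" unfolding R_def using rp r1 by (intro powr_mono') auto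
      have Leq: "L = cL * r N powr (- D)" unfolding L_def cL_def D_def by (rule kernel_scale[OF \<epsilon>(1) rp])
      have pn0: "0 \<le> p N" by (simp add: p_def)
      have t3: "((3 + G) * \<eta> * R + ac * Cf * real K) * Pn \<le> e / 8 + e / 8"
      proof -
        have "((3 + G) * \<eta> * R + ac * Cf * real K) * Pn \<le> ((3 + G) * \<eta> * R + ac * Cf * real K) * (P * r N powr (D - 2))"
          using G0 \<eta> Rp ac Cf by (intro mult_left_mono Pn) auto
        also have "\<dots> = (3 + G) * \<eta> * P * (R * r N powr (D - 2)) + ac * Cf * real K * P * r N powr (D - 2)"
          by (simp add: algebra_simps)
        also have "\<dots> \<le> e / 8 + e / 8" unfolding Rr using \<eta>e elim(7) by simp
        finally show ?thesis .
      qed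
      have t24: "ac * (G * (L * p N) * real K) + (ac * (G * L * real K) + R * G) * p N \<le> e / 8"
      proof -
        have "R * G * p N \<le> r N powr (- D) * G * p N" using RL G0 pn0 by (intro mult_right_mono) auto
        then have "ac * (G * (L * p N) * real K) + (ac * (G * L * real K) + R * G) * p N \<le> (2 * ac * G * real K * cL + G) * (r N powr (- D) * p N)"
          unfolding Leq by (simp add: algebra_simps)
        then show ?thesis using elim(8) by linarith
      qed
      \<comment> \<open>Four eighths here, and a fifth from the convergence of the occupation
        integral, stay below \<open>e\<close>.\<close>
      have "\<bar>ac * occ N - R * expectation Y\<bar> \<le> e / 8 + e / 8 + e / 8 + e / 8"
        using os t3 t24 E0e by (simp add: distrib_left distrib_right)
      then have "\<bar>R * expectation Y - ac * I\<bar> < e" using elim(6) e by linarith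
      then show ?case by (simp add: R_def Y_def)
    qed
  qed
  have "(\<lambda>N. r N powr (2 - D) * expectation (hit_value g (real K) (r N) N)) \<longlonglongrightarrow> ac * I"
    by (rule tendstoI) (use main in \<open>simp add: dist_real_def\<close>)
  then show ?thesis by (simp add: D_def ac_def I_def)
qed

end

section \<open>Transfer from the explicit solution to the given processes\<close>

lemma borel_measurable_completion_AE_eq:
  fixes f h :: "'w \<Rightarrow> 'b::topological_space"
  assumes f: "f \<in> borel_measurable M" and ae: "AE \<omega> in M. h \<omega> = f \<omega>"
  shows "h \<in> borel_measurable (completion M)"
proof (rule measurableI)
  fix A :: "'b set" assume A: "A \<in> sets borel"
  show "h -` A \<inter> space (completion M) \<in> sets (completion M)"
  proof (rule completion.in_sets_AE)
    show "AE \<omega> in completion M. (\<omega> \<in> f -` A \<inter> space M) = (\<omega> \<in> h -` A \<inter> space (completion M))"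
      using AE_completion[OF ae] by eventually_elim simp
    show "f -` A \<inter> space M \<in> sets (completion M)"
      using measurable_sets[OF f A] by (rule sets_completionI_sets)
  qed simp
qed simp

lemma hit_time_cong:
  assumes "\<And>t. 0 \<le> t \<Longrightarrow> p t = q t"
  shows "hit_time K r p = hit_time K r q"
proof -
  have "{t. 0 \<le> t \<and> norm (p t) \<le> r} = {t. 0 \<le> t \<and> norm (q t) \<le> r}" using assms by auto
  then show ?thesis by (simp add: hit_time_def)
qed

theorem theorem2p4:
  fixes M :: "'w measure"
    and B :: "nat \<Rightarrow> real \<Rightarrow> 'w \<Rightarrow> real ^ 'd"
    and V X :: "nat \<Rightarrow> nat \<Rightarrow> real \<Rightarrow> 'w \<Rightarrow> real ^ 'd"
    and x :: "nat \<Rightarrow> real ^ 'd"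
    and y \<tau> b :: "nat \<Rightarrow> real"
    and r :: "nat \<Rightarrow> real"
    and \<alpha> t0 t1 :: real
    and g :: "real \<times> (real ^ 'd) \<Rightarrow> real"
  assumes dim: "CARD('d) \<ge> 3"
    and pos: "\<And>i. i \<in> {1, 2} \<Longrightarrow> y i > 0 \<and> \<tau> i > 0 \<and> b i > 0"
    and start: "x 1 \<noteq> x 2"
    and prob: "prob_space M"
    and bm: "\<And>i. i \<in> {1, 2} \<Longrightarrow> std_brownian_motion M (B i)"
    and indep: "prob_space.indep_vars M (\<lambda>_. Pi\<^sub>M {0..} (\<lambda>_. borel))
                  (\<lambda>i \<omega>. \<lambda>t\<in>{0..}. B i t \<omega>) {1, 2}"
    and ou: "\<And>N i. N \<ge> 1 \<Longrightarrow> i \<in> {1, 2} \<Longrightarrow>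
               ou_process M (B i) (real N * b i) (real N * \<tau> i) (x i) (V N i) (X N i)"
    and r_pos: "\<And>N. N \<ge> 1 \<Longrightarrow> r N > 0"
    and alpha: "\<alpha> < 1 / 2"
    and r_lower: "\<And>N. N \<ge> 1 \<Longrightarrow> r N > real N powr (- \<alpha>)"
    and r_lim: "r \<longlonglongrightarrow> 0"
    and times: "0 < t0" "t0 < t1"
    and g_cont: "uniformly_continuous_on ({0..} \<times> UNIV) g"
    and g_bdd: "bounded (g ` ({0..} \<times> UNIV))"
    and g_supp: "\<And>t z. 0 \<le> t \<Longrightarrow> t \<notin> {t0..t1} \<Longrightarrow> g (t, z) = 0"
  shows "(\<lambda>N. \<bar>r N powr (2 - real CARD('d)) *
              (LINT \<omega>|completion M.
                 collision_value g (y 1) (y 2) (r N) (\<lambda>t. X N 1 t \<omega>) (\<lambda>t. X N 2 t \<omega>))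
            - collision_const CARD('d) * ((b 1 / \<tau> 1)\<^sup>2 + (b 2 / \<tau> 2)\<^sup>2) *
              (LINT t:{t0..t1}|lborel. LINT z|lborel.
                 bm_density ((b 1 / \<tau> 1)\<^sup>2) 0 (x 1) t z *
                 bm_density ((b 2 / \<tau> 2)\<^sup>2) 0 (x 2) t z * g (t, z))\<bar>)
         \<longlonglongrightarrow> 0"
proof -
  interpret prob_space M by (rule prob)
  note [simp del] = One_nat_def
  obtain Fil W where W: "brownian M Fil W" and W_AE: "AE \<omega> in M. \<forall>t\<ge>0. W t \<omega> = (B 1 t \<omega>, B 2 t \<omega>)"
    using brownian_pair_exists[OF prob bm indep] by blast
  have pos12: "y 1 > 0" "\<tau> 1 > 0" "b 1 > 0" "y 2 > 0" "\<tau> 2 > 0" "b 2 > 0" using pos[of 1] pos[of 2] by simp_all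
  interpret o: ou_pair M Fil W "x 1" "x 2" "b 1" "\<tau> 1" "b 2" "\<tau> 2" "y 1" "y 2"
    using W pos12 by (intro ou_pair.intro brownian_pair.intro pair_geometry.intro ou_pair_axioms.intro) simp_all
  \<comment> \<open>Extends \<open>g\<close> to negative times by its value at time 0, which is 0
    because \<open>t0\<close> > 0. Clamping time does not increase distances, so uniform continuity
    survives.\<close>
  define g' where "g' p = g (max 0 (fst p), snd p)" for p
  \<comment> \<open>The added 1 puts the cap strictly after \<open>t1\<close>.\<close>
  define K where "K = nat \<lceil>t1\<rceil> + 1"
  have K: "t1 < real K" unfolding K_def using times by linarith
  have g'_cont: "uniformly_continuous_on UNIV g'"
    unfolding uniformly_continuous_on_def
  proof (intro allI impI)
    fix e :: real assume "e > 0"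
    then obtain d where d: "d > 0" "\<And>p p'. p \<in> {0..} \<times> UNIV \<Longrightarrow> p' \<in> {0..} \<times> UNIV \<Longrightarrow> dist p' p < d \<Longrightarrow> dist (g p') (g p) < e"
      using g_cont unfolding uniformly_continuous_on_def by metis
    have "dist (g' p') (g' p) < e" if "dist p' p < d" for p p' :: "real \<times> (real ^ 'd)"
    proof -
      have "dist (max 0 (fst p'), snd p') (max 0 (fst p), snd p) \<le> dist p' p"
        unfolding dist_prod_def fst_conv snd_conv
        by (intro real_sqrt_le_mono add_mono power_mono) (auto simp: dist_real_def max_def)
      then show ?thesis unfolding g'_def using that by (intro d) auto
    qed
    then show "\<exists>d>0. \<forall>x\<in>UNIV. \<forall>x'\<in>UNIV. dist x' x < d \<longrightarrow> dist (g' x') (g' x) < e" using d(1) by blast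
  qed
  obtain G where "\<And>p. p \<in> {0..} \<times> UNIV \<Longrightarrow> \<bar>g p\<bar> \<le> G"
    using g_bdd unfolding bounded_iff by auto
  then have G: "\<bar>g' p\<bar> \<le> G" for p by (simp add: g'_def)
  have g'_supp: "g' (t, z) = 0" if "t \<notin> {t0..t1}" for t z
    unfolding g'_def using that times by (intro g_supp) (auto simp: max_def)
  have value_AE: "AE \<omega> in M. \<forall>N\<ge>1. collision_value g (y 1) (y 2) (r N) (\<lambda>t. X N 1 t \<omega>) (\<lambda>t. X N 2 t \<omega>) = o.hit_value g' (real K) (r N) N \<omega>"
  proof -
    define ou_path where "ou_path N i \<omega> \<longleftrightarrow> 
      continuous_on {0..} (\<lambda>t. V N i t \<omega>) \<and> V N i 0 \<omega> = 0 \<and> X N i 0 \<omega> = x i \<and>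
      (\<forall>t\<ge>0. V N i t \<omega> = (real N * b i) *\<^sub>R (B i t \<omega> - B i 0 \<omega>) - (real N * \<tau> i) *\<^sub>R integral {0..t} (\<lambda>s. V N i s \<omega>)) \<and>
      (\<forall>t\<ge>0. X N i t \<omega> = x i + integral {0..t} (\<lambda>s. V N i s \<omega>))" for N i \<omega>
    \<comment> \<open>For \<open>N\<close> = 0 nothing is assumed about the processes. Over the
      remaining countably many \<open>N\<close> the exceptional null sets are united into
      one.\<close>
    have "AE \<omega> in M. N \<ge> 1 \<longrightarrow> ou_path N 1 \<omega> \<and> ou_path N 2 \<omega>" for N
      using ou[of N 1] ou[of N 2] unfolding ou_process_def ou_path_def by (cases "N \<ge> 1") auto
    then have "AE \<omega> in M. \<forall>N. N \<ge> 1 \<longrightarrow> ou_path N 1 \<omega> \<and> ou_path N 2 \<omega>" by (simp add: AE_all_countable)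
    then show ?thesis using W_AE AE_space
    proof eventually_elim
      case (elim \<omega>)
      show ?case
      proof (intro allI impI)
        fix N :: nat assume N: "N \<ge> 1"
        have B0: "B 1 0 \<omega> = 0" "B 2 0 \<omega> = 0" using o.start[OF elim(3)] elim(2) by (auto simp: zero_prod_def)
        have p1: "X N 1 t \<omega> = o.pos1 N t \<omega>" if t: "0 \<le> t" for t
        proof -
          have path: "ou_path N 1 \<omega>" using elim(1) N by blast
          have "integral {0..t} (\<lambda>s. V N 1 s \<omega>) = (real N * b 1) *\<^sub>R memory (real N * \<tau> 1) (\<lambda>s. fst (W s \<omega>)) t"
          proof (rule ou_integral_eq_memory[OF _ _ t])
            show "continuous_on {0..} (\<lambda>s. V N 1 s \<omega>)" using path by (simp add: ou_path_def)
            show "V N 1 s \<omega> = (real N * b 1) *\<^sub>R fst (W s \<omega>) - (real N * \<tau> 1) *\<^sub>R integral {0..s} (\<lambda>s. V N 1 s \<omega>)" if "0 \<le> s" for s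
            proof -
              have "V N 1 s \<omega> = (real N * b 1) *\<^sub>R (B 1 s \<omega> - B 1 0 \<omega>) - (real N * \<tau> 1) *\<^sub>R integral {0..s} (\<lambda>s. V N 1 s \<omega>)"
                using path that unfolding ou_path_def by blast
              then show ?thesis using elim(2) that B0 by simp
            qed
          qed
          then show ?thesis using path t by (simp add: ou_path_def o.pos1_def)
        qed
        have p2: "X N 2 t \<omega> = o.pos2 N t \<omega>" if t: "0 \<le> t" for t
        proof -
          have path: "ou_path N 2 \<omega>" using elim(1) N by blast
          have "integral {0..t} (\<lambda>s. V N 2 s \<omega>) = (real N * b 2) *\<^sub>R memory (real N * \<tau> 2) (\<lambda>s. snd (W s \<omega>)) t"
          proof (rule ou_integral_eq_memory[OF _ _ t])
            show "continuous_on {0..} (\<lambda>s. V N 2 s \<omega>)" using path by (simp add: ou_path_def)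
            show "V N 2 s \<omega> = (real N * b 2) *\<^sub>R snd (W s \<omega>) - (real N * \<tau> 2) *\<^sub>R integral {0..s} (\<lambda>s. V N 2 s \<omega>)" if "0 \<le> s" for s
            proof -
              have "V N 2 s \<omega> = (real N * b 2) *\<^sub>R (B 2 s \<omega> - B 2 0 \<omega>) - (real N * \<tau> 2) *\<^sub>R integral {0..s} (\<lambda>s. V N 2 s \<omega>)"
                using path that unfolding ou_path_def by blast
              then show ?thesis using elim(2) that B0 by simp
            qed
          qed
          then show ?thesis using path t by (simp add: ou_path_def o.pos2_def)
        qed
        have c1: "continuous_on {0..} (\<lambda>t. X N 1 t \<omega>)"
          using o.pos_continuous(1)[OF elim(3), of N] by (rule continuous_on_eq) (simp add: p1)
        have c2: "continuous_on {0..} (\<lambda>t. X N 2 t \<omega>)"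
          using o.pos_continuous(2)[OF elim(3), of N] by (rule continuous_on_eq) (simp add: p2)
        have h: "hit_time (real K) (r N) (\<lambda>t. X N 1 t \<omega> - X N 2 t \<omega>) = o.hit (real K) (r N) N \<omega>"
          unfolding o.hit_def by (rule hit_time_cong) (simp add: p1 p2)
        have h0: "0 \<le> o.hit (real K) (r N) N \<omega>" by (rule o.hit_bounds(1)[OF elim(3)]) simp
        have "collision_value g (y 1) (y 2) (r N) (\<lambda>t. X N 1 t \<omega>) (\<lambda>t. X N 2 t \<omega>) = 
          (let h = hit_time (real K) (r N) (\<lambda>t. X N 1 t \<omega> - X N 2 t \<omega>) in g (h, (y 1 *\<^sub>R X N 1 h \<omega> + y 2 *\<^sub>R X N 2 h \<omega>) /\<^sub>R (y 1 + y 2)))"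
          by (rule collision_value_eq_hit_time[where ?t0.0=t0 and ?t1.0=t1]) (use c1 c2 g_supp K in auto)
        then show "collision_value g (y 1) (y 2) (r N) (\<lambda>t. X N 1 t \<omega>) (\<lambda>t. X N 2 t \<omega>) = o.hit_value g' (real K) (r N) N \<omega>"
          unfolding h o.hit_value_def g'_def using h0 by (simp add: Let_def p1 p2 max_def)
      qed
    qed
  qed
  have value_eq: "(LINT \<omega>|completion M. collision_value g (y 1) (y 2) (r N) (\<lambda>t. X N 1 t \<omega>) (\<lambda>t. X N 2 t \<omega>)) = expectation (o.hit_value g' (real K) (r N) N)"
    if N: "N \<ge> 1" for N
  proof -
    have ae: "AE \<omega> in M. collision_value g (y 1) (y 2) (r N) (\<lambda>t. X N 1 t \<omega>) (\<lambda>t. X N 2 t \<omega>) = o.hit_value g' (real K) (r N) N \<omega>"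
      using value_AE by eventually_elim (use N in blast)
    have hm: "o.hit_value g' (real K) (r N) N \<in> borel_measurable M"
      by (rule o.hit_value_measurable[OF uniformly_continuous_imp_continuous[OF g'_cont]]) simp
    \<comment> \<open>The collision value agrees only almost everywhere with a measurable function,
      so its measurability is established for the completion; the integral of the latter function is
      the same over the completion and over \<open>M\<close>.\<close>
    have "(LINT \<omega>|completion M. collision_value g (y 1) (y 2) (r N) (\<lambda>t. X N 1 t \<omega>) (\<lambda>t. X N 2 t \<omega>)) = (LINT \<omega>|completion M. o.hit_value g' (real K) (r N) N \<omega>)"
      by (rule integral_cong_AE[OF borel_measurable_completion_AE_eq[OF hm ae] measurable_completion[OF hm] AE_completion[OF ae]])
    then show ?thesis by (simp add: integral_completion[OF hm])
  qed
  define I where "I = (LINT t:{t0..t1}|lborel. LINT z|lborel. bm_density ((b 1 / \<tau> 1)\<^sup>2) 0 (x 1) t z * bm_density ((b 2 / \<tau> 2)\<^sup>2) 0 (x 2) t z * g (t, z))"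
  have I: "(LINT t:{t0..t1}|lborel. LINT z|lborel. gauss ((b 1 / \<tau> 1)\<^sup>2 * t) (z - x 1) * gauss ((b 2 / \<tau> 2)\<^sup>2 * t) (z - x 2) * g' (t, z)) = I"
    unfolding I_def using times
    by (intro set_lebesgue_integral_cong) (auto simp: bm_density_eq_gauss g'_def max_def)
  have dm: "DIM(real ^ 'd) = CARD('d)" by simp
  have "(\<lambda>N. r N powr (2 - real CARD('d)) * expectation (o.hit_value g' (real K) (r N) N)) \<longlonglongrightarrow>
      o.diffusivity * collision_const CARD('d) * I"
    using o.collision_limit[OF _ start alpha r_pos r_lower r_lim times(1) K g'_cont G g'_supp] dim
    unfolding I dm by simp
  then have "(\<lambda>N. r N powr (2 - real CARD('d)) * (LINT \<omega>|completion M. collision_value g (y 1) (y 2) (r N) (\<lambda>t. X N 1 t \<omega>) (\<lambda>t. X N 2 t \<omega>))) \<longlonglongrightarrow>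
      o.diffusivity * collision_const CARD('d) * I"
  proof (rule Lim_transform_eventually)
    show "eventually (\<lambda>N. r N powr (2 - real CARD('d)) * expectation (o.hit_value g' (real K) (r N) N) = 
      r N powr (2 - real CARD('d)) * (LINT \<omega>|completion M. collision_value g (y 1) (y 2) (r N) (\<lambda>t. X N 1 t \<omega>) (\<lambda>t. X N 2 t \<omega>))) sequentially"
      using eventually_ge_at_top[of 1] by eventually_elim (simp add: value_eq)
  qed
  then have "(\<lambda>N. \<bar>r N powr (2 - real CARD('d)) * (LINT \<omega>|completion M. collision_value g (y 1) (y 2) (r N) (\<lambda>t. X N 1 t \<omega>) (\<lambda>t. X N 2 t \<omega>)) -
      o.diffusivity * collision_const CARD('d) * I\<bar>) \<longlonglongrightarrow> 0"
    by (intro tendsto_rabs_zero) (simp add: LIM_zero)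
  then show ?thesis unfolding I_def o.diffusivity_def by (simp only: mult.commute[of "collision_const CARD('d)"])
qed

end
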